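(* Let $K_4$ be the complete 3-graph on 4 vertices and let $J_4$ be the 3-graph on vertex set $[5]$ whose edges are all triples $\{x,y,5\}$ with $\{x,y\}\subseteq[4]$, $x\ne y$. Then \[\pi(K_4,J_4) < 0.479371 < \frac12 \le \pi(J_4).\]
   Context: A 3-graph $G=(V,E)$ consists of a vertex set $V$ and a set $E$ of 3-element subsets of $V$. For a family $\mathcal{F}$ of 3-graphs, $G$ is $\mathcal{F}$-free if it contains no member of $\mathcal{F}$ as a (not necessarily induced) subgraph. $\mathrm{ex}(n,\mathcal{F})$ is the maximum number of edges of an $\mathcal{F}$-free 3-graph on $n$ vertices, and $\pi(\mathcal{F})=\lim_{n\to\infty}\mathrm{ex}(n,\mathcal{F})/\binom{n}{3}$ (this limit exists). $\pi(H_1,\dots,H_k)$ means $\pi(\{H_1,\dots,H_k\})$. *)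

theory Defs
  imports Complex_Main
begin

record 'a hgraph =
  vertices :: "'a set"
  edges :: "'a set set"

definition three_graph :: "'a hgraph \<Rightarrow> bool" where
  "three_graph G \<longleftrightarrow> (\<forall>e \<in> edges G. e \<subseteq> vertices G \<and> card e = 3)"

definition contains_copy :: "'a hgraph \<Rightarrow> 'b hgraph \<Rightarrow> bool" where
  "contains_copy G H \<longleftrightarrow>
     (\<exists>f. inj_on f (vertices H) \<and> f ` vertices H \<subseteq> vertices G \<and>
          (\<forall>e \<in> edges H. f ` e \<in> edges G))"

definition family_free :: "'b hgraph set \<Rightarrow> 'a hgraph \<Rightarrow> bool" where
  "family_free \<F> G \<longleftrightarrow> (\<forall>H \<in> \<F>. \<not> contains_copy G H)"

text \<open>
  Host graphs have their vertices in \<open>nat\<close>, which is no restriction as they are finite.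
  \<open>Max\<close> is unspecified if no \<open>\<F>\<close>-free 3-graph on \<open>n\<close> vertices exists; this cannot happen
  if every member of \<open>\<F>\<close> has an edge, since then the edgeless 3-graph is \<open>\<F>\<close>-free.
\<close>

definition ex_number :: "nat \<Rightarrow> 'b hgraph set \<Rightarrow> nat" where
  "ex_number n \<F> =
     Max {card (edges G) | G :: nat hgraph.
            three_graph G \<and> finite (vertices G) \<and> card (vertices G) = n \<and> family_free \<F> G}"

definition turan_density :: "'b hgraph set \<Rightarrow> real" where
  "turan_density \<F> = lim (\<lambda>n. real (ex_number n \<F>) / real (n choose 3))"

definition K4 :: "nat hgraph" where
  "K4 = \<lparr>vertices = {1..4}, edges = {e. e \<subseteq> {1..4} \<and> card e = 3}\<rparr>"

definition J4 :: "nat hgraph" where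
  "J4 = \<lparr>vertices = {1..5}, edges = {{x, y, 5} | x y. {x, y} \<subseteq> {1..4} \<and> x \<noteq> y}\<rparr>"

end

theory Submission
  imports Defs
begin

text \<open>
  Upper bound. Being free of \<open>K4\<close> and \<open>J4\<close> is preserved under
  blow-ups, so sampling six vertices with replacement from a free 3-graph \<open>G\<close> on
  \<open>n\<close> vertices always shows a free pattern, and flag algebra identities hold exactly in
  \<open>G\<close>, without error terms. The plain order-six semidefinite bound is just
  \<open>0.479371\<close>, leaving no room for rounding. Instead, it is shown that every free
  \<open>G\<close> has a vertex of degree less than \<open>151/630 n\<^sup>2\<close>; deleting such
  vertices one by one gives the density bound \<open>151/315\<close>. If all degrees were larger,
  then a sum of squares plus nonnegative multiples of the excess degrees, summed over all 6-tuples
  of vertices, would be nonnegative, whereas its symmetrisation is negative on each of the 914 free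
  patterns on six vertices.

  Lower bound. In the complement of the Fano plane every link is
  \<open>K\<^bsub>2,2,2\<^esub>\<close>, which contains no \<open>K\<^bsub>4\<^esub>\<close>;
  iterated blow-ups of it are therefore \<open>J4\<close>-free, and their edge density is at least
  \<open>1/2\<close>.
\<close>

section \<open>Tables of the certificate\<close>

text \<open>In \<open>K4\<close> and in \<open>J4\<close> any two vertices lie in a common edge.
  Sampled vertices that satisfy all edge relations of such a graph are therefore distinct, which is
  why repetitions in a sample create no forbidden pattern. Degree conditions give slack because the
  weight of an excess degree may depend on the pattern around the vertex, whereas a bound on the
  average density could only be multiplied by a constant. The fraction 151/315 = 0.479365... has a
  small denominator and lies just under the target; degrees are counted as ordered pairs, so the
  threshold 151/315 n^2 means 151/630 n^2 edges, and summing 151/630 k^2 over k up to n gives about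
  151/315 * n^3/6. The cost of computing by rewriting shapes the first half: there are 2^20 labelled
  patterns, so branches are cut as soon as a relabelling is larger, and values are assembled from
  tabulated inner products. For the lower bound, 168 of the 7^3 - 7 = 336 nonconstant triples over
  the seven points are ordered edges, a fraction of exactly 1/2, and iteration repeats this fraction
  at every level.\<close>

fun dot :: "int list \<Rightarrow> int list \<Rightarrow> int" where
  "dot (x # xs) (y # ys) = x * y + dot xs ys"
| "dot [] ys = 0"
| "dot (x # xs) [] = 0"

lemma dot_commute: "dot xs ys = dot ys xs"
  by (induction xs ys rule: dot.induct) (auto, metis dot.elims dot.simps(2,3) list.exhaust)

text \<open>As \<open>dot\<close> is symmetric, the tables of the \<open>q i\<close> are computed
  for \<open>lex_le\<close>-ordered arguments only; \<open>flip\<close> keeps the rewriting that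
  swaps the arguments from looping.\<close>

definition flip :: "('a \<Rightarrow> 'a \<Rightarrow> 'b) \<Rightarrow> 'a \<Rightarrow> 'a
  \<Rightarrow> 'b" where
  "flip h x y = h y x"

section \<open>Bit lists and the rules that evaluate tables\<close>

fun bits_nat :: "bool list \<Rightarrow> nat" where
  "bits_nat [] = 0"
| "bits_nat (b # bs) = of_bool b * 2 ^ length bs + bits_nat bs"

definition bools :: "nat \<Rightarrow> bool list list" where
  "bools n = product_lists (replicate n [False, True])"

lemma bools_0: "bools 0 = [[]]"
  by (simp add: bools_def)

lemma bools_Suc: "bools (Suc n) = map ((#) False) (bools n) @ map ((#) True) (bools n)"
  by (simp add: bools_def)

lemma length_bools_element: "bs \<in> set (bools n) \<Longrightarrow> length bs = n"
  by (induction n arbitrary: bs) (auto simp: bools_0 bools_Suc)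

lemma map_bits_nat_bools: "map bits_nat (bools n) = [0..<2 ^ n]"
proof (induction n)
  case 0
  show ?case by (simp add: bools_0)
next
  case (Suc n)
  have "map (bits_nat \<circ> (#) False) (bools n) = map bits_nat (bools n)"
    by simp
  moreover have "map (bits_nat \<circ> (#) True) (bools n) = map ((+) (2 ^ n)) (map bits_nat (bools
    n))"
    by (simp add: length_bools_element)
  moreover have "map ((+) (2 ^ n)) [0..<2 ^ n] = [2 ^ n..<2 ^ n + 2 ^ n]"
    by (rule nth_equalityI) auto
  ultimately show ?case
    using Suc by (simp add: bools_Suc mult_2 upt_add_eq_append[of 0 "2 ^ n" "2 ^ n", simplified])
qed

text \<open>Applied to a table, this gives all values of \<open>F0\<close>, ..., \<open>F4\<close>
  as one list equation; injectivity of the list constructor then splits it into one rewrite rule for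
  each bit list.\<close>

lemma map_nth_bits_nat:
  assumes "length T = 2 ^ n"
  shows "map (\<lambda>u. T ! bits_nat u) (bools n) = T"
proof -
  have "map (\<lambda>u. T ! bits_nat u) (bools n) = map ((!) T) (map bits_nat (bools n))"
    by simp
  then show ?thesis
    using assms by (simp only: map_bits_nat_bools) (metis map_nth)
qed

schematic_goal bools_6: "bools 6 = ?bs"
  by (simp add: numeral_eq_Suc bools_Suc bools_0)

schematic_goal bools_4: "bools 4 = ?bs"
  by (simp add: numeral_eq_Suc bools_Suc bools_0)

text \<open>Expands a statement about all bits into a finite conjunction, which then serves as a
  table of rewrite rules.\<close>

lemma all_bool: "(\<forall>b. P b) \<longleftrightarrow> P True \<and> P False"
  by (metis (full_types))

fun lex_le :: "bool list \<Rightarrow> bool list \<Rightarrow> bool" where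
  "lex_le (x # xs) (y # ys) = (if x = y then lex_le xs ys else y)"
| "lex_le _ _ = True"

lemma bool_eqs: "(True = False) = False" "(False = True) = False" "(True = True) = True"
  "(False = False) = True" "(\<not> True) = False" "(\<not> False) = True"
  "(False \<or> P) = P" "(True \<or> P) = True" "(True \<and> P) = P" "(False \<and> P) = False"
  "(P \<and> True) = P"
  by auto

lemmas table_eval = list.distinct lex_le.simps bool_eqs if_True if_False arith_simps arith_special
  mult_1_left mult_1_right mult_zero_left mult_zero_right add_0_left add_0_right
  mult_minus1 mult_minus1_right minus_minus inc.simps BitM.simps numeral_One dot.simps

text \<open>
  The squares of the certificate. A root is a quadruple of vertices; \<open>F0\<close>,
  \<open>F1\<close>, \<open>F2\<close>, \<open>F3\<close> belong to the roots spanning \<open>0, 1,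
  2, 3\<close> edges, in the normal form of \<open>flag\<close> below. A fifth vertex is described
  by the six pairs of the root, in lexicographic order, with which it forms an edge, and \<open>F
  i\<close> lists the values at this description of the functions whose squares are taken;
  \<open>[]\<close> stands for the zero vector at descriptions that contain \<open>K4\<close> or
  \<open>J4\<close>. \<open>F4\<close> plays the same role for a pair of roots and a pair of further
  vertices. The numbers are a rounded numerical solution of the semidefinite programme, scaled by
  370 and adjusted by local search; the rounding respects the symmetries of the roots.
\<close>

definition T0 :: "int list list" where
  "T0 = [
[451,-6,-6,-6,-267,0,0,0,1,1,1,0,0,0], [396,-46,22,22,119,40,0,0,50,-22,-22,-307,0,0],
[396,22,-46,22,119,0,40,0,-22,50,-22,0,-307,0],
[-17,-74,-74,148,-66,106,106,-130,-17,-17,26,26,26,33],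
[396,22,22,-46,119,0,0,40,-22,-22,50,0,0,-307],
[-17,-74,148,-74,-66,106,-130,106,-17,26,-17,26,33,26],
[-17,148,-74,-74,-66,-130,106,106,26,-17,-17,33,26,26], [-35,1,1,1,2,-46,-46,-46,-3,-3,-3,2,2,2],
[396,22,22,-46,119,0,0,-40,-22,-22,50,0,0,307],
[-17,-74,148,-74,-66,106,130,-106,-17,26,-17,26,-33,-26],
[-17,148,-74,-74,-66,130,106,-106,26,-17,-17,-33,26,-26],
[-11,3,3,3,169,71,71,-71,-1,-1,-1,31,31,-31], [435,-118,-118,240,-30,0,0,0,-7,-7,16,0,0,0],
[-7,-91,95,-1,193,439,0,0,-62,-103,165,-12,0,0], [-7,95,-91,-1,193,0,439,0,-103,-62,165,0,-12,0],
[-30,-163,-163,327,-210,7,7,-171,2,2,-12,72,72,-43], [396,22,-46,22,119,0,-40,0,-22,50,-22,0,307,0],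
[-17,-74,-74,148,-66,106,-106,130,-17,-17,26,26,-26,-33],
[435,-118,240,-118,-30,0,0,0,-7,16,-7,0,0,0], [-7,-91,-1,95,193,439,0,0,-62,165,-103,-12,0,0],
[-17,148,-74,-74,-66,130,-106,106,26,-17,-17,-33,-26,26],
[-11,3,3,3,169,71,-71,71,-1,-1,-1,31,-31,31], [-7,95,-1,-91,193,0,0,439,-103,165,-62,0,0,-12],
[-30,-163,327,-163,-210,7,-171,7,2,-12,2,72,-43,72],
[-17,148,-74,-74,-66,-130,-106,-106,26,-17,-17,33,-26,-26],
[-35,1,1,1,2,-46,46,46,-3,-3,-3,2,-2,-2], [-7,95,-1,-91,193,0,0,-439,-103,165,-62,0,0,12],
[-30,-163,327,-163,-210,7,171,-7,2,-12,2,72,43,-72],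
[-7,95,-91,-1,193,0,-439,0,-103,-62,165,0,12,0],
[-30,-163,-163,327,-210,7,-7,171,2,2,-12,72,-72,43], [-554,105,-52,-52,-17,0,0,0,-4,2,2,0,0,0],
[-267,-153,77,77,135,-151,0,0,-41,23,23,6,0,0], [396,-46,22,22,119,-40,0,0,50,-22,-22,307,0,0],
[435,240,-118,-118,-30,0,0,0,16,-7,-7,0,0,0],
[-17,-74,-74,148,-66,-106,106,130,-17,-17,26,-26,26,-33],
[-7,-1,-91,95,193,0,439,0,165,-62,-103,0,-12,0],
[-17,-74,148,-74,-66,-106,130,106,-17,26,-17,-26,-33,26],
[-7,-1,95,-91,193,0,0,439,165,-103,-62,0,0,-12], [-11,3,3,3,169,-71,71,71,-1,-1,-1,-31,31,31],
[-30,327,-163,-163,-210,-171,7,7,-12,2,2,-43,72,72],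
[-17,-74,148,-74,-66,-106,-130,-106,-17,26,-17,-26,33,-26],
[-7,-1,95,-91,193,0,0,-439,165,-103,-62,0,0,12], [-35,1,1,1,2,46,-46,46,-3,-3,-3,-2,2,-2],
[-30,327,-163,-163,-210,171,7,-7,-12,2,2,43,72,-72],
[-7,-91,95,-1,193,-439,0,0,-62,-103,165,12,0,0], [-554,-52,105,-52,-17,0,0,0,2,-4,2,0,0,0],
[-30,-163,-163,327,-210,-7,7,171,2,2,-12,-72,72,43], [-267,77,-153,77,135,0,-151,0,23,-41,23,0,6,0],
[-17,-74,-74,148,-66,-106,-106,-130,-17,-17,26,-26,-26,33],
[-7,-1,-91,95,193,0,-439,0,165,-62,-103,0,12,0], [-7,-91,-1,95,193,-439,0,0,-62,165,-103,12,0,0],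
[-554,-52,-52,105,-17,0,0,0,2,2,-4,0,0,0], [-35,1,1,1,2,46,46,-46,-3,-3,-3,-2,-2,2],
[-30,327,-163,-163,-210,171,-7,7,-12,2,2,43,-72,72],
[-30,-163,327,-163,-210,-7,171,7,2,-12,2,-72,43,72], [-267,77,77,-153,135,0,0,-151,23,23,-41,0,0,6],
[-11,3,3,3,169,-71,-71,-71,-1,-1,-1,-31,-31,-31],
[-30,327,-163,-163,-210,-171,-7,-7,-12,2,2,-43,-72,-72],
[-30,-163,327,-163,-210,-7,-171,-7,2,-12,2,-72,-43,-72],
[-267,77,77,-153,135,0,0,151,23,23,-41,0,0,-6],
[-30,-163,-163,327,-210,-7,-7,-171,2,2,-12,-72,-72,-43],
[-267,77,-153,77,135,0,151,0,23,-41,23,0,-6,0], [-267,-153,77,77,135,151,0,0,-41,23,23,-6,0,0], []]"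

definition T1 :: "int list list" where
  "T1 = [
[702,-2,-2,-2,-3,-3,-3,164,263,1,1,1,-127,-3,-3,-3,2,2,2,0,-67,3,3,3,-2,-2,-2,0,0,0],
[226,214,214,-428,47,47,-94,376,-26,-66,-66,134,-309,94,94,-185,-2,-2,9,0,3,-71,-71,138,46,46,-94,1,1,-4],
[226,214,-428,214,47,-94,47,376,-26,-66,134,-66,-309,94,-185,94,-2,9,-2,0,3,-71,138,-71,46,-94,46,1,-4,1],
[-343,-62,31,31,296,-146,-146,307,-313,39,-19,-19,42,35,-15,-15,-251,126,126,0,-72,-198,102,102,-52,28,28,-32,17,17],
[459,26,-13,-13,47,-23,-23,364,166,332,-166,-166,24,90,-45,-45,-123,61,61,0,-43,-52,24,24,98,-49,-49,87,-44,-44],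
[241,42,126,-168,133,-30,-105,262,-80,331,-304,-27,88,213,84,-297,-120,-18,136,168,-1,78,-10,-68,-90,48,42,-10,-8,24],
[241,42,-168,126,133,-105,-30,262,-80,331,-27,-304,88,213,-297,84,-120,136,-18,-168,-1,78,-68,-10,-90,42,48,-10,24,-8],
[-176,129,-64,-64,229,-115,-115,293,160,434,-219,-219,196,-89,45,45,233,-114,-114,0,-125,-167,85,85,6,-5,-5,-66,34,34],
[226,-428,214,214,-94,47,47,376,-26,134,-66,-66,-309,-185,94,94,9,-2,-2,0,3,138,-71,-71,-94,46,46,-4,1,1],
[-343,31,-62,31,-146,296,-146,307,-313,-19,39,-19,42,-15,35,-15,126,-251,126,0,-72,102,-198,102,28,-52,28,17,-32,17],
[-343,31,31,-62,-146,-146,296,307,-313,-19,-19,39,42,-15,-15,35,126,126,-251,0,-72,102,102,-198,28,28,-52,17,17,-32],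
[-592,1,1,1,0,0,0,15,-105,0,0,0,104,1,1,1,0,0,0,0,-12,-1,-1,-1,1,1,1,0,0,0],
[184,-438,219,219,-476,238,238,327,24,196,-99,-99,-75,-58,29,29,-24,17,17,0,59,0,1,1,-74,39,39,-8,6,6],
[-211,-302,177,125,-109,137,-27,146,24,308,-192,-113,235,95,169,-266,-14,42,-27,-220,169,-16,25,-11,73,-66,-6,-3,5,2],
[-211,-302,125,177,-109,-27,137,146,24,308,-113,-192,235,95,-266,169,-14,-27,42,220,169,-16,-11,25,73,-6,-66,-3,2,5],
[-559,-180,90,90,-71,36,36,-67,139,221,-111,-111,-225,98,-51,-51,87,-43,-43,0,200,75,-37,-37,17,-8,-8,21,-9,-9],
[459,-13,26,-13,-23,47,-23,364,166,-166,332,-166,24,-45,90,-45,61,-123,61,0,-43,24,-52,24,-49,98,-49,-44,87,-44],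
[241,126,42,-168,-30,133,-105,262,-80,-304,331,-27,88,84,213,-297,-18,-120,136,-168,-1,-10,78,-68,48,-90,42,-8,-10,24],
[184,219,-438,219,238,-476,238,327,24,-99,196,-99,-75,29,-58,29,17,-24,17,0,59,1,0,1,39,-74,39,6,-8,6],
[-211,177,-302,125,137,-109,-27,146,24,-192,308,-113,235,169,95,-266,42,-14,-27,220,169,25,-16,-11,-66,73,-6,5,-3,2],
[495,-288,-288,575,260,260,-521,-52,-136,-77,-77,154,14,-92,-92,185,-40,-40,78,0,212,-9,-9,17,-50,-50,100,14,14,-26],
[302,137,137,-274,296,296,-592,-365,414,140,140,-281,289,-153,-153,306,-49,-49,97,0,-15,64,64,-125,8,8,-22,0,0,1],
[334,-184,-411,595,375,-157,-218,-164,-445,-79,35,43,-5,69,12,-84,-93,131,-38,-108,21,-36,-6,44,45,-17,-31,13,-12,-5],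
[288,-73,-398,473,411,-174,-238,-283,-8,-28,-61,88,-4,102,-57,-44,263,-226,-38,-89,-25,51,47,-97,9,86,-93,6,-46,37],
[241,-168,42,126,-105,133,-30,262,-80,-27,331,-304,88,-297,213,84,136,-120,-18,168,-1,-68,78,-10,42,-90,48,24,-10,-8],
[-176,-64,129,-64,-115,229,-115,293,160,-219,434,-219,196,45,-89,45,-114,233,-114,0,-125,85,-167,85,-5,6,-5,34,-66,34],
[-211,125,-302,177,-27,-109,137,146,24,-113,308,-192,235,-266,95,169,-27,-14,42,-220,169,-11,-16,25,-6,73,-66,2,-3,5],
[-559,90,-180,90,36,-71,36,-67,139,-111,221,-111,-225,-51,98,-51,-43,87,-43,0,200,-37,75,-37,-8,17,-8,-9,21,-9],
[334,-411,-184,595,-157,375,-218,-164,-445,35,-79,43,-5,12,69,-84,131,-93,-38,108,21,-6,-36,44,-17,45,-31,-12,13,-5],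
[288,-398,-73,473,-174,411,-238,-283,-8,-61,-28,88,-4,-57,102,-44,-226,263,-38,89,-25,47,51,-97,86,9,-93,-46,6,37],
[-196,-217,-217,436,-57,-57,116,33,-358,1,1,-3,320,-8,-8,18,-15,-15,27,0,-39,-28,-28,59,-11,-11,23,28,28,-54],
[-557,-242,-242,484,9,9,-18,-220,-117,-50,-50,99,-133,60,60,-119,28,28,-55,0,-95,-31,-31,62,-37,-37,76,-4,-4,9],
[459,-13,-13,26,-23,-23,47,364,166,-166,-166,332,24,-45,-45,90,61,61,-123,0,-43,24,24,-52,-49,-49,98,-44,-44,87],
[184,219,219,-438,238,238,-476,327,24,-99,-99,196,-75,29,29,-58,17,17,-24,0,59,1,1,0,39,39,-74,6,6,-8],
[241,126,-168,42,-30,-105,133,262,-80,-304,-27,331,88,84,-297,213,-18,136,-120,168,-1,-10,-68,78,48,42,-90,-8,24,-10],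
[-211,177,125,-302,137,-27,-109,146,24,-192,-113,308,235,169,-266,95,42,-27,-14,-220,169,25,-11,-16,-66,-6,73,5,2,-3],
[495,-288,575,-288,260,-521,260,-52,-136,-77,154,-77,14,-92,185,-92,-40,78,-40,0,212,-9,17,-9,-50,100,-50,14,-26,14],
[334,-184,595,-411,375,-218,-157,-164,-445,-79,43,35,-5,69,-84,12,-93,-38,131,108,21,-36,44,-6,45,-31,-17,13,-5,-12],
[302,137,-274,137,296,-592,296,-365,414,140,-281,140,289,-153,306,-153,-49,97,-49,0,-15,64,-125,64,8,-22,8,0,1,0],
[288,-73,473,-398,411,-238,-174,-283,-8,-28,88,-61,-4,102,-44,-57,263,-38,-226,89,-25,51,-97,47,9,-93,86,6,37,-46],
[241,-168,126,42,-105,-30,133,262,-80,-27,-304,331,88,-297,84,213,136,-18,-120,-168,-1,-68,-10,78,42,48,-90,24,-8,-10],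
[-211,125,177,-302,-27,137,-109,146,24,-113,-192,308,235,-266,169,95,-27,42,-14,220,169,-11,25,-16,-6,-66,73,2,5,-3],
[-176,-64,-64,129,-115,-115,229,293,160,-219,-219,434,196,45,45,-89,-114,-114,233,0,-125,85,85,-167,-5,-5,6,34,34,-66],
[-559,90,90,-180,36,36,-71,-67,139,-111,-111,221,-225,-51,-51,98,-43,-43,87,0,200,-37,-37,75,-8,-8,17,-9,-9,21],
[334,-411,595,-184,-157,-218,375,-164,-445,35,43,-79,-5,12,-84,69,131,-38,-93,-108,21,-6,44,-36,-17,-31,45,-12,-5,13],
[-196,-217,436,-217,-57,116,-57,33,-358,1,-3,1,320,-8,18,-8,-15,27,-15,0,-39,-28,59,-28,-11,23,-11,28,-54,28],
[288,-398,473,-73,-174,-238,411,-283,-8,-61,88,-28,-4,-57,-44,102,-226,-38,263,-89,-25,47,-97,51,86,-93,9,-46,37,6],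
[-557,-242,484,-242,9,-18,9,-220,-117,-50,99,-50,-133,60,-119,60,28,-55,28,0,-95,-31,62,-31,-37,76,-37,-4,9,-4],
[495,575,-288,-288,-521,260,260,-52,-136,154,-77,-77,14,185,-92,-92,78,-40,-40,0,212,17,-9,-9,100,-50,-50,-26,14,14],
[334,595,-184,-411,-218,375,-157,-164,-445,43,-79,35,-5,-84,69,12,-38,-93,131,-108,21,44,-36,-6,-31,45,-17,-5,13,-12],
[334,595,-411,-184,-218,-157,375,-164,-445,43,35,-79,-5,-84,12,69,-38,131,-93,108,21,44,-6,-36,-31,-17,45,-5,-12,13],
[-196,436,-217,-217,116,-57,-57,33,-358,-3,1,1,320,18,-8,-8,27,-15,-15,0,-39,59,-28,-28,23,-11,-11,-54,28,28],
[], [], [], [],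
[302,-274,137,137,-592,296,296,-365,414,-281,140,140,289,306,-153,-153,97,-49,-49,0,-15,-125,64,64,-22,8,8,1,0,0],
[288,473,-73,-398,-238,411,-174,-283,-8,88,-28,-61,-4,-44,102,-57,-38,263,-226,-89,-25,-97,51,47,-93,9,86,37,6,-46],
[288,473,-398,-73,-238,-174,411,-283,-8,88,-61,-28,-4,-44,-57,102,-38,-226,263,89,-25,-97,47,51,-93,86,9,37,-46,6],
[-557,484,-242,-242,-18,9,9,-220,-117,99,-50,-50,-133,-119,60,60,-55,28,28,0,-95,62,-31,-31,76,-37,-37,9,-4,-4],
[], [], [], []]"

definition T2 :: "int list list" where
  "T2 = [
[775,0,-41,0,-114,0,0,0,-122,0,52,0,0,0,126,-147,0,0],
[988,0,-72,0,109,0,0,0,5,0,-225,0,0,0,263,167,0,0],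
[613,169,-98,45,85,34,-242,-189,-45,34,99,-57,92,-217,97,-115,84,-43],
[462,459,-83,-198,-256,51,172,-168,-93,65,-100,70,-21,107,-191,-19,-18,72],
[613,169,-98,-45,85,-34,242,-189,-45,-34,99,57,-92,-217,97,-115,-84,-43],
[462,459,-83,198,-256,-51,-172,-168,-93,-65,-100,-70,21,107,-191,-19,18,72],
[383,495,-99,0,-304,0,0,-162,-142,0,70,0,0,-329,102,80,0,11],
[650,860,-240,0,97,0,0,-91,41,0,152,0,0,227,-110,304,0,-127],
[613,-169,-98,45,85,-34,242,189,-45,-34,99,-57,92,217,97,-115,-84,43],
[462,-459,-83,-198,-256,-51,-172,168,-93,-65,-100,70,-21,-107,-191,-19,18,-72],
[21,0,-438,-773,-72,0,0,0,-347,0,-215,-389,201,0,-25,-128,0,0],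
[307,0,324,-545,-372,0,0,0,161,0,259,-129,162,0,-154,-35,0,0],
[386,0,-102,0,-22,-265,38,0,269,6,122,0,0,0,-102,-5,-218,0],
[107,0,-235,0,41,-78,123,0,-127,-297,-123,0,0,0,-112,143,-27,0],
[-106,148,-318,-568,-376,-229,-99,119,277,157,-18,172,-161,-40,72,-35,55,94],
[-71,401,-234,-394,69,-376,-220,265,-52,-204,240,196,26,-30,-82,-125,16,-11],
[613,-169,-98,-45,85,34,-242,189,-45,34,99,57,-92,217,97,-115,84,43],
[462,-459,-83,198,-256,51,172,168,-93,65,-100,-70,21,-107,-191,-19,-18,-72],
[386,0,-102,0,-22,265,-38,0,269,-6,122,0,0,0,-102,-5,218,0],
[107,0,-235,0,41,78,-123,0,-127,297,-123,0,0,0,-112,143,27,0],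
[21,0,-438,773,-72,0,0,0,-347,0,-215,389,-201,0,-25,-128,0,0],
[307,0,324,545,-372,0,0,0,161,0,259,129,-162,0,-154,-35,0,0],
[-106,148,-318,568,-376,229,99,119,277,-157,-18,-172,161,-40,72,-35,-55,94],
[-71,401,-234,394,69,376,220,265,-52,204,240,-196,-26,-30,-82,-125,-16,-11],
[383,-495,-99,0,-304,0,0,162,-142,0,70,0,0,329,102,80,0,-11],
[650,-860,-240,0,97,0,0,91,41,0,152,0,0,-227,-110,304,0,127],
[-106,-148,-318,-568,-376,229,99,-119,277,-157,-18,172,-161,40,72,-35,-55,-94],
[-71,-401,-234,-394,69,376,220,-265,-52,204,240,196,26,30,-82,-125,-16,11],
[-106,-148,-318,568,-376,-229,-99,-119,277,157,-18,-172,161,40,72,-35,55,-94],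
[-71,-401,-234,394,69,-376,-220,-265,-52,-204,240,-196,-26,30,-82,-125,16,11],
[-608,0,-185,0,-379,0,0,0,-55,0,143,0,0,0,14,-21,0,0],
[-827,0,-392,0,-6,0,0,0,60,0,-157,0,0,0,0,101,0,0],
[330,0,-152,0,92,0,0,0,272,0,-142,0,0,0,271,-52,0,0],
[427,0,35,0,-104,0,0,0,253,0,-511,0,0,0,-217,-192,0,0],
[171,-233,198,24,349,360,-140,-376,15,138,-15,-284,-146,65,-41,-46,-12,15],
[103,243,271,-119,53,291,-178,-69,65,-299,-116,-120,-311,-106,-36,-24,-65,17],
[171,-233,198,-24,349,-360,140,-376,15,-138,-15,284,146,65,-41,-46,12,15],
[103,243,271,119,53,-291,178,-69,65,299,-116,120,311,-106,-36,-24,65,17],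
[-257,301,173,0,488,0,0,-223,92,0,-1,0,0,114,-114,4,0,45],
[-33,423,464,0,-105,0,0,130,-267,0,100,0,0,69,76,-4,0,36],
[171,233,198,24,349,-360,140,376,15,-138,-15,-284,-146,-65,-41,-46,12,-15],
[103,-243,271,-119,53,-291,178,69,65,299,-116,-120,-311,106,-36,-24,65,-17], [], [],
[175,0,747,0,-186,102,380,0,63,-325,-44,0,0,0,65,-5,160,0],
[-219,0,364,0,-641,-66,382,0,-123,68,-40,0,0,0,-21,54,-32,0], [], [],
[171,233,198,-24,349,360,-140,376,15,138,-15,284,146,-65,-41,-46,-12,-15],
[103,-243,271,119,53,291,-178,69,65,-299,-116,120,311,106,-36,-24,-65,-17],
[175,0,747,0,-186,-102,-380,0,63,325,-44,0,0,0,65,-5,-160,0],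
[-219,0,364,0,-641,66,-382,0,-123,-68,-40,0,0,0,-21,54,32,0], [], [], [], [],
[-257,-301,173,0,488,0,0,223,92,0,-1,0,0,-114,-114,4,0,-45],
[-33,-423,464,0,-105,0,0,-130,-267,0,100,0,0,-69,76,-4,0,-36], [], [], [], [], [], []]"

definition T3 :: "int list list" where
  "T3 = [
[363,3,3,3,0,1,1,1,79,139,0,-4,-4,-4], [796,-55,28,28,0,265,-131,-131,-94,104,0,50,-25,-25],
[796,28,-55,28,0,-131,265,-131,-94,104,0,-25,50,-25],
[359,-198,-198,395,0,-36,-36,75,-171,-8,0,10,10,-21],
[796,28,28,-55,0,-131,-131,265,-94,104,0,-25,-25,50],
[359,-198,395,-198,0,-36,75,-36,-171,-8,0,10,-21,10],
[359,395,-198,-198,0,75,-36,-36,-171,-8,0,-21,10,10], [970,-3,-3,-3,0,-3,-3,-3,9,-263,0,1,1,1],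
[277,62,62,-124,0,-115,-115,231,212,47,0,5,5,-6],
[164,-48,-170,219,301,210,-119,-91,-275,252,-194,-121,64,54],
[164,-170,-48,219,-301,-119,210,-91,-275,252,194,64,-121,54],
[-209,-99,-99,196,0,79,79,-158,-42,-201,0,-29,-29,59],
[293,82,82,-163,0,10,10,-19,88,-309,0,40,40,-79],
[108,-375,289,86,193,139,-12,-127,-88,-92,-323,27,-26,-6],
[108,289,-375,86,-193,-12,139,-127,-88,-92,323,-26,27,-6],
[-280,-239,-239,480,0,-77,-77,155,292,260,0,12,12,-27],
[277,62,-124,62,0,-115,231,-115,212,47,0,5,-6,5],
[164,-48,219,-170,-301,210,-91,-119,-275,252,194,-121,54,64],
[293,82,-163,82,0,10,-19,10,88,-309,0,40,-79,40],
[108,-375,86,289,-193,139,-127,-12,-88,-92,323,27,-6,-26],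
[164,-170,219,-48,301,-119,-91,210,-275,252,-194,64,54,-121],
[-209,-99,196,-99,0,79,-158,79,-42,-201,0,-29,59,-29],
[108,289,86,-375,193,-12,-127,139,-88,-92,-323,-26,-6,27],
[-280,-239,480,-239,0,-77,155,-77,292,260,0,12,-27,12],
[242,11,-6,-6,0,327,-163,-163,223,54,0,-56,30,30], [],
[-130,-109,-427,537,-586,-354,170,184,-234,-126,-205,-67,34,32], [],
[-130,-109,537,-427,586,-354,184,170,-234,-126,205,-67,32,34], [],
[-337,35,-18,-18,0,-601,300,300,-316,34,0,-30,13,13], [],
[277,-124,62,62,0,231,-115,-115,212,47,0,-6,5,5], [293,-163,82,82,0,-19,10,10,88,-309,0,-79,40,40],
[164,219,-48,-170,301,-91,210,-119,-275,252,-194,54,-121,64],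
[108,86,-375,289,193,-127,139,-12,-88,-92,-323,-6,27,-26],
[164,219,-170,-48,-301,-91,-119,210,-275,252,194,54,64,-121],
[108,86,289,-375,-193,-127,-12,139,-88,-92,323,-6,-26,27],
[-209,196,-99,-99,0,-158,79,79,-42,-201,0,59,-29,-29],
[-280,480,-239,-239,0,155,-77,-77,292,260,0,-27,12,12],
[242,-6,11,-6,0,-163,327,-163,223,54,0,30,-56,30],
[-130,-427,-109,537,586,170,-354,184,-234,-126,205,34,-67,32], [], [],
[-130,537,-109,-427,-586,184,-354,170,-234,-126,-205,32,-67,34],
[-337,-18,35,-18,0,300,-601,300,-316,34,0,13,-30,13], [], [],
[242,-6,-6,11,0,-163,-163,327,223,54,0,30,30,-56],
[-130,-427,537,-109,-586,170,184,-354,-234,-126,-205,34,32,-67],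
[-130,537,-427,-109,586,184,170,-354,-234,-126,205,32,34,-67],
[-337,-18,-18,35,0,300,300,-601,-316,34,0,13,13,-30], [], [], [], [], [], [], [], [], [], [], [],
[]]"

definition T4 :: "int list list" where
  "T4 = [
[33,0], [-127,-73], [-127,73], [-77,0], [220,0], [-112,-253], [-112,253], [-431,0], [220,0],
[-112,-253], [-112,253], [-431,0], [458,0], [394,-551], [394,551], []]"

definition F0 :: "bool list \<Rightarrow> int list" where
  "F0 u = T0 ! bits_nat u"

definition F1 :: "bool list \<Rightarrow> int list" where
  "F1 u = T1 ! bits_nat u"

definition F2 :: "bool list \<Rightarrow> int list" where
  "F2 u = T2 ! bits_nat u"

definition F3 :: "bool list \<Rightarrow> int list" where
  "F3 u = T3 ! bits_nat u"

definition F4 :: "bool list \<Rightarrow> int list" where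
  "F4 u = T4 ! bits_nat u"

lemma map_F0: "map F0 (bools 6) = T0"
  using map_nth_bits_nat[of T0 6] by (simp add: T0_def F0_def[abs_def])

lemmas F0_rows = map_F0[unfolded bools_6 T0_def list.map list.inject simp_thms]

definition q0 :: "bool list \<Rightarrow> bool list \<Rightarrow> int" where
  "q0 u v = dot (F0 u) (F0 v)"

text \<open>The conditional turns the entries to be skipped into \<open>True\<close>, which drops
  out of the expanded conjunction. What remains is one rewrite rule for each lexicographically
  ordered pair of nonzero vectors.\<close>

lemma q0_all:
  "\<forall>a b c d e f a' b' c' d' e' f'. if F0 [a, b, c, d, e, f] = [] \<or> F0 [a', b', c', d',
    e', f'] = [] \<or> \<not> lex_le [a, b, c, d, e, f] [a', b', c', d', e', f'] then True
     else q0 [a, b, c, d, e, f] [a', b', c', d', e', f'] = dot (F0 [a, b, c, d, e, f]) (F0 [a', b',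
       c', d', e', f'])"
  by (simp add: q0_def)

lemmas q0_table = q0_all[unfolded all_bool, simplified F0_rows table_eval]

lemma q0_flip: "q0 u v = flip q0 v u" "flip q0 u v = q0 u v"
  by (simp_all add: flip_def q0_def dot_commute)

lemmas q0_table' = q0_table[simplified q0_flip(1), simplified q0_flip(2)]

lemma map_F1: "map F1 (bools 6) = T1"
  using map_nth_bits_nat[of T1 6] by (simp add: T1_def F1_def[abs_def])

lemmas F1_rows = map_F1[unfolded bools_6 T1_def list.map list.inject simp_thms]

definition q1 :: "bool list \<Rightarrow> bool list \<Rightarrow> int" where
  "q1 u v = dot (F1 u) (F1 v)"

lemma q1_all:
  "\<forall>a b c d e f a' b' c' d' e' f'. if F1 [a, b, c, d, e, f] = [] \<or> F1 [a', b', c', d',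
    e', f'] = [] \<or> \<not> lex_le [a, b, c, d, e, f] [a', b', c', d', e', f'] then True
     else q1 [a, b, c, d, e, f] [a', b', c', d', e', f'] = dot (F1 [a, b, c, d, e, f]) (F1 [a', b',
       c', d', e', f'])"
  by (simp add: q1_def)

lemmas q1_table = q1_all[unfolded all_bool, simplified F1_rows table_eval]

lemma q1_flip: "q1 u v = flip q1 v u" "flip q1 u v = q1 u v"
  by (simp_all add: flip_def q1_def dot_commute)

lemmas q1_table' = q1_table[simplified q1_flip(1), simplified q1_flip(2)]

lemma map_F2: "map F2 (bools 6) = T2"
  using map_nth_bits_nat[of T2 6] by (simp add: T2_def F2_def[abs_def])

lemmas F2_rows = map_F2[unfolded bools_6 T2_def list.map list.inject simp_thms]

definition q2 :: "bool list \<Rightarrow> bool list \<Rightarrow> int" where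
  "q2 u v = dot (F2 u) (F2 v)"

lemma q2_all:
  "\<forall>a b c d e f a' b' c' d' e' f'. if F2 [a, b, c, d, e, f] = [] \<or> F2 [a', b', c', d',
    e', f'] = [] \<or> \<not> lex_le [a, b, c, d, e, f] [a', b', c', d', e', f'] then True
     else q2 [a, b, c, d, e, f] [a', b', c', d', e', f'] = dot (F2 [a, b, c, d, e, f]) (F2 [a', b',
       c', d', e', f'])"
  by (simp add: q2_def)

lemmas q2_table = q2_all[unfolded all_bool, simplified F2_rows table_eval]

lemma q2_flip: "q2 u v = flip q2 v u" "flip q2 u v = q2 u v"
  by (simp_all add: flip_def q2_def dot_commute)

lemmas q2_table' = q2_table[simplified q2_flip(1), simplified q2_flip(2)]

lemma map_F3: "map F3 (bools 6) = T3"
  using map_nth_bits_nat[of T3 6] by (simp add: T3_def F3_def[abs_def])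

lemmas F3_rows = map_F3[unfolded bools_6 T3_def list.map list.inject simp_thms]

definition q3 :: "bool list \<Rightarrow> bool list \<Rightarrow> int" where
  "q3 u v = dot (F3 u) (F3 v)"

lemma q3_all:
  "\<forall>a b c d e f a' b' c' d' e' f'. if F3 [a, b, c, d, e, f] = [] \<or> F3 [a', b', c', d',
    e', f'] = [] \<or> \<not> lex_le [a, b, c, d, e, f] [a', b', c', d', e', f'] then True
     else q3 [a, b, c, d, e, f] [a', b', c', d', e', f'] = dot (F3 [a, b, c, d, e, f]) (F3 [a', b',
       c', d', e', f'])"
  by (simp add: q3_def)

lemmas q3_table = q3_all[unfolded all_bool, simplified F3_rows table_eval]

lemma q3_flip: "q3 u v = flip q3 v u" "flip q3 u v = q3 u v"
  by (simp_all add: flip_def q3_def dot_commute)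

lemmas q3_table' = q3_table[simplified q3_flip(1), simplified q3_flip(2)]

lemma map_F4: "map F4 (bools 4) = T4"
  using map_nth_bits_nat[of T4 4] by (simp add: T4_def F4_def[abs_def])

lemmas F4_rows = map_F4[unfolded bools_4 T4_def list.map list.inject simp_thms]

definition q4 :: "bool list \<Rightarrow> bool list \<Rightarrow> int" where
  "q4 u v = dot (F4 u) (F4 v)"

lemma q4_all:
  "\<forall>a b c d a' b' c' d'. if F4 [a, b, c, d] = [] \<or> F4 [a', b', c', d'] = [] \<or>
    \<not> lex_le [a, b, c, d] [a', b', c', d'] then True
     else q4 [a, b, c, d] [a', b', c', d'] = dot (F4 [a, b, c, d]) (F4 [a', b', c', d'])"
  by (simp add: q4_def)

lemmas q4_table = q4_all[unfolded all_bool, simplified F4_rows table_eval]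

lemma q4_flip: "q4 u v = flip q4 v u" "flip q4 u v = q4 u v"
  by (simp_all add: flip_def q4_def dot_commute)

lemmas q4_table' = q4_table[simplified q4_flip(1), simplified q4_flip(2)]

text \<open>\<open>flag abc abd acd bcd ab ac ad bc bd cd\<close>: the first four arguments describe
  the root \<open>a, b, c, d\<close>. It is reordered so that its edges are among \<open>abc, abd,
  acd\<close>, taken in this order.\<close>

fun flag :: "bool \<Rightarrow> bool \<Rightarrow> bool \<Rightarrow> bool \<Rightarrow> bool
  \<Rightarrow> bool \<Rightarrow> bool \<Rightarrow> bool \<Rightarrow> bool \<Rightarrow> bool
  \<Rightarrow> int list" where
  "flag False False False False ab ac ad bc bd cd = F0 [ab, ac, ad, bc, bd, cd]"
| "flag False False False True ab ac ad bc bd cd = F1 [bc, bd, ab, cd, ac, ad]"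
| "flag False False True False ab ac ad bc bd cd = F1 [ac, ad, ab, cd, bc, bd]"
| "flag False False True True ab ac ad bc bd cd = F2 [cd, ac, bc, ad, bd, ab]"
| "flag False True False False ab ac ad bc bd cd = F1 [ab, ad, ac, bd, bc, cd]"
| "flag False True False True ab ac ad bc bd cd = F2 [bd, ab, bc, ad, cd, ac]"
| "flag False True True False ab ac ad bc bd cd = F2 [ad, ab, ac, bd, cd, bc]"
| "flag False True True True ab ac ad bc bd cd = F3 [ad, bd, cd, ab, ac, bc]"
| "flag True False False False ab ac ad bc bd cd = F1 [ab, ac, ad, bc, bd, cd]"
| "flag True False False True ab ac ad bc bd cd = F2 [bc, ab, bd, ac, cd, ad]"
| "flag True False True False ab ac ad bc bd cd = F2 [ac, ab, ad, bc, cd, bd]"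
| "flag True False True True ab ac ad bc bd cd = F3 [ac, bc, cd, ab, ad, bd]"
| "flag True True False False ab ac ad bc bd cd = F2 [ab, ac, ad, bc, bd, cd]"
| "flag True True False True ab ac ad bc bd cd = F3 [ab, bc, bd, ac, ad, cd]"
| "flag True True True False ab ac ad bc bd cd = F3 [ab, ac, ad, bc, bd, cd]"
| "flag True True True True ab ac ad bc bd cd = []"

text \<open>The multiplier of the excess degree \<open>315 d(v) - 151\<close> of a vertex
  \<open>v\<close>, for \<open>v\<close> seen together with three further vertices;
  \<open>opp\<close> says whether these form an edge.\<close>

definition vertex_weight :: "bool \<Rightarrow> bool \<Rightarrow> bool \<Rightarrow> bool
  \<Rightarrow> int" where
  "vertex_weight x y z opp =
     (if opp then [61, 658, 441, 0] else [461, 809, 178, 0]) !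
       (of_bool x + of_bool y + of_bool z)"

definition degree_term :: "bool \<Rightarrow> bool \<Rightarrow> bool \<Rightarrow> bool
  \<Rightarrow> bool \<Rightarrow> bool \<Rightarrow> bool \<Rightarrow> bool \<Rightarrow> int"
  where
  "degree_term abc abd acd bcd a b c d =
     vertex_weight abc abd acd bcd * (315 * of_bool a - 151) +
     vertex_weight abc abd bcd acd * (315 * of_bool b - 151) +
     vertex_weight abc acd bcd abd * (315 * of_bool c - 151) +
     vertex_weight abd acd bcd abc * (315 * of_bool d - 151)"

text \<open>For a fixed root, summation over \<open>e\<close> and \<open>f\<close> turns the inner
  product into the squared norm of a vector sum, and the degree term into a weighted sum of excess
  degrees of the root vertices.\<close>

definition quad_term :: "('v \<Rightarrow> 'v \<Rightarrow> 'v \<Rightarrow> bool) \<Rightarrow> 'v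
  \<Rightarrow> 'v \<Rightarrow> 'v \<Rightarrow> 'v \<Rightarrow> 'v \<Rightarrow> 'v
  \<Rightarrow> int" where
  "quad_term E a b c d e f =
     dot (flag (E a b c) (E a b d) (E a c d) (E b c d)
            (E a b e) (E a c e) (E a d e) (E b c e) (E b d e) (E c d e))
         (flag (E a b c) (E a b d) (E a c d) (E b c d)
            (E a b f) (E a c f) (E a d f) (E b c f) (E b d f) (E c d f)) +
     degree_term (E a b c) (E a b d) (E a c d) (E b c d) (E a e f) (E b e f) (E c e f) (E d e f)"

definition pair_term :: "('v \<Rightarrow> 'v \<Rightarrow> 'v \<Rightarrow> bool) \<Rightarrow> 'v
  \<Rightarrow> 'v \<Rightarrow> 'v \<Rightarrow> 'v \<Rightarrow> 'v \<Rightarrow> 'v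
  \<Rightarrow> int" where
  "pair_term E a b c d e f = q4 [E a b c, E a b d, E a c d, E b c d] [E a b e, E a b f, E a e f, E
    b e f]"

fun list6 :: "('v \<Rightarrow> 'v \<Rightarrow> 'v \<Rightarrow> 'v \<Rightarrow> 'v \<Rightarrow>
  'v \<Rightarrow> int) \<Rightarrow> 'v list \<Rightarrow> int" where
  "list6 h [a, b, c, d, e, f] = h a b c d e f"
| "list6 h _ = 0"

text \<open>On symmetric relations \<open>quad_term\<close> is invariant under 4! * 2! = 48
  permutations of its arguments and \<open>pair_term\<close> under 2^4 = 16. Hence 720/48 = 15 and
  720/16 = 45 orders represent all orderings of six vertices. In both lists each class is
  represented by its sorted member.\<close>

definition quad_orders :: "nat list list" where
  "quad_orders = [[2,3,4,5,0,1], [1,3,4,5,0,2], [1,2,4,5,0,3], [1,2,3,5,0,4], [1,2,3,4,0,5],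
    [0,3,4,5,1,2],
[0,2,4,5,1,3], [0,2,3,5,1,4], [0,2,3,4,1,5], [0,1,4,5,2,3], [0,1,3,5,2,4], [0,1,3,4,2,5],
[0,1,2,5,3,4], [0,1,2,4,3,5], [0,1,2,3,4,5]]"

definition pair_orders :: "nat list list" where
  "pair_orders = [[0,1,2,3,4,5], [0,1,2,4,3,5], [0,1,2,5,3,4], [0,2,1,3,4,5], [0,2,1,4,3,5],
    [0,2,1,5,3,4],
[0,3,1,2,4,5], [0,3,1,4,2,5], [0,3,1,5,2,4], [0,4,1,2,3,5], [0,4,1,3,2,5], [0,4,1,5,2,3],
[0,5,1,2,3,4], [0,5,1,3,2,4], [0,5,1,4,2,3], [1,2,0,3,4,5], [1,2,0,4,3,5], [1,2,0,5,3,4],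
[1,3,0,2,4,5], [1,3,0,4,2,5], [1,3,0,5,2,4], [1,4,0,2,3,5], [1,4,0,3,2,5], [1,4,0,5,2,3],
[1,5,0,2,3,4], [1,5,0,3,2,4], [1,5,0,4,2,3], [2,3,0,1,4,5], [2,3,0,4,1,5], [2,3,0,5,1,4],
[2,4,0,1,3,5], [2,4,0,3,1,5], [2,4,0,5,1,3], [2,5,0,1,3,4], [2,5,0,3,1,4], [2,5,0,4,1,3],
[3,4,0,1,2,5], [3,4,0,2,1,5], [3,4,0,5,1,2], [3,5,0,1,2,4], [3,5,0,2,1,4], [3,5,0,4,1,2],
[4,5,0,1,2,3], [4,5,0,2,1,3], [4,5,0,3,1,2]]"

definition certificate_value :: "('v \<Rightarrow> 'v \<Rightarrow> 'v \<Rightarrow> bool)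
  \<Rightarrow> 'v list \<Rightarrow> int" where
  "certificate_value E xs =
     (\<Sum>p\<leftarrow>quad_orders. list6 (quad_term E) (map ((!) xs) p)) +
     (\<Sum>p\<leftarrow>pair_orders. list6 (pair_term E) (map ((!) xs) p))"

section \<open>Encoding of the patterns on six vertices\<close>

definition triples :: "(nat \<times> nat \<times> nat) list" where
  "triples = [(0, 1, 2), (0, 1, 3), (0, 1, 4), (0, 1, 5), (0, 2, 3), (0, 2, 4), (0, 2, 5), (0, 3,
    4), (0, 3, 5),
(0, 4, 5), (1, 2, 3), (1, 2, 4), (1, 2, 5), (1, 3, 4), (1, 3, 5), (1, 4, 5), (2, 3, 4), (2, 3, 5),
(2, 4, 5), (3, 4, 5)]"

definition bits :: "('v \<Rightarrow> 'v \<Rightarrow> 'v \<Rightarrow> bool) \<Rightarrow> 'v list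
  \<Rightarrow> bool list" where
  "bits E xs = map (\<lambda>(a, b, c). E (xs ! a) (xs ! b) (xs ! c)) triples"

definition swap_vertices :: "nat list list" where
  "swap_vertices = [[1,0,2,3,4,5], [0,2,1,3,4,5], [0,1,3,2,4,5], [0,1,2,4,3,5], [0,1,2,3,5,4]]"

text \<open>The action of the five adjacent transpositions on the positions in
  \<open>triples\<close>. They generate all relabellings of six vertices.\<close>

definition swap_triples :: "nat list list" where
  "swap_triples = [[0,1,2,3,10,11,12,13,14,15,4,5,6,7,8,9,16,17,18,19],
[0,4,5,6,1,2,3,7,8,9,10,11,12,16,17,18,13,14,15,19],
[1,0,2,3,4,7,8,5,6,9,10,13,14,11,12,15,16,17,19,18],
[0,2,1,3,5,4,6,7,9,8,11,10,12,13,15,14,16,18,17,19],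
[0,1,3,2,4,6,5,8,7,9,10,12,11,14,13,15,17,16,18,19]]"

text \<open>This is \<open>certificate_value\<close> with each adjacency replaced by its bit.
  Evaluation can rewrite \<open>flag\<close> at once, without going through the orders and the list
  lookups anew for every pattern.\<close>

fun bits_value :: "bool list \<Rightarrow> int" where
  "bits_value [b0, b1, b2, b3, b4, b5, b6, b7, b8, b9, b10, b11, b12, b13, b14, b15, b16, b17, b18,
    b19] =
dot (flag b16 b17 b18 b19 b4 b5 b6 b7 b8 b9) (flag b16 b17 b18 b19 b10 b11 b12 b13 b14 b15) +
degree_term b16 b17 b18 b19 b0 b1 b2 b3 + dot (flag b13 b14 b15 b19 b1 b2 b3 b7 b8 b9) (flag b13 b14
b15 b19 b10 b11 b12 b16 b17 b18) + degree_term b13 b14 b15 b19 b0 b4 b5 b6 + dot (flag b11 b12 b15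
b18 b0 b2 b3 b5 b6 b9) (flag b11 b12 b15 b18 b10 b13 b14 b16 b17 b19) + degree_term b11 b12 b15 b18
b1 b4 b7 b8 + dot (flag b10 b12 b14 b17 b0 b1 b3 b4 b6 b8) (flag b10 b12 b14 b17 b11 b13 b15 b16 b18
b19) + degree_term b10 b12 b14 b17 b2 b5 b7 b9 + dot (flag b10 b11 b13 b16 b0 b1 b2 b4 b5 b7) (flag
b10 b11 b13 b16 b12 b14 b15 b17 b18 b19) + degree_term b10 b11 b13 b16 b3 b6 b8 b9 + dot (flag b7 b8
b9 b19 b1 b2 b3 b13 b14 b15) (flag b7 b8 b9 b19 b4 b5 b6 b16 b17 b18) + degree_term b7 b8 b9 b19 b0
b10 b11 b12 + dot (flag b5 b6 b9 b18 b0 b2 b3 b11 b12 b15) (flag b5 b6 b9 b18 b4 b7 b8 b16 b17 b19)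
+ degree_term b5 b6 b9 b18 b1 b10 b13 b14 + dot (flag b4 b6 b8 b17 b0 b1 b3 b10 b12 b14) (flag b4 b6
b8 b17 b5 b7 b9 b16 b18 b19) + degree_term b4 b6 b8 b17 b2 b11 b13 b15 + dot (flag b4 b5 b7 b16 b0
b1 b2 b10 b11 b13) (flag b4 b5 b7 b16 b6 b8 b9 b17 b18 b19) + degree_term b4 b5 b7 b16 b3 b12 b14
b15 + dot (flag b2 b3 b9 b15 b0 b5 b6 b11 b12 b18) (flag b2 b3 b9 b15 b1 b7 b8 b13 b14 b19) +
degree_term b2 b3 b9 b15 b4 b10 b16 b17 + dot (flag b1 b3 b8 b14 b0 b4 b6 b10 b12 b17) (flag b1 b3
b8 b14 b2 b7 b9 b13 b15 b19) + degree_term b1 b3 b8 b14 b5 b11 b16 b18 + dot (flag b1 b2 b7 b13 b0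
b4 b5 b10 b11 b16) (flag b1 b2 b7 b13 b3 b8 b9 b14 b15 b19) + degree_term b1 b2 b7 b13 b6 b12 b17
b18 + dot (flag b0 b3 b6 b12 b1 b4 b8 b10 b14 b17) (flag b0 b3 b6 b12 b2 b5 b9 b11 b15 b18) +
degree_term b0 b3 b6 b12 b7 b13 b16 b19 + dot (flag b0 b2 b5 b11 b1 b4 b7 b10 b13 b16) (flag b0 b2
b5 b11 b3 b6 b9 b12 b15 b18) + degree_term b0 b2 b5 b11 b8 b14 b17 b19 + dot (flag b0 b1 b4 b10 b2
b5 b7 b11 b13 b16) (flag b0 b1 b4 b10 b3 b6 b8 b12 b14 b17) + degree_term b0 b1 b4 b10 b9 b15 b18
b19 + q4 [b0, b1, b4, b10] [b2, b3, b9, b15] + q4 [b0, b2, b5, b11] [b1, b3, b8, b14] + q4 [b0, b3,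
b6, b12] [b1, b2, b7, b13] + q4 [b0, b4, b1, b10] [b5, b6, b9, b18] + q4 [b0, b5, b2, b11] [b4, b6,
b8, b17] + q4 [b0, b6, b3, b12] [b4, b5, b7, b16] + q4 [b1, b4, b0, b10] [b7, b8, b9, b19] + q4 [b1,
b7, b2, b13] [b4, b8, b6, b17] + q4 [b1, b8, b3, b14] [b4, b7, b5, b16] + q4 [b2, b5, b0, b11] [b7,
b9, b8, b19] + q4 [b2, b7, b1, b13] [b5, b9, b6, b18] + q4 [b2, b9, b3, b15] [b5, b7, b4, b16] + q4
[b3, b6, b0, b12] [b8, b9, b7, b19] + q4 [b3, b8, b1, b14] [b6, b9, b5, b18] + q4 [b3, b9, b2, b15]
[b6, b8, b4, b17] + q4 [b0, b10, b1, b4] [b11, b12, b15, b18] + q4 [b0, b11, b2, b5] [b10, b12, b14,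
b17] + q4 [b0, b12, b3, b6] [b10, b11, b13, b16] + q4 [b1, b10, b0, b4] [b13, b14, b15, b19] + q4
[b1, b13, b2, b7] [b10, b14, b12, b17] + q4 [b1, b14, b3, b8] [b10, b13, b11, b16] + q4 [b2, b11,
b0, b5] [b13, b15, b14, b19] + q4 [b2, b13, b1, b7] [b11, b15, b12, b18] + q4 [b2, b15, b3, b9]
[b11, b13, b10, b16] + q4 [b3, b12, b0, b6] [b14, b15, b13, b19] + q4 [b3, b14, b1, b8] [b12, b15,
b11, b18] + q4 [b3, b15, b2, b9] [b12, b14, b10, b17] + q4 [b4, b10, b0, b1] [b16, b17, b18, b19] +
q4 [b4, b16, b5, b7] [b10, b17, b12, b14] + q4 [b4, b17, b6, b8] [b10, b16, b11, b13] + q4 [b5, b11,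
b0, b2] [b16, b18, b17, b19] + q4 [b5, b16, b4, b7] [b11, b18, b12, b15] + q4 [b5, b18, b6, b9]
[b11, b16, b10, b13] + q4 [b6, b12, b0, b3] [b17, b18, b16, b19] + q4 [b6, b17, b4, b8] [b12, b18,
b11, b15] + q4 [b6, b18, b5, b9] [b12, b17, b10, b14] + q4 [b7, b13, b1, b2] [b16, b19, b17, b18] +
q4 [b7, b16, b4, b5] [b13, b19, b14, b15] + q4 [b7, b19, b8, b9] [b13, b16, b10, b11] + q4 [b8, b14,
b1, b3] [b17, b19, b16, b18] + q4 [b8, b17, b4, b6] [b14, b19, b13, b15] + q4 [b8, b19, b7, b9]
[b14, b17, b10, b12] + q4 [b9, b15, b2, b3] [b18, b19, b16, b17] + q4 [b9, b18, b5, b6] [b15, b19,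
b13, b14] + q4 [b9, b19, b7, b8] [b15, b18, b11, b12]"
| "bits_value _ = 0"

definition words :: "nat list list" where
  "words = [[2], [3], [1], [4,2], [4,1], [3,1], [3,0], [2,1,4,3,2,0], [1,0,2,1,3,2,4,3],
    [3,2,1,0,4,3,2,1],
[0], [1,0,4,3,2,1], [2,0], [1,2,3,4,3,2,1], [1,2,3,0,4,3,2,1], [3,4,1,0], [4], [2,0,3,1,4,2],
[0,1,3,2,4,3,1,0], [4,0], [3,2,4,3], [2,0,3,1,4,3,2,0], [0,1,2,1,0,3,2,1,4,3,2,0], [2,3,2,0],
[1,2,4,3,0], [0,1,2,3,2,4,3,2,1,0], [1,3,2,1,0,4,3,2,1], [1,0,2,1,3,2,4,3,0], [2,3,4,3,2,0],
[3,0,4,2,1], [0,1,2,3,2,1,0,4,3,2,1,0], [3,1,0,4,3,2,1], [0,4,3,1], [2,3,4,3,2], [2,3,2,4,3,0],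
[2,0,3,2,1,4,3,2,0], [4,2,0], [3,2,4,3,2,0], [2,3,4,0], [0,1,2,1,0,3,2,1,4,3,2], [0,3,2,1,4,3,2,0],
[0,2,1,3,2,4,3,0], [0,1,2,3,0,4,3,2,1,0], [0,1,0,2,1,3,2,4,3,2,1,0], [0,1,0,2,1,3,2,1,0,4,3,2,1],
[1,2,3,0,4,3,2,1,0], [2,1,3,2,4,3,2,1], [1,3,2,0], [0,1,2,1,3,2,0,4,3,2,1], [2,3,0],
[0,1,0,2,1,3,2,0,4,3,2,1,0], [0,1,0,2,1,3,2,4,3,1,0], [0,3,2,1,0,4,3,2,1], [0,1,2,3,2,0,4,3,2,1,0],
[1,0,2,1,3,2,4,3,2,0], [1,3,2,4,3,1], [2,1,3,2,0,4,3,2,1], [3,1,4,2,0], [1,0,2,1,3,2,4,3,1],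
[2,1,3,2]]"

text \<open>Positions in \<open>triples\<close> of the edges of a copy: first the 15 copies of
  \<open>K4\<close>, one for each 4-set, then the 6 * 5 = 30 copies of \<open>J4\<close>, one for
  each 5-set with a chosen apex.\<close>

definition forbidden :: "nat list list" where
  "forbidden = [[0,1,4,10], [0,2,5,11], [0,3,6,12], [1,2,7,13], [1,3,8,14], [2,3,9,15], [4,5,7,16],
    [4,6,8,17],
[5,6,9,18], [7,8,9,19], [10,11,13,16], [10,12,14,17], [11,12,15,18], [13,14,15,19], [16,17,18,19],
[2,5,7,11,13,16], [3,6,8,12,14,17], [1,4,7,10,13,16], [3,6,9,12,15,18], [1,4,8,10,14,17],
[2,5,9,11,15,18], [0,4,5,10,11,16], [3,8,9,14,15,19], [0,4,6,10,12,17], [2,7,9,13,15,19],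
[0,5,6,11,12,18], [1,7,8,13,14,19], [0,1,2,10,11,13], [6,8,9,17,18,19], [0,1,3,10,12,14],
[5,7,9,16,18,19], [0,2,3,11,12,15], [4,7,8,16,17,19], [1,2,3,13,14,15], [4,5,6,16,17,18],
[0,1,2,4,5,7], [12,14,15,17,18,19], [0,1,3,4,6,8], [11,13,15,16,18,19], [0,2,3,5,6,9],
[10,13,14,16,17,19], [1,2,3,7,8,9], [10,11,12,16,17,18], [4,5,6,7,8,9], [10,11,12,13,14,15]]"

text \<open>
  An orderly search tree through the free patterns on \<open>{0..5}\<close>. A pattern is
  given by its values on \<open>triples\<close>, \<open>None\<close> meaning undecided, and is only
  followed if it is lexicographically maximal (\<open>True\<close> above \<open>False\<close>) in
  its orbit: \<open>Swaps k\<close> refers to a product of adjacent transpositions that leads to a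
  larger pattern, \<open>Dead k\<close> to a forbidden copy.
\<close>

datatype cert = Leaf | Br cert cert | Swaps nat | Dead nat

fun assign :: "bool \<Rightarrow> bool option list \<Rightarrow> bool option list" where
  "assign v [] = []"
| "assign v (Some b # bs) = Some b # assign v bs"
| "assign v (None # bs) = Some v # bs"

text \<open>An undecided entry ends the comparison with \<open>False\<close>, so a positive answer
  is valid for all completions of the two partial patterns.\<close>

fun greater :: "bool option list \<Rightarrow> bool option list \<Rightarrow> bool" where
  "greater (Some x # xs) (Some y # ys) = (if x = y then greater xs ys else x)"
| "greater _ _ = False"

definition permute_bits :: "nat list \<Rightarrow> 'a list \<Rightarrow> 'a list" where
  "permute_bits w bs = foldl (\<lambda>bs i. map ((!) bs) (swap_triples ! i)) bs w"

fun check :: "cert \<Rightarrow> bool option list \<Rightarrow> bool" where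
  "check Leaf bs = (None \<notin> set bs \<and> bits_value (map the bs) < 0)"
| "check (Br s t) bs = (check s (assign True bs) \<and> check t (assign False bs))"
| "check (Swaps k) bs = (k < length words \<and> greater (permute_bits (words ! k) bs) bs)"
| "check (Dead k) bs = (k < length forbidden \<and> (\<forall>i \<in> set (forbidden ! k). bs ! i =
  Some True))"

definition certificate :: cert where
  "certificate =
(Br (Br (Br (Br (Br (Br (Br (Br (Dead 35) (Br (Dead 37) (Br (Dead 39) (Br (Dead 0) (Br (Dead 1) (Br
(Dead 2) (Br (Br (Br (Dead 33) (Br (Br (Br (Dead 34) (Br Leaf Leaf)) (Br (Br Leaf Leaf) (Br Leaf
Leaf))) (Br (Swaps 16) (Br (Br Leaf Leaf) (Br Leaf Leaf))))) (Br (Swaps 1) (Br (Br (Swaps 2) (Br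
(Swaps 1) (Br Leaf Leaf))) (Br (Br (Swaps 4) (Br Leaf Leaf)) (Br (Swaps 1) (Br Leaf Leaf)))))) (Br
(Swaps 16) (Br (Swaps 1) (Br (Swaps 2) (Br (Swaps 2) (Br (Swaps 1) (Br Leaf Leaf))))))))))))) (Br
(Dead 35) (Br (Br (Br (Dead 0) (Br (Dead 1) (Br (Br (Br (Dead 4) (Br (Dead 5) (Br (Br (Br (Br (Dead
14) Leaf) (Br (Swaps 3) Leaf)) (Br (Swaps 1) (Br Leaf Leaf))) (Br (Swaps 3) (Br (Swaps 1) (Br (Swaps
3) Leaf)))))) (Br (Dead 4) (Br (Dead 5) (Br (Br (Br (Br (Dead 14) Leaf) (Br Leaf Leaf)) (Br (Swaps
1) (Br Leaf Leaf))) (Br (Br (Br (Swaps 33) Leaf) (Br (Swaps 33) Leaf)) (Br (Swaps 1) (Br (Swaps 33)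
Leaf))))))) (Br (Br (Dead 4) (Swaps 3)) (Br (Dead 4) (Br (Dead 5) (Br (Br (Br (Br (Dead 14) Leaf)
(Br (Swaps 3) Leaf)) (Br (Swaps 1) (Br Leaf Leaf))) (Br (Swaps 3) (Br (Swaps 1) (Br (Swaps 3)
Leaf)))))))))) (Br (Dead 0) (Br (Dead 1) (Br (Br (Br (Dead 4) (Br (Br (Br (Br (Br (Dead 14) Leaf)
(Br (Swaps 3) Leaf)) (Br (Br (Swaps 34) Leaf) (Br (Swaps 34) Leaf))) (Br (Swaps 3) (Br (Swaps 37)
(Br (Swaps 3) Leaf)))) (Br (Br (Br (Br (Dead 14) Leaf) (Br (Swaps 3) Leaf)) (Br (Br Leaf Leaf) (Br
Leaf Leaf))) (Br (Swaps 3) (Br (Br Leaf Leaf) (Br (Swaps 3) Leaf)))))) (Br (Dead 4) (Br (Br (Br (Br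
(Br (Dead 14) Leaf) (Br Leaf Leaf)) (Br (Br Leaf Leaf) (Br Leaf Leaf))) (Br (Br (Br Leaf Leaf) (Br
Leaf Leaf)) (Br (Br Leaf Leaf) (Br Leaf Leaf)))) (Br (Br (Br (Br (Dead 14) Leaf) (Br Leaf Leaf)) (Br
(Br Leaf Leaf) (Br Leaf Leaf))) (Br (Br (Br Leaf Leaf) (Br Leaf Leaf)) (Br (Br Leaf Leaf) (Br Leaf
Leaf))))))) (Br (Br (Dead 4) (Swaps 3)) (Br (Dead 4) (Br (Br (Br (Br (Br (Dead 14) Leaf) (Br (Swaps
3) Leaf)) (Br (Br Leaf Leaf) (Br Leaf Leaf))) (Br (Swaps 3) (Br (Br Leaf Leaf) (Br (Swaps 3)
Leaf)))) (Br (Br (Br (Br (Dead 14) Leaf) (Br (Swaps 3) Leaf)) (Br (Br Leaf Leaf) (Br Leaf Leaf)))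
(Br (Swaps 3) (Br (Br Leaf Leaf) (Br (Swaps 3) Leaf))))))))))) (Br (Swaps 1) (Br (Dead 0) (Br (Dead
1) (Br (Br (Br (Br (Dead 33) (Swaps 38)) (Br (Swaps 1) (Br (Br (Br (Br (Dead 14) Leaf) (Br Leaf
Leaf)) (Br (Swaps 1) (Br Leaf Leaf))) (Br (Br (Br Leaf Leaf) (Br Leaf Leaf)) (Br (Swaps 1) (Br Leaf
Leaf)))))) (Br (Br (Swaps 28) (Br (Br (Br (Br (Dead 14) Leaf) (Br Leaf Leaf)) (Br (Br Leaf Leaf) (Br
Leaf Leaf))) (Br (Br (Br Leaf Leaf) (Br Leaf Leaf)) (Br (Br Leaf Leaf) (Br Leaf Leaf))))) (Br (Swaps
1) (Br (Br (Br (Br (Dead 14) Leaf) (Br Leaf Leaf)) (Br (Swaps 1) (Br Leaf Leaf))) (Br (Br (Br Leaf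
Leaf) (Br Leaf Leaf)) (Br (Swaps 1) (Br Leaf Leaf))))))) (Br (Br (Br (Dead 33) (Swaps 38)) (Br
(Swaps 1) (Br (Br (Br (Br (Dead 14) Leaf) (Br Leaf Leaf)) (Br (Swaps 1) (Br Leaf Leaf))) (Br (Br (Br
Leaf Leaf) (Br Leaf Leaf)) (Br (Swaps 1) (Br Leaf Leaf)))))) (Br (Br (Br (Br (Br (Br (Dead 14) Leaf)
(Br Leaf Leaf)) (Br (Swaps 1) (Br Leaf Leaf))) (Br (Br (Br (Swaps 28) Leaf) (Br (Swaps 28) Leaf))
(Br (Swaps 1) (Br (Swaps 28) Leaf)))) (Br (Br (Br (Br (Dead 14) Leaf) (Br Leaf Leaf)) (Br (Br Leaf
Leaf) (Br Leaf Leaf))) (Br (Br (Br Leaf Leaf) (Br Leaf Leaf)) (Br (Br Leaf Leaf) (Br Leaf Leaf)))))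
(Br (Swaps 1) (Br (Br (Br (Br (Dead 14) Leaf) (Br Leaf Leaf)) (Br (Swaps 1) (Br Leaf Leaf))) (Br (Br
(Br Leaf Leaf) (Br Leaf Leaf)) (Br (Swaps 1) (Br Leaf Leaf)))))))))))))) (Br (Swaps 16) (Br (Swaps
0) (Br (Swaps 0) (Br (Br (Dead 0) (Br (Br (Swaps 6) (Br (Swaps 6) (Br (Br (Dead 5) (Br (Br (Br (Br
(Dead 14) Leaf) (Br (Swaps 3) Leaf)) (Br (Swaps 6) (Br Leaf Leaf))) (Br (Swaps 3) (Br (Swaps 6) (Br
(Swaps 3) Leaf))))) (Br (Dead 5) (Br (Br (Br (Br (Dead 14) Leaf) (Br Leaf Leaf)) (Br (Br (Swaps 20)
Leaf) (Br Leaf Leaf))) (Br (Br (Swaps 20) (Br Leaf Leaf)) (Br (Swaps 20) (Br (Swaps 20) Leaf))))))))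
(Br (Swaps 16) (Br (Swaps 0) (Br (Swaps 0) (Br (Dead 5) (Br (Br (Br (Br (Dead 14) Leaf) (Br (Swaps
0) Leaf)) (Br (Br (Swaps 20) Leaf) (Br (Swaps 0) Leaf))) (Br (Swaps 3) (Br (Swaps 20) (Br (Swaps 0)
Leaf)))))))))) (Br (Dead 0) (Br (Br (Swaps 6) (Br (Swaps 6) (Br (Br (Swaps 6) (Swaps 6)) (Br (Swaps
6) (Br (Br (Br (Br (Dead 14) Leaf) (Br Leaf Leaf)) (Br (Swaps 6) (Br Leaf Leaf))) (Br (Br (Br Leaf
Leaf) (Br Leaf Leaf)) (Br (Swaps 6) (Br Leaf Leaf)))))))) (Br (Swaps 16) (Br (Swaps 0) (Br (Swaps 0)
(Br (Br (Br (Br (Br (Dead 14) Leaf) (Br (Swaps 0) Leaf)) (Br (Br (Swaps 34) Leaf) (Br (Swaps 0)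
Leaf))) (Br (Swaps 3) (Br (Swaps 37) (Br (Swaps 0) Leaf)))) (Br (Br (Br (Br (Dead 14) Leaf) (Br
(Swaps 0) Leaf)) (Br (Br Leaf Leaf) (Br (Swaps 0) Leaf))) (Br (Swaps 3) (Br (Br Leaf Leaf) (Br
(Swaps 0) Leaf))))))))))))))) (Br (Swaps 1) (Br (Swaps 16) (Br (Swaps 0) (Br (Swaps 0) (Br (Swaps 1)
(Br (Swaps 10) (Br (Swaps 1) (Br (Swaps 6) (Br (Swaps 0) (Br (Swaps 0) (Br (Swaps 1) (Br (Br (Br (Br
(Dead 14) Leaf) (Br (Swaps 0) Leaf)) (Br (Swaps 1) (Br (Swaps 0) Leaf))) (Br (Swaps 3) (Br (Swaps 1)
(Br (Swaps 0) Leaf)))))))))))))))) (Br (Br (Br (Swaps 2) (Br (Dead 35) (Br (Br (Br (Dead 0) (Br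
(Dead 1) (Br (Br (Br (Br (Br (Br (Br (Br (Dead 13) Leaf) (Br (Dead 13) Leaf)) (Br (Swaps 1) (Br
(Dead 13) Leaf))) (Br (Br (Br (Dead 13) Leaf) (Br (Dead 13) Leaf)) (Br (Swaps 1) (Br (Dead 13)
Leaf)))) (Br (Br (Br (Swaps 2) (Br (Swaps 7) (Swaps 7))) (Br (Br Leaf Leaf) (Br Leaf Leaf))) (Br (Br
(Br (Swaps 7) Leaf) (Br (Swaps 7) Leaf)) (Br (Br Leaf Leaf) (Br Leaf Leaf))))) (Br (Swaps 1) (Br (Br
(Swaps 2) (Br (Swaps 1) (Br Leaf Leaf))) (Br (Br (Br Leaf Leaf) (Br Leaf Leaf)) (Br (Swaps 1) (Br
Leaf Leaf)))))) (Br (Br (Br (Swaps 2) (Br (Br (Br (Dead 36) Leaf) (Br (Swaps 7) Leaf)) (Br (Swaps 1)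
(Br Leaf Leaf)))) (Br (Swaps 2) (Br (Br (Swaps 2) (Br (Swaps 7) Leaf)) (Br (Br Leaf Leaf) (Br Leaf
Leaf))))) (Br (Swaps 1) (Br (Swaps 2) (Br (Swaps 2) (Br (Swaps 1) (Br Leaf Leaf))))))) (Br (Br (Br
(Br (Br (Br (Br (Dead 13) (Swaps 7)) (Br (Dead 13) (Swaps 7))) (Br (Swaps 1) (Br (Dead 13) Leaf)))
(Br (Br (Br (Dead 13) Leaf) (Br (Dead 13) Leaf)) (Br (Swaps 1) (Br (Dead 13) Leaf)))) (Br (Br (Br
(Swaps 2) (Br (Swaps 7) (Swaps 7))) (Br (Br Leaf Leaf) (Br Leaf Leaf))) (Br (Br (Br (Swaps 7) Leaf)
(Br (Swaps 7) Leaf)) (Br (Br Leaf Leaf) (Br Leaf Leaf))))) (Br (Swaps 1) (Br (Br (Swaps 2) (Br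
(Swaps 1) (Br Leaf Leaf))) (Br (Br (Br Leaf Leaf) (Br Leaf Leaf)) (Br (Swaps 1) (Br Leaf Leaf))))))
(Br (Br (Br (Swaps 2) (Br (Br (Br (Swaps 7) Leaf) (Br (Swaps 7) Leaf)) (Br (Swaps 1) (Br Leaf
Leaf)))) (Br (Swaps 2) (Br (Br (Swaps 2) (Br (Swaps 7) Leaf)) (Br (Br Leaf Leaf) (Br Leaf Leaf)))))
(Br (Swaps 1) (Br (Swaps 2) (Br (Swaps 2) (Br (Swaps 1) (Br Leaf Leaf)))))))))) (Br (Dead 0) (Br
(Dead 1) (Br (Br (Br (Br (Swaps 17) (Br (Br (Br (Swaps 2) (Br (Swaps 7) (Swaps 7))) (Br (Br (Swaps
21) Leaf) (Br (Swaps 21) Leaf))) (Br (Br (Br (Swaps 7) Leaf) (Br (Swaps 7) Leaf)) (Br (Br Leaf Leaf)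
(Br Leaf Leaf))))) (Br (Br (Br (Swaps 2) (Br (Br (Swaps 22) Leaf) (Br Leaf Leaf))) (Br (Br (Br Leaf
Leaf) (Br Leaf Leaf)) (Br (Br Leaf Leaf) (Br Leaf Leaf)))) (Br (Br (Swaps 2) (Br (Swaps 2) (Br Leaf
Leaf))) (Br (Br (Br Leaf Leaf) (Br Leaf Leaf)) (Br (Br Leaf Leaf) (Br Leaf Leaf)))))) (Br (Br (Br
(Swaps 2) (Br (Br (Br (Dead 36) Leaf) (Br (Swaps 7) Leaf)) (Br (Br Leaf Leaf) (Br Leaf Leaf)))) (Br
(Swaps 2) (Br (Br (Swaps 2) (Br (Swaps 7) Leaf)) (Br (Br Leaf Leaf) (Br Leaf Leaf))))) (Br (Br
(Swaps 2) (Br (Swaps 2) (Br (Br Leaf Leaf) (Br Leaf Leaf)))) (Br (Swaps 2) (Br (Swaps 2) (Br (Swaps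
2) (Br Leaf Leaf))))))) (Br (Br (Br (Br (Br (Br (Br (Dead 13) (Swaps 7)) (Br (Dead 13) (Swaps 7)))
(Br (Br (Dead 13) (Swaps 17)) (Br (Dead 13) (Swaps 17)))) (Br (Br (Br (Dead 13) Leaf) (Br (Dead 13)
Leaf)) (Br (Br (Dead 13) Leaf) (Br (Dead 13) Leaf)))) (Br (Br (Br (Swaps 2) (Br (Swaps 7) (Swaps
7))) (Br (Br (Swaps 21) Leaf) (Br (Swaps 21) Leaf))) (Br (Br (Br (Swaps 7) (Swaps 7)) (Br (Swaps 7)
(Swaps 7))) (Br (Br Leaf Leaf) (Br Leaf Leaf))))) (Br (Br (Br (Swaps 2) (Br (Br (Swaps 22) Leaf) (Br
Leaf Leaf))) (Br (Br (Br Leaf Leaf) (Br Leaf Leaf)) (Br (Br Leaf Leaf) (Br Leaf Leaf)))) (Br (Br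
(Swaps 2) (Br (Swaps 2) (Br Leaf Leaf))) (Br (Br (Br Leaf Leaf) (Br Leaf Leaf)) (Br (Br Leaf Leaf)
(Br Leaf Leaf)))))) (Br (Br (Br (Swaps 2) (Br (Br (Br (Swaps 7) Leaf) (Br (Swaps 7) Leaf)) (Br (Br
Leaf Leaf) (Br Leaf Leaf)))) (Br (Swaps 2) (Br (Br (Swaps 2) (Br (Swaps 7) Leaf)) (Br (Br Leaf Leaf)
(Br Leaf Leaf))))) (Br (Br (Swaps 2) (Br (Swaps 2) (Br (Br Leaf Leaf) (Br Leaf Leaf)))) (Br (Swaps
2) (Br (Swaps 2) (Br (Swaps 2) (Br Leaf Leaf))))))))))) (Br (Swaps 1) (Br (Dead 0) (Br (Dead 1) (Br
(Br (Br (Br (Swaps 17) (Br (Br (Br (Swaps 2) (Br (Swaps 39) Leaf)) (Br (Br Leaf Leaf) (Br Leaf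
Leaf))) (Br (Br (Br Leaf Leaf) (Br Leaf Leaf)) (Br (Br Leaf Leaf) (Br Leaf Leaf))))) (Br (Swaps 1)
(Br (Br (Swaps 2) (Br (Swaps 1) (Br Leaf Leaf))) (Br (Br (Br Leaf Leaf) (Br Leaf Leaf)) (Br (Swaps
1) (Br Leaf Leaf)))))) (Br (Br (Br (Swaps 2) (Br (Br (Br (Dead 36) Leaf) (Br Leaf Leaf)) (Br (Swaps
1) (Br Leaf Leaf)))) (Br (Swaps 2) (Br (Br (Swaps 2) (Br Leaf Leaf)) (Br (Br Leaf Leaf) (Br Leaf
Leaf))))) (Br (Swaps 1) (Br (Swaps 2) (Br (Swaps 2) (Br (Swaps 1) (Br Leaf Leaf))))))) (Br (Br (Br
(Swaps 17) (Br (Br (Br (Swaps 2) (Br (Swaps 39) Leaf)) (Br (Br Leaf Leaf) (Br Leaf Leaf))) (Br (Br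
(Br Leaf Leaf) (Br Leaf Leaf)) (Br (Br Leaf Leaf) (Br Leaf Leaf))))) (Br (Swaps 1) (Br (Br (Swaps 2)
(Br (Swaps 1) (Br Leaf Leaf))) (Br (Br (Br Leaf Leaf) (Br Leaf Leaf)) (Br (Swaps 1) (Br Leaf
Leaf)))))) (Br (Br (Br (Swaps 2) (Br (Br (Br Leaf Leaf) (Br Leaf Leaf)) (Br (Swaps 1) (Br Leaf
Leaf)))) (Br (Swaps 2) (Br (Br (Swaps 2) (Br Leaf Leaf)) (Br (Br Leaf Leaf) (Br Leaf Leaf))))) (Br
(Swaps 1) (Br (Swaps 2) (Br (Swaps 2) (Br (Swaps 1) (Br Leaf Leaf)))))))))))))) (Br (Br (Swaps 0)
(Br (Swaps 4) (Br (Br (Dead 0) (Br (Br (Br (Swaps 6) (Br (Br (Swaps 6) (Br (Br (Swaps 4) (Br (Swaps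
4) (Br Leaf Leaf))) (Br (Swaps 4) (Br (Swaps 6) (Br Leaf Leaf))))) (Br (Swaps 6) (Br (Br (Swaps 4)
(Swaps 4)) (Br (Swaps 4) (Br (Swaps 4) (Br Leaf Leaf))))))) (Br (Swaps 23) (Br (Br (Br (Br (Br
(Swaps 8) (Br Leaf Leaf)) (Br (Swaps 18) (Br (Swaps 29) Leaf))) (Br (Br (Swaps 29) (Br Leaf Leaf))
(Br (Swaps 29) (Br Leaf Leaf)))) (Br (Br (Br (Swaps 8) (Swaps 24)) (Br (Br Leaf Leaf) (Br Leaf
Leaf))) (Br (Br (Br (Swaps 14) Leaf) (Br Leaf Leaf)) (Br (Br Leaf Leaf) (Br Leaf Leaf))))) (Br (Br
(Br (Br (Swaps 8) (Swaps 24)) (Br (Swaps 18) (Br Leaf Leaf))) (Br (Br (Swaps 40) (Br Leaf Leaf)) (Br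
(Swaps 40) (Br Leaf Leaf)))) (Br (Br (Br (Swaps 8) (Swaps 24)) (Br (Br Leaf Leaf) (Br Leaf Leaf)))
(Br (Br (Br (Swaps 14) Leaf) (Br Leaf Leaf)) (Br (Br Leaf Leaf) (Br Leaf Leaf)))))))) (Br (Swaps 4)
(Br (Br (Br (Swaps 17) (Br (Br (Br (Swaps 4) (Br (Swaps 27) Leaf)) (Br (Br (Swaps 41) Leaf) (Br
(Swaps 41) Leaf))) (Br (Br (Br (Swaps 48) Leaf) (Br Leaf Leaf)) (Br (Br Leaf Leaf) (Br Leaf
Leaf))))) (Br (Br (Br (Swaps 4) (Br (Br (Swaps 9) (Swaps 35)) (Br (Swaps 22) Leaf))) (Br (Br (Br
(Swaps 9) Leaf) (Br (Swaps 35) Leaf)) (Br (Br (Swaps 9) Leaf) (Br (Swaps 35) Leaf)))) (Br (Br (Swaps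
4) (Br (Br Leaf Leaf) (Br Leaf Leaf))) (Br (Br (Swaps 4) (Br Leaf Leaf)) (Br (Br Leaf Leaf) (Br Leaf
Leaf)))))) (Br (Br (Br (Br (Swaps 4) (Br (Br (Swaps 9) Leaf) (Br Leaf Leaf))) (Br (Swaps 4) (Br (Br
(Swaps 9) Leaf) (Br Leaf Leaf)))) (Br (Br (Swaps 4) (Br (Swaps 4) (Br Leaf Leaf))) (Br (Swaps 4) (Br
(Br Leaf Leaf) (Br Leaf Leaf))))) (Br (Br (Br (Swaps 4) (Swaps 4)) (Br (Swaps 4) (Br (Br (Swaps 9)
Leaf) (Br Leaf Leaf)))) (Br (Br (Swaps 4) (Swaps 4)) (Br (Swaps 4) (Br (Swaps 4) (Br Leaf
Leaf)))))))))) (Br (Dead 0) (Br (Br (Br (Swaps 6) (Br (Br (Swaps 6) (Swaps 6)) (Br (Swaps 6) (Br (Br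
(Swaps 4) (Swaps 4)) (Br (Swaps 4) (Br (Swaps 4) (Br Leaf Leaf))))))) (Br (Swaps 23) (Br (Br (Swaps
29) (Br (Br (Br (Swaps 8) (Swaps 24)) (Br (Br Leaf Leaf) (Br Leaf Leaf))) (Br (Br (Swaps 14) (Br
Leaf Leaf)) (Br (Br Leaf Leaf) (Br Leaf Leaf))))) (Br (Br (Br (Br (Swaps 8) (Swaps 24)) (Br (Br
(Swaps 18) Leaf) (Br Leaf Leaf))) (Br (Br (Swaps 14) (Br Leaf Leaf)) (Br (Br Leaf Leaf) (Br Leaf
Leaf)))) (Br (Br (Br (Swaps 8) (Swaps 24)) (Br (Br Leaf Leaf) (Br Leaf Leaf))) (Br (Br (Swaps 14)
(Br Leaf Leaf)) (Br (Br Leaf Leaf) (Br Leaf Leaf)))))))) (Br (Swaps 4) (Br (Br (Br (Swaps 17) (Swaps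
49)) (Br (Br (Br (Swaps 4) (Br (Br (Swaps 23) Leaf) (Br (Swaps 23) Leaf))) (Br (Br (Br Leaf Leaf)
(Br Leaf Leaf)) (Br (Br (Swaps 23) Leaf) (Br (Swaps 23) Leaf)))) (Br (Br (Swaps 4) (Br (Br Leaf
Leaf) (Br Leaf Leaf))) (Br (Br (Swaps 4) (Br Leaf Leaf)) (Br (Br Leaf Leaf) (Br Leaf Leaf)))))) (Br
(Br (Br (Br (Swaps 4) (Br (Br Leaf Leaf) (Br Leaf Leaf))) (Br (Swaps 4) (Br (Br Leaf Leaf) (Br Leaf
Leaf)))) (Br (Br (Swaps 4) (Br (Swaps 4) (Br Leaf Leaf))) (Br (Swaps 4) (Br (Br Leaf Leaf) (Br Leaf
Leaf))))) (Br (Br (Br (Swaps 4) (Swaps 4)) (Br (Swaps 4) (Br (Br Leaf Leaf) (Br Leaf Leaf)))) (Br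
(Br (Swaps 4) (Swaps 4)) (Br (Swaps 4) (Br (Swaps 4) (Br Leaf Leaf))))))))))))) (Br (Swaps 0) (Br
(Swaps 0) (Br (Br (Dead 0) (Br (Br (Swaps 6) (Br (Swaps 6) (Br (Br (Swaps 6) (Br (Br (Br (Swaps 8)
(Br (Swaps 27) Leaf)) (Br (Swaps 6) (Br Leaf Leaf))) (Br (Br (Br (Swaps 50) Leaf) (Br Leaf Leaf))
(Br (Swaps 6) (Br Leaf Leaf))))) (Br (Swaps 6) (Br (Br (Br (Swaps 8) (Br Leaf Leaf)) (Br (Br (Swaps
51) Leaf) (Br Leaf Leaf))) (Br (Br (Br Leaf Leaf) (Br Leaf Leaf)) (Br (Br Leaf Leaf) (Br Leaf
Leaf)))))))) (Br (Br (Swaps 0) (Br (Br (Br (Br (Br (Swaps 8) (Br (Swaps 0) Leaf)) (Br (Br (Swaps 9)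
(Swaps 25)) (Br (Swaps 0) Leaf))) (Br (Br (Swaps 25) (Br (Swaps 0) Leaf)) (Br (Br (Swaps 9) (Swaps
25)) (Br (Swaps 0) Leaf)))) (Br (Br (Br (Swaps 8) (Br (Swaps 0) Leaf)) (Br (Br Leaf Leaf) (Br (Swaps
0) Leaf))) (Br (Br (Br (Swaps 42) Leaf) (Br (Swaps 0) Leaf)) (Br (Br Leaf Leaf) (Br (Swaps 0)
Leaf))))) (Br (Br (Br (Br (Swaps 8) (Br Leaf Leaf)) (Br (Br (Swaps 9) (Swaps 52)) (Br Leaf Leaf)))
(Br (Br (Br (Swaps 9) (Swaps 53)) (Br Leaf Leaf)) (Br (Br (Swaps 9) Leaf) (Br Leaf Leaf)))) (Br (Br
(Br (Swaps 8) (Br (Swaps 54) Leaf)) (Br (Br Leaf Leaf) (Br Leaf Leaf))) (Br (Br (Br (Swaps 43) Leaf)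
(Br Leaf Leaf)) (Br (Br Leaf Leaf) (Br Leaf Leaf))))))) (Br (Swaps 0) (Br (Swaps 0) (Br (Br (Br (Br
(Br (Dead 14) Leaf) (Br (Swaps 0) Leaf)) (Br (Br (Swaps 9) Leaf) (Br (Swaps 0) Leaf))) (Br (Br (Br
(Swaps 9) Leaf) (Br (Swaps 0) Leaf)) (Br (Br (Swaps 9) Leaf) (Br (Swaps 0) Leaf)))) (Br (Br (Br (Br
(Dead 14) (Swaps 8)) (Br (Swaps 0) Leaf)) (Br (Br Leaf Leaf) (Br (Swaps 0) Leaf))) (Br (Br (Br Leaf
Leaf) (Br (Swaps 0) Leaf)) (Br (Br Leaf Leaf) (Br (Swaps 0) Leaf)))))))))) (Br (Dead 0) (Br (Br
(Swaps 6) (Br (Swaps 6) (Br (Br (Swaps 6) (Swaps 6)) (Br (Swaps 6) (Br (Br (Br (Swaps 8) (Br (Swaps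
27) Leaf)) (Br (Swaps 6) (Br Leaf Leaf))) (Br (Br (Br Leaf Leaf) (Br Leaf Leaf)) (Br (Swaps 6) (Br
Leaf Leaf)))))))) (Br (Br (Swaps 0) (Br (Br (Br (Br (Br (Swaps 8) (Br (Swaps 0) Leaf)) (Br (Br
(Swaps 25) Leaf) (Br (Swaps 0) Leaf))) (Br (Br (Swaps 25) (Br (Swaps 0) Leaf)) (Br (Br (Swaps 25)
Leaf) (Br (Swaps 0) Leaf)))) (Br (Br (Br (Swaps 8) (Br (Swaps 0) Leaf)) (Br (Br Leaf Leaf) (Br
(Swaps 0) Leaf))) (Br (Br (Br (Swaps 42) Leaf) (Br (Swaps 0) Leaf)) (Br (Br Leaf Leaf) (Br (Swaps 0)
Leaf))))) (Br (Br (Br (Br (Swaps 8) (Br (Swaps 27) Leaf)) (Br (Br (Swaps 30) Leaf) (Br Leaf Leaf)))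
(Br (Br (Br (Swaps 30) Leaf) (Br Leaf Leaf)) (Br (Br Leaf Leaf) (Br Leaf Leaf)))) (Br (Br (Br (Swaps
8) (Br (Swaps 27) Leaf)) (Br (Br Leaf Leaf) (Br Leaf Leaf))) (Br (Br (Br (Swaps 43) Leaf) (Br Leaf
Leaf)) (Br (Br Leaf Leaf) (Br Leaf Leaf))))))) (Br (Swaps 0) (Br (Swaps 0) (Br (Br (Br (Br (Swaps 8)
(Br (Swaps 0) Leaf)) (Br (Br (Swaps 44) Leaf) (Br (Swaps 0) Leaf))) (Br (Br (Br Leaf Leaf) (Br
(Swaps 0) Leaf)) (Br (Br Leaf Leaf) (Br (Swaps 0) Leaf)))) (Br (Br (Br (Swaps 8) (Br (Swaps 0)
Leaf)) (Br (Br Leaf Leaf) (Br (Swaps 0) Leaf))) (Br (Br (Br Leaf Leaf) (Br (Swaps 0) Leaf)) (Br (Br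
Leaf Leaf) (Br (Swaps 0) Leaf))))))))))))))) (Br (Swaps 1) (Br (Br (Swaps 0) (Br (Br (Br (Swaps 10)
(Br (Swaps 1) (Br (Br (Swaps 0) (Br (Br (Br (Br (Swaps 13) (Br (Swaps 1) (Br (Swaps 0) Leaf))) (Br
(Swaps 13) (Br (Swaps 1) (Br (Swaps 0) Leaf)))) (Br (Br (Swaps 13) (Br (Swaps 13) (Br (Swaps 0)
Leaf))) (Br (Swaps 13) (Br (Swaps 13) (Br (Swaps 0) Leaf))))) (Br (Swaps 1) (Br (Br (Swaps 13) (Br
(Swaps 1) (Br (Swaps 13) Leaf))) (Br (Swaps 13) (Br (Swaps 1) (Br (Swaps 13) Leaf))))))) (Br (Swaps
0) (Br (Swaps 0) (Br (Swaps 1) (Br (Br (Swaps 13) (Br (Swaps 1) (Br (Swaps 0) Leaf))) (Br (Swaps 13)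
(Br (Swaps 1) (Br (Swaps 0) Leaf)))))))))) (Br (Swaps 10) (Br (Swaps 6) (Br (Br (Swaps 0) (Br (Br
(Swaps 6) (Br (Br (Br (Swaps 11) (Swaps 11)) (Br (Swaps 31) (Br (Swaps 0) Leaf))) (Br (Br (Swaps 11)
(Swaps 11)) (Br (Swaps 31) (Br (Swaps 0) Leaf))))) (Br (Br (Br (Br (Swaps 11) (Swaps 11)) (Br (Swaps
6) (Br Leaf Leaf))) (Br (Br (Swaps 11) (Swaps 11)) (Br (Swaps 6) (Br Leaf Leaf)))) (Br (Br (Br
(Swaps 11) (Swaps 11)) (Br (Swaps 31) (Br Leaf Leaf))) (Br (Br (Swaps 11) (Swaps 11)) (Br (Swaps 31)
(Br Leaf Leaf))))))) (Br (Swaps 0) (Br (Swaps 0) (Br (Br (Br (Br (Swaps 14) (Br (Swaps 0) Leaf)) (Br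
(Br (Swaps 44) Leaf) (Br (Swaps 0) Leaf))) (Br (Br (Swaps 45) (Br (Swaps 0) Leaf)) (Br (Br Leaf
Leaf) (Br (Swaps 0) Leaf)))) (Br (Br (Br (Swaps 14) (Br (Swaps 0) Leaf)) (Br (Br Leaf Leaf) (Br
(Swaps 0) Leaf))) (Br (Br (Swaps 45) (Br (Swaps 0) Leaf)) (Br (Br Leaf Leaf) (Br (Swaps 0)
Leaf))))))))))) (Br (Swaps 1) (Br (Swaps 10) (Br (Swaps 1) (Br (Br (Swaps 6) (Br (Swaps 10) (Br
(Swaps 1) (Br (Br (Br (Swaps 11) (Swaps 11)) (Br (Swaps 1) (Br Leaf Leaf))) (Br (Br (Swaps 11)
(Swaps 11)) (Br (Swaps 1) (Br Leaf Leaf))))))) (Br (Swaps 12) (Br (Br (Swaps 12) (Br (Br (Br (Swaps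
14) (Br (Swaps 12) Leaf)) (Br (Br Leaf Leaf) (Br (Swaps 12) Leaf))) (Br (Br (Br (Swaps 14) Leaf) (Br
(Swaps 12) Leaf)) (Br (Br Leaf Leaf) (Br (Swaps 12) Leaf))))) (Br (Swaps 1) (Br (Br (Br (Swaps 14)
(Br Leaf Leaf)) (Br (Swaps 1) (Br Leaf Leaf))) (Br (Br (Br (Swaps 14) Leaf) (Br Leaf Leaf)) (Br
(Swaps 1) (Br Leaf Leaf))))))))))))) (Br (Swaps 0) (Br (Swaps 0) (Br (Swaps 1) (Br (Swaps 10) (Br
(Swaps 1) (Br (Swaps 6) (Br (Swaps 0) (Br (Swaps 0) (Br (Swaps 1) (Br (Br (Br (Br (Dead 14) Leaf)
(Br (Swaps 0) Leaf)) (Br (Swaps 1) (Br (Swaps 0) Leaf))) (Br (Br (Br Leaf Leaf) (Br (Swaps 0) Leaf))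
(Br (Swaps 1) (Br (Swaps 0) Leaf))))))))))))))))) (Br (Swaps 3) (Br (Br (Swaps 2) (Br (Swaps 2) (Br
(Swaps 0) (Br (Swaps 0) (Br (Br (Dead 0) (Br (Br (Swaps 32) (Br (Br (Swaps 0) (Br (Swaps 18) (Br (Br
(Swaps 2) (Br (Swaps 2) (Br (Swaps 0) Leaf))) (Br (Br (Br (Swaps 26) Leaf) (Br (Swaps 0) Leaf)) (Br
(Br (Swaps 26) Leaf) (Br (Swaps 0) Leaf)))))) (Br (Br (Br (Swaps 2) (Br (Swaps 3) (Br (Swaps 9) (Br
(Swaps 3) Leaf)))) (Br (Swaps 2) (Br (Swaps 3) (Br (Br (Swaps 26) Leaf) (Br (Swaps 3) Leaf))))) (Br
(Br (Swaps 2) (Br (Swaps 2) (Br (Swaps 9) (Br (Swaps 9) Leaf)))) (Br (Swaps 2) (Br (Swaps 2) (Br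
(Swaps 2) (Br Leaf Leaf)))))))) (Br (Swaps 4) (Br (Swaps 0) (Br (Swaps 0) (Br (Br (Swaps 2) (Br
(Swaps 2) (Br (Swaps 9) (Br (Swaps 0) Leaf)))) (Br (Swaps 2) (Br (Swaps 2) (Br (Swaps 2) (Br (Swaps
0) Leaf)))))))))) (Br (Dead 0) (Br (Br (Swaps 32) (Br (Br (Swaps 0) (Br (Swaps 18) (Br (Br (Swaps 2)
(Br (Swaps 2) (Br (Swaps 0) Leaf))) (Br (Br (Br Leaf Leaf) (Br (Swaps 0) Leaf)) (Br (Br Leaf Leaf)
(Br (Swaps 0) Leaf)))))) (Br (Br (Br (Swaps 2) (Br (Swaps 3) (Br (Br (Swaps 18) Leaf) (Br (Swaps 3)
Leaf)))) (Br (Swaps 2) (Br (Swaps 3) (Br (Br Leaf Leaf) (Br (Swaps 3) Leaf))))) (Br (Br (Swaps 2)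
(Br (Swaps 2) (Br (Br (Swaps 18) Leaf) (Br Leaf Leaf)))) (Br (Swaps 2) (Br (Swaps 2) (Br (Swaps 2)
(Br Leaf Leaf)))))))) (Br (Swaps 4) (Br (Swaps 0) (Br (Swaps 0) (Br (Br (Swaps 2) (Br (Swaps 2) (Br
(Br (Swaps 30) Leaf) (Br (Swaps 0) Leaf)))) (Br (Swaps 2) (Br (Swaps 2) (Br (Swaps 2) (Br (Swaps 0)
Leaf))))))))))))))) (Br (Br (Swaps 5) (Br (Br (Swaps 0) (Br (Swaps 5) (Br (Swaps 10) (Br (Swaps 5)
(Br (Br (Swaps 0) (Br (Br (Swaps 19) (Br (Swaps 5) (Br (Swaps 19) (Br (Br Leaf Leaf) (Br (Swaps 0)
Leaf))))) (Br (Br (Swaps 5) (Br (Br (Swaps 5) (Br Leaf Leaf)) (Br (Swaps 5) (Br Leaf Leaf)))) (Br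
(Swaps 5) (Br (Br (Swaps 5) (Swaps 5)) (Br (Swaps 5) (Br Leaf Leaf))))))) (Br (Swaps 0) (Br (Swaps
0) (Br (Br (Swaps 5) (Br (Br (Swaps 5) (Br (Swaps 0) Leaf)) (Br (Swaps 5) (Br (Swaps 0) Leaf)))) (Br
(Swaps 5) (Br (Br (Swaps 5) (Swaps 5)) (Br (Swaps 5) (Br (Swaps 0) Leaf)))))))))))) (Br (Br (Br
(Swaps 10) (Br (Swaps 5) (Br (Br (Br (Swaps 3) (Br (Br (Br (Br (Swaps 5) (Br (Swaps 3) Leaf)) (Br
(Swaps 5) (Br (Swaps 9) Leaf))) (Br (Swaps 3) (Br (Swaps 9) (Br (Swaps 3) Leaf)))) (Br (Br (Br
(Swaps 5) (Swaps 5)) (Br (Swaps 5) (Br (Swaps 22) Leaf))) (Br (Swaps 3) (Br (Swaps 15) (Br (Swaps 3)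
Leaf)))))) (Br (Swaps 3) (Br (Br (Swaps 5) (Br (Br (Swaps 5) (Br (Swaps 7) (Swaps 46))) (Br (Swaps
5) (Br (Swaps 9) Leaf)))) (Br (Swaps 5) (Br (Br (Swaps 5) (Swaps 5)) (Br (Swaps 5) (Br (Swaps 46)
Leaf))))))) (Br (Br (Swaps 3) (Swaps 3)) (Br (Swaps 3) (Br (Br (Swaps 5) (Br (Swaps 3) (Br (Swaps 5)
(Swaps 55)))) (Br (Swaps 5) (Br (Swaps 3) (Br (Swaps 5) (Br (Swaps 3) Leaf)))))))))) (Br (Swaps 10)
(Br (Swaps 15) (Br (Br (Br (Swaps 3) (Br (Swaps 12) (Br (Br (Br (Swaps 8) (Swaps 8)) (Br (Swaps 15)
(Br (Swaps 12) Leaf))) (Br (Swaps 3) (Br (Swaps 15) (Br (Swaps 3) Leaf)))))) (Br (Swaps 3) (Br (Br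
(Br (Swaps 32) (Br (Swaps 15) (Br Leaf Leaf))) (Br (Swaps 32) (Br (Swaps 15) (Br Leaf Leaf)))) (Br
(Br (Br (Swaps 8) (Swaps 8)) (Br (Swaps 15) (Swaps 15))) (Br (Br (Swaps 15) (Br (Swaps 7) Leaf)) (Br
(Swaps 15) (Br Leaf Leaf))))))) (Br (Br (Swaps 3) (Swaps 3)) (Br (Swaps 3) (Br (Br (Br (Br (Swaps 8)
(Br (Swaps 3) Leaf)) (Br (Swaps 47) (Br (Swaps 56) Leaf))) (Br (Swaps 3) (Br (Br (Swaps 30) Leaf)
(Br (Swaps 3) Leaf)))) (Br (Br (Br (Swaps 8) (Br (Swaps 3) Leaf)) (Br (Swaps 47) (Br Leaf Leaf)))
(Br (Swaps 3) (Br (Br Leaf Leaf) (Br (Swaps 3) Leaf))))))))))) (Br (Swaps 5) (Br (Swaps 10) (Br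
(Swaps 5) (Br (Br (Br (Swaps 12) (Swaps 12)) (Br (Swaps 19) (Br (Swaps 19) (Br (Swaps 5) (Br (Swaps
19) (Br (Swaps 5) (Br Leaf Leaf))))))) (Br (Br (Swaps 12) (Br (Swaps 12) (Br (Br (Br (Swaps 5)
(Swaps 5)) (Br (Swaps 5) (Br (Swaps 12) Leaf))) (Br (Br (Swaps 57) (Br (Swaps 12) Leaf)) (Br (Br
(Swaps 22) Leaf) (Br (Swaps 12) Leaf)))))) (Br (Br (Swaps 36) (Br (Swaps 5) (Br (Swaps 36) (Br (Br
Leaf Leaf) (Br (Swaps 36) Leaf))))) (Br (Br (Swaps 5) (Br (Br (Swaps 5) (Br Leaf Leaf)) (Br (Swaps
5) (Br Leaf Leaf)))) (Br (Swaps 5) (Br (Br (Swaps 5) (Swaps 5)) (Br (Swaps 5) (Br Leaf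
Leaf)))))))))))))) (Br (Swaps 16) (Br (Swaps 0) (Br (Swaps 0) (Br (Br (Swaps 10) (Br (Swaps 10) (Br
(Swaps 10) (Br (Swaps 0) (Br (Swaps 0) (Br (Br (Br (Br (Swaps 8) (Br (Swaps 0) Leaf)) (Br (Swaps 9)
(Br (Swaps 0) Leaf))) (Br (Swaps 3) (Br (Swaps 9) (Br (Swaps 0) Leaf)))) (Br (Br (Br (Swaps 8) (Br
(Swaps 0) (Swaps 8))) (Br (Br (Swaps 26) (Swaps 26)) (Br (Swaps 0) Leaf))) (Br (Swaps 3) (Br (Br
(Swaps 26) Leaf) (Br (Swaps 0) Leaf)))))))))) (Br (Swaps 10) (Br (Swaps 10) (Br (Swaps 10) (Br
(Swaps 0) (Br (Swaps 0) (Br (Swaps 10) (Br (Br (Br (Swaps 8) (Swaps 8)) (Br (Swaps 58) (Br (Swaps 0)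
Leaf))) (Br (Swaps 3) (Br (Br Leaf Leaf) (Br (Swaps 0) Leaf)))))))))))))))))) (Br (Swaps 1) (Br
(Swaps 16) (Br (Swaps 2) (Br (Swaps 1) (Br (Swaps 2) (Br (Br (Swaps 7) (Br (Swaps 1) (Br (Swaps 10)
(Br (Swaps 1) (Br (Swaps 6) (Br (Swaps 59) (Br (Br (Swaps 19) (Br (Swaps 2) (Br (Swaps 19) (Br (Br
(Swaps 21) Leaf) (Br (Swaps 21) Leaf))))) (Br (Swaps 1) (Br (Swaps 2) (Br (Swaps 2) (Br (Swaps 1)
(Br (Swaps 22) Leaf)))))))))))) (Br (Swaps 4) (Br (Swaps 1) (Br (Swaps 10) (Br (Swaps 1) (Br (Swaps
4) (Br (Swaps 6) (Br (Swaps 10) (Br (Swaps 1) (Br (Swaps 2) (Br (Swaps 2) (Br (Swaps 1) (Br Leaf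
Leaf))))))))))))))))))) (Br (Swaps 0) (Br (Swaps 1) (Br (Swaps 3) (Br (Swaps 2) (Br (Swaps 1) (Br
(Swaps 2) (Br (Swaps 0) (Br (Swaps 0) (Br (Swaps 1) (Br (Swaps 10) (Br (Swaps 1) (Br (Swaps 4) (Br
(Swaps 0) (Br (Swaps 0) (Br (Swaps 1) (Br (Swaps 2) (Br (Swaps 2) (Br (Swaps 1) (Br (Swaps 0)
Leaf))))))))))))))))))))"

section \<open>Evaluation of the certificate\<close>

lemma map_nth_words: "map ((!) words) [0, 1, 2, 3, 4, 5, 6, 7, 8, 9, 10, 11, 12, 13, 14, 15, 16,
  17, 18, 19, 20, 21, 22, 23, 24, 25, 26,
27, 28, 29, 30, 31, 32, 33, 34, 35, 36, 37, 38, 39, 40, 41, 42, 43, 44, 45, 46, 47, 48, 49, 50, 51,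
52, 53, 54, 55, 56, 57, 58, 59] = words"
  by (simp add: words_def)

lemmas words_nth = map_nth_words[unfolded words_def[abs_def] list.map list.inject simp_thms, folded
  words_def]

lemma map_nth_forbidden: "map ((!) forbidden) [0, 1, 2, 3, 4, 5, 6, 7, 8, 9, 10, 11, 12, 13, 14,
  15, 16, 17, 18, 19, 20, 21, 22, 23, 24, 25, 26,
27, 28, 29, 30, 31, 32, 33, 34, 35, 36, 37, 38, 39, 40, 41, 42, 43, 44] = forbidden"
  by (simp add: forbidden_def)

lemmas forbidden_nth = map_nth_forbidden[unfolded forbidden_def[abs_def] list.map list.inject
  simp_thms, folded forbidden_def]

lemma length_forbidden: "length forbidden = 45"
  by (simp add: forbidden_def)

lemma length_words: "length words = 60"
  by (simp add: words_def)

lemma vertex_weight_all: "\<forall>x y z w. vertex_weight x y z w =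
  (if w then [61, 658, 441, 0] else [461, 809, 178, 0]) !
       (of_bool x + of_bool y + of_bool z)"
  by (simp add: vertex_weight_def)

lemmas vertex_weight_table = vertex_weight_all[unfolded all_bool, simplified]

\<comment> \<open>Reflexivity instantiates the right side with the body of the definition; expanding
  the eight bits then tabulates all 256 arguments.\<close>
schematic_goal degree_term_all: "\<forall>s1 s2 s3 s4 a b c d. degree_term s1 s2 s3 s4 a b c d = ?R
  s1 s2 s3 s4 a b c d"
  unfolding degree_term_def by (intro allI) (rule refl)

lemmas degree_term_table = degree_term_all[unfolded all_bool,
  simplified vertex_weight_table of_bool_eq mult_zero_right mult_1_right mult_zero_left
    diff_0 diff_0_right add_0_left add_0_right arith_simps]

schematic_goal replicate_20: "replicate 20 x = ?xs"
  by (simp add: numeral_eq_Suc)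

\<comment> \<open>With variables for the twenty entries, a transposition acts on a whole partial
  pattern in a single rewrite step.\<close>
schematic_goal swap_triples_eval:
  "map ((!) [b0, b1, b2, b3, b4, b5, b6, b7, b8, b9, b10, b11, b12, b13, b14, b15, b16, b17, b18,
    b19]) (swap_triples ! 0) = ?l0"
  "map ((!) [b0, b1, b2, b3, b4, b5, b6, b7, b8, b9, b10, b11, b12, b13, b14, b15, b16, b17, b18,
    b19]) (swap_triples ! 1) = ?l1"
  "map ((!) [b0, b1, b2, b3, b4, b5, b6, b7, b8, b9, b10, b11, b12, b13, b14, b15, b16, b17, b18,
    b19]) (swap_triples ! 2) = ?l2"
  "map ((!) [b0, b1, b2, b3, b4, b5, b6, b7, b8, b9, b10, b11, b12, b13, b14, b15, b16, b17, b18,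
    b19]) (swap_triples ! 3) = ?l3"
  "map ((!) [b0, b1, b2, b3, b4, b5, b6, b7, b8, b9, b10, b11, b12, b13, b14, b15, b16, b17, b18,
    b19]) (swap_triples ! 4) = ?l4"
  by (simp_all add: swap_triples_def)

lemma nth_Cons_pred: "(x # xs) ! numeral v = xs ! pred_numeral v" "(x # xs) ! 1 = xs ! 0"
  by (simp_all add: numeral_eq_Suc)

text \<open>The whole search tree is evaluated here. A leaf costs 15 + 45 inner products and 15
  degree terms, all of them table lookups, and their addition. No rule for zero vectors is supplied,
  so every inner product met at a leaf is a tabulated one.\<close>

lemma certificate_correct: "check certificate (replicate 20 None)"
  unfolding certificate_def
  by (simp only: check.simps assign.simps greater.simps permute_bits_def foldl_Cons foldl_Nil
  words_nth forbidden_nth length_forbidden length_words swap_triples_eval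
  list.set empty_iff insert_iff option.distinct option.sel option.inject list.map bits_value.simps
    bool_eqs
  if_True if_False
  ball_simps nth_Cons_0 nth_Cons_pred pred_numeral_simps BitM.simps numeral_One
  flag.simps q0_def[symmetric] q1_def[symmetric] q2_def[symmetric] q3_def[symmetric]
  q0_table q1_table q2_table q3_table q4_table q0_table' q1_table' q2_table' q3_table' q4_table'
  degree_term_table inc.simps mult_1_left mult_1_right mult_zero_left mult_zero_right minus_minus
  arith_simps arith_special rel_simps add_0_left add_0_right
  replicate_20)

section \<open>Symmetry\<close>

lemma q0_zero: "F0 u = [] \<Longrightarrow> q0 u v = 0" "F0 v = [] \<Longrightarrow> q0 u v = 0"
  by (simp_all add: q0_def dot_commute[of _ "[]"])

text \<open>Exchanging the root vertices a and b changes the vectors \<open>F0\<close>, but not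
  their Gram matrix, because the rounding kept this symmetry. It is verified entry by entry, on all
  2^12 pairs of descriptions. The next two lemmas exchange b with c and c with d.\<close>

lemma q0_swap1:
  "q0 [ab, bc, bd, ac, ad, cd] [ab', bc', bd', ac', ad', cd'] = q0 [ab, ac, ad, bc, bd, cd] [ab',
    ac', ad', bc', bd', cd']"
proof -
  have "\<forall>ab ac ad bc bd cd ab' ac' ad' bc' bd' cd'. q0 [ab, bc, bd, ac, ad, cd] [ab', bc',
    bd', ac', ad', cd'] = q0 [ab, ac, ad, bc, bd, cd] [ab', ac', ad', bc', bd', cd']"
    by (simp only: all_bool q0_table q0_table' q0_zero F0_rows list.distinct simp_thms)
  then show ?thesis
    by blast
qed

lemma q0_swap2:
  "q0 [ac, ab, ad, bc, cd, bd] [ac', ab', ad', bc', cd', bd'] = q0 [ab, ac, ad, bc, bd, cd] [ab',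
    ac', ad', bc', bd', cd']"
proof -
  have "\<forall>ab ac ad bc bd cd ab' ac' ad' bc' bd' cd'. q0 [ac, ab, ad, bc, cd, bd] [ac', ab',
    ad', bc', cd', bd'] = q0 [ab, ac, ad, bc, bd, cd] [ab', ac', ad', bc', bd', cd']"
    by (simp only: all_bool q0_table q0_table' q0_zero F0_rows list.distinct simp_thms)
  then show ?thesis
    by blast
qed

lemma q0_swap3:
  "q0 [ab, ad, ac, bd, bc, cd] [ab', ad', ac', bd', bc', cd'] = q0 [ab, ac, ad, bc, bd, cd] [ab',
    ac', ad', bc', bd', cd']"
proof -
  have "\<forall>ab ac ad bc bd cd ab' ac' ad' bc' bd' cd'. q0 [ab, ad, ac, bd, bc, cd] [ab', ad',
    ac', bd', bc', cd'] = q0 [ab, ac, ad, bc, bd, cd] [ab', ac', ad', bc', bd', cd']"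
    by (simp only: all_bool q0_table q0_table' q0_zero F0_rows list.distinct simp_thms)
  then show ?thesis
    by blast
qed

lemma q1_zero: "F1 u = [] \<Longrightarrow> q1 u v = 0" "F1 v = [] \<Longrightarrow> q1 u v = 0"
  by (simp_all add: q1_def dot_commute[of _ "[]"])

text \<open>From here on only transpositions that preserve the normal form of the root occur. They
  generate its symmetry group: a-b and b-c for the edge abc, a-b and c-d for abc and abd, and b-c
  and c-d when bcd is the missing edge.\<close>

lemma q1_swap1:
  "q1 [ab, bc, bd, ac, ad, cd] [ab', bc', bd', ac', ad', cd'] = q1 [ab, ac, ad, bc, bd, cd] [ab',
    ac', ad', bc', bd', cd']"
proof -
  have "\<forall>ab ac ad bc bd cd ab' ac' ad' bc' bd' cd'. q1 [ab, bc, bd, ac, ad, cd] [ab', bc',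
    bd', ac', ad', cd'] = q1 [ab, ac, ad, bc, bd, cd] [ab', ac', ad', bc', bd', cd']"
    by (simp only: all_bool q1_table q1_table' q1_zero F1_rows list.distinct simp_thms)
  then show ?thesis
    by blast
qed

lemma q1_swap2:
  "q1 [ac, ab, ad, bc, cd, bd] [ac', ab', ad', bc', cd', bd'] = q1 [ab, ac, ad, bc, bd, cd] [ab',
    ac', ad', bc', bd', cd']"
proof -
  have "\<forall>ab ac ad bc bd cd ab' ac' ad' bc' bd' cd'. q1 [ac, ab, ad, bc, cd, bd] [ac', ab',
    ad', bc', cd', bd'] = q1 [ab, ac, ad, bc, bd, cd] [ab', ac', ad', bc', bd', cd']"
    by (simp only: all_bool q1_table q1_table' q1_zero F1_rows list.distinct simp_thms)
  then show ?thesis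
    by blast
qed

lemma q2_zero: "F2 u = [] \<Longrightarrow> q2 u v = 0" "F2 v = [] \<Longrightarrow> q2 u v = 0"
  by (simp_all add: q2_def dot_commute[of _ "[]"])

lemma q2_swap1:
  "q2 [ab, bc, bd, ac, ad, cd] [ab', bc', bd', ac', ad', cd'] = q2 [ab, ac, ad, bc, bd, cd] [ab',
    ac', ad', bc', bd', cd']"
proof -
  have "\<forall>ab ac ad bc bd cd ab' ac' ad' bc' bd' cd'. q2 [ab, bc, bd, ac, ad, cd] [ab', bc',
    bd', ac', ad', cd'] = q2 [ab, ac, ad, bc, bd, cd] [ab', ac', ad', bc', bd', cd']"
    by (simp only: all_bool q2_table q2_table' q2_zero F2_rows list.distinct simp_thms)
  then show ?thesis
    by blast
qed

lemma q2_swap3: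
  "q2 [ab, ad, ac, bd, bc, cd] [ab', ad', ac', bd', bc', cd'] = q2 [ab, ac, ad, bc, bd, cd] [ab',
    ac', ad', bc', bd', cd']"
proof -
  have "\<forall>ab ac ad bc bd cd ab' ac' ad' bc' bd' cd'. q2 [ab, ad, ac, bd, bc, cd] [ab', ad',
    ac', bd', bc', cd'] = q2 [ab, ac, ad, bc, bd, cd] [ab', ac', ad', bc', bd', cd']"
    by (simp only: all_bool q2_table q2_table' q2_zero F2_rows list.distinct simp_thms)
  then show ?thesis
    by blast
qed

lemma q3_zero: "F3 u = [] \<Longrightarrow> q3 u v = 0" "F3 v = [] \<Longrightarrow> q3 u v = 0"
  by (simp_all add: q3_def dot_commute[of _ "[]"])

lemma q3_swap2:
  "q3 [ac, ab, ad, bc, cd, bd] [ac', ab', ad', bc', cd', bd'] = q3 [ab, ac, ad, bc, bd, cd] [ab',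
    ac', ad', bc', bd', cd']"
proof -
  have "\<forall>ab ac ad bc bd cd ab' ac' ad' bc' bd' cd'. q3 [ac, ab, ad, bc, cd, bd] [ac', ab',
    ad', bc', cd', bd'] = q3 [ab, ac, ad, bc, bd, cd] [ab', ac', ad', bc', bd', cd']"
    by (simp only: all_bool q3_table q3_table' q3_zero F3_rows list.distinct simp_thms)
  then show ?thesis
    by blast
qed

lemma q3_swap3:
  "q3 [ab, ad, ac, bd, bc, cd] [ab', ad', ac', bd', bc', cd'] = q3 [ab, ac, ad, bc, bd, cd] [ab',
    ac', ad', bc', bd', cd']"
proof -
  have "\<forall>ab ac ad bc bd cd ab' ac' ad' bc' bd' cd'. q3 [ab, ad, ac, bd, bc, cd] [ab', ad',
    ac', bd', bc', cd'] = q3 [ab, ac, ad, bc, bd, cd] [ab', ac', ad', bc', bd', cd']"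
    by (simp only: all_bool q3_table q3_table' q3_zero F3_rows list.distinct simp_thms)
  then show ?thesis
    by blast
qed

lemma q4_zero: "F4 u = [] \<Longrightarrow> q4 u v = 0" "F4 v = [] \<Longrightarrow> q4 u v = 0"
  by (simp_all add: q4_def dot_commute[of _ "[]"])

text \<open>Two orderings of the same root that put it in normal form differ by a symmetry of that
  form. A transposition may thus lead to another clause of \<open>flag\<close>, but the argument
  orders differ only by symmetries under which the Gram matrices are invariant.\<close>

lemma dot_flag_swap:
  "dot (flag abc abd bcd acd ab bc bd ac ad cd) (flag abc abd bcd acd ab' bc' bd' ac' ad' cd') =
   dot (flag abc abd acd bcd ab ac ad bc bd cd) (flag abc abd acd bcd ab' ac' ad' bc' bd' cd')"
  "dot (flag abc acd abd bcd ac ab ad bc cd bd) (flag abc acd abd bcd ac' ab' ad' bc' cd' bd') =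
   dot (flag abc abd acd bcd ab ac ad bc bd cd) (flag abc abd acd bcd ab' ac' ad' bc' bd' cd')"
  "dot (flag abd abc acd bcd ab ad ac bd bc cd) (flag abd abc acd bcd ab' ad' ac' bd' bc' cd') =
   dot (flag abc abd acd bcd ab ac ad bc bd cd) (flag abc abd acd bcd ab' ac' ad' bc' bd' cd')"
  by (cases abc; cases abd; cases acd; cases bcd;
      simp only: flag.simps q0_def[symmetric] q1_def[symmetric] q2_def[symmetric] q3_def[symmetric]
        q0_swap1 q0_swap2 q0_swap3 q1_swap1 q1_swap2 q2_swap1 q2_swap3 q3_swap2 q3_swap3)+

lemma degree_term_swap:
  "degree_term abc abd bcd acd b a c d = degree_term abc abd acd bcd a b c d"
  "degree_term abc acd abd bcd a c b d = degree_term abc abd acd bcd a b c d"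
  "degree_term abd abc acd bcd a b d c = degree_term abc abd acd bcd a b c d"
  by (cases abc; cases abd; cases acd; cases bcd; simp add: degree_term_def vertex_weight_table)+

text \<open>In \<open>T4\<close> the first coordinate is even and the second odd under the exchange
  of the two roots, so this exchange preserves inner products only. The exchange of the two further
  vertices fixes \<open>F4\<close> itself.\<close>

lemma q4_swap:
  "q4 [x, y, w, z] [x', y', w', z'] = q4 [x, y, z, w] [x', y', z', w']"
  "q4 [y, x, z, w] v = q4 [x, y, z, w] v"
  "q4 v [y, x, z, w] = q4 v [x, y, z, w]"
proof -
  have "\<forall>x y z w x' y' z' w'. q4 [x, y, w, z] [x', y', w', z'] = q4 [x, y, z, w] [x', y',
    z', w']"
    by (simp only: all_bool q4_table q4_table' q4_zero F4_rows list.distinct simp_thms)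
  then show "q4 [x, y, w, z] [x', y', w', z'] = q4 [x, y, z, w] [x', y', z', w']"
    by blast
  have "\<forall>x y z w. F4 [y, x, z, w] = F4 [x, y, z, w]"
    by (simp only: all_bool F4_rows simp_thms)
  then show "q4 [y, x, z, w] v = q4 [x, y, z, w] v" "q4 v [y, x, z, w] = q4 v [x, y, z, w]"
    unfolding q4_def by metis+
qed

locale symmetric3 =
  fixes E :: "'v \<Rightarrow> 'v \<Rightarrow> 'v \<Rightarrow> bool"
  assumes sym12: "E a b c = E b a c" and sym23: "E a b c = E a c b"
begin

lemma quad_term_swap:
  "quad_term E b a c d e f = quad_term E a b c d e f"
  "quad_term E a c b d e f = quad_term E a b c d e f"
  "quad_term E a b d c e f = quad_term E a b c d e f"
  "quad_term E a b c d f e = quad_term E a b c d e f"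
     apply (simp only: quad_term_def sym12[of b a] dot_flag_swap(1) degree_term_swap(1))
    apply (simp only: quad_term_def sym12[of c b] sym23[of _ c b] dot_flag_swap(2)
      degree_term_swap(2))
   apply (simp only: quad_term_def sym12[of d c] sym23[of _ d c] dot_flag_swap(3)
     degree_term_swap(3))
  apply (simp only: quad_term_def sym23[of _ f e] dot_commute)
  done

lemma pair_term_swap:
  "pair_term E b a c d e f = pair_term E a b c d e f"
  "pair_term E a b d c e f = pair_term E a b c d e f"
  "pair_term E a b c d f e = pair_term E a b c d e f"
  "pair_term E a b e f c d = pair_term E a b c d e f"
     apply (simp only: pair_term_def sym12[of b a] q4_swap(1))
    apply (simp only: pair_term_def sym12[of d c] sym23[of _ d c] q4_swap(2))
   apply (simp only: pair_term_def sym12[of f e] sym23[of _ f e] q4_swap(3))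
  apply (simp only: pair_term_def q4_def dot_commute)
  done

lemmas certificate_value_expand =
  certificate_value_def[of E "[x0, x1, x2, x3, x4, x5]" for x0 x1 x2 x3 x4 x5, unfolded
    quad_orders_def pair_orders_def,
    simplified]

lemma certificate_value_swap_0_5:
  "certificate_value E [x1, x0, x2, x3, x4, x5] = certificate_value E [x0, x1, x2, x3, x4, x5]"
  "certificate_value E [x0, x2, x1, x3, x4, x5] = certificate_value E [x0, x1, x2, x3, x4, x5]"
  "certificate_value E [x0, x1, x3, x2, x4, x5] = certificate_value E [x0, x1, x2, x3, x4, x5]"
  "certificate_value E [x0, x1, x2, x4, x3, x5] = certificate_value E [x0, x1, x2, x3, x4, x5]"
  "certificate_value E [x0, x1, x2, x3, x5, x4] = certificate_value E [x0, x1, x2, x3, x4, x5]"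
proof -
  show "certificate_value E [x1, x0, x2, x3, x4, x5] = certificate_value E [x0, x1, x2, x3, x4, x5]"
    unfolding certificate_value_expand
    \<comment> \<open>The instances fire only where \<open>x1\<close> precedes \<open>x0\<close> in
      the same block, or where it leads the first of two exchangeable pairs and \<open>x0\<close>
      the second. They bring the terms back to the sorted representatives, so that the two sums
      differ only in the order of summands.\<close>
    by (simp only: quad_term_swap(1)[of x1 x0] quad_term_swap(2)[of _ x1 x0]
      quad_term_swap(3)[of _ _ x1 x0] quad_term_swap(4)[of _ _ _ _ x1 x0]
      pair_term_swap(1)[of x1 x0] pair_term_swap(2)[of _ _ x1 x0] pair_term_swap(3)[of _ _ _ _ x1
        x0]
      pair_term_swap(4)[of _ _ x1 _ x0] add.assoc add.commute add.left_commute)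
  show "certificate_value E [x0, x2, x1, x3, x4, x5] = certificate_value E [x0, x1, x2, x3, x4, x5]"
    unfolding certificate_value_expand
    by (simp only: quad_term_swap(1)[of x2 x1] quad_term_swap(2)[of _ x2 x1]
      quad_term_swap(3)[of _ _ x2 x1] quad_term_swap(4)[of _ _ _ _ x2 x1]
      pair_term_swap(1)[of x2 x1] pair_term_swap(2)[of _ _ x2 x1] pair_term_swap(3)[of _ _ _ _ x2
        x1]
      pair_term_swap(4)[of _ _ x2 _ x1] add.assoc add.commute add.left_commute)
  show "certificate_value E [x0, x1, x3, x2, x4, x5] = certificate_value E [x0, x1, x2, x3, x4, x5]"
    unfolding certificate_value_expand
    by (simp only: quad_term_swap(1)[of x3 x2] quad_term_swap(2)[of _ x3 x2]
      quad_term_swap(3)[of _ _ x3 x2] quad_term_swap(4)[of _ _ _ _ x3 x2]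
      pair_term_swap(1)[of x3 x2] pair_term_swap(2)[of _ _ x3 x2] pair_term_swap(3)[of _ _ _ _ x3
        x2]
      pair_term_swap(4)[of _ _ x3 _ x2] add.assoc add.commute add.left_commute)
  show "certificate_value E [x0, x1, x2, x4, x3, x5] = certificate_value E [x0, x1, x2, x3, x4, x5]"
    unfolding certificate_value_expand
    by (simp only: quad_term_swap(1)[of x4 x3] quad_term_swap(2)[of _ x4 x3]
      quad_term_swap(3)[of _ _ x4 x3] quad_term_swap(4)[of _ _ _ _ x4 x3]
      pair_term_swap(1)[of x4 x3] pair_term_swap(2)[of _ _ x4 x3] pair_term_swap(3)[of _ _ _ _ x4
        x3]
      pair_term_swap(4)[of _ _ x4 _ x3] add.assoc add.commute add.left_commute)
  show "certificate_value E [x0, x1, x2, x3, x5, x4] = certificate_value E [x0, x1, x2, x3, x4, x5]"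
    unfolding certificate_value_expand
    by (simp only: quad_term_swap(1)[of x5 x4] quad_term_swap(2)[of _ x5 x4]
      quad_term_swap(3)[of _ _ x5 x4] quad_term_swap(4)[of _ _ _ _ x5 x4]
      pair_term_swap(1)[of x5 x4] pair_term_swap(2)[of _ _ x5 x4] pair_term_swap(3)[of _ _ _ _ x5
        x4]
      pair_term_swap(4)[of _ _ x5 _ x4] add.assoc add.commute add.left_commute)
qed

lemma certificate_value_swap:
  assumes "i < 5" "length xs = 6"
  shows "certificate_value E (map ((!) xs) (swap_vertices ! i)) = certificate_value E xs"
proof -
  obtain x0 x1 x2 x3 x4 x5 where xs: "xs = [x0, x1, x2, x3, x4, x5]"
    using assms(2) by (auto simp: numeral_eq_Suc length_Suc_conv)
  from assms(1) consider "i = 0" | "i = 1" | "i = 2" | "i = 3" | "i = 4"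
    by linarith
  then show ?thesis
    by cases (simp_all add: xs swap_vertices_def certificate_value_swap_0_5)
qed

lemma bits_swap:
  assumes "i < 5" "length xs = 6"
  shows "bits E (map ((!) xs) (swap_vertices ! i)) = map ((!) (bits E xs)) (swap_triples ! i)"
proof -
  obtain x0 x1 x2 x3 x4 x5 where xs: "xs = [x0, x1, x2, x3, x4, x5]"
    using assms(2) by (auto simp: numeral_eq_Suc length_Suc_conv)
  from assms(1) consider "i = 0" | "i = 1" | "i = 2" | "i = 3" | "i = 4"
    by linarith
  then show ?thesis
    by cases (simp_all add: xs swap_vertices_def swap_triples_def bits_def triples_def,
      (simp only: sym12[of x1 x0] sym23[of _ x1 x0] sym12[of x2 x0] sym23[of _ x2 x0] sym12[of x3
        x0] sym23[of _ x3 x0] sym12[of x4 x0] sym23[of _ x4 x0] sym12[of x5 x0] sym23[of _ x5 x0]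
        sym12[of x2 x1] sym23[of _ x2 x1] sym12[of x3 x1] sym23[of _ x3 x1] sym12[of x4 x1]
        sym23[of _ x4 x1] sym12[of x5 x1] sym23[of _ x5 x1] sym12[of x3 x2] sym23[of _ x3 x2]
        sym12[of x4 x2] sym23[of _ x4 x2] sym12[of x5 x2] sym23[of _ x5 x2] sym12[of x4 x3]
        sym23[of _ x4 x3] sym12[of x5 x3] sym23[of _ x5 x3] sym12[of x5 x4] sym23[of _ x5 x4]
        simp_thms)+)
qed

lemma certificate_value_eq_bits_value:
  assumes "length xs = 6"
  shows "certificate_value E xs = bits_value (bits E xs)"
proof -
  obtain x0 x1 x2 x3 x4 x5 where xs: "xs = [x0, x1, x2, x3, x4, x5]"
    using assms by (auto simp: numeral_eq_Suc length_Suc_conv)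
  have bits: "bits E [x0, x1, x2, x3, x4, x5] = [E x0 x1 x2, E x0 x1 x3, E x0 x1 x4, E x0 x1 x5, E
    x0 x2 x3, E x0 x2 x4, E x0 x2 x5, E x0 x3 x4, E x0 x3 x5, E x0 x4 x5, E x1 x2 x3, E x1 x2 x4, E
    x1 x2 x5, E x1 x3 x4, E x1 x3 x5, E x1 x4 x5, E x2 x3 x4, E x2 x3 x5, E x2 x4 x5, E x3 x4 x5]"
    by (simp add: bits_def triples_def)
  show ?thesis
    unfolding xs bits certificate_value_expand bits_value.simps quad_term_def pair_term_def
    by (simp only: sym12[of x1 x0] sym23[of _ x1 x0] sym12[of x2 x0] sym23[of _ x2 x0] sym12[of x3
      x0] sym23[of _ x3 x0] sym12[of x4 x0] sym23[of _ x4 x0] sym12[of x5 x0] sym23[of _ x5 x0]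
      sym12[of x2 x1] sym23[of _ x2 x1] sym12[of x3 x1] sym23[of _ x3 x1] sym12[of x4 x1] sym23[of
      _ x4 x1] sym12[of x5 x1] sym23[of _ x5 x1] sym12[of x3 x2] sym23[of _ x3 x2] sym12[of x4 x2]
      sym23[of _ x4 x2] sym12[of x5 x2] sym23[of _ x5 x2] sym12[of x4 x3] sym23[of _ x4 x3]
      sym12[of x5 x3] sym23[of _ x5 x3] sym12[of x5 x4] sym23[of _ x5 x4] add.assoc add.commute
      add.left_commute)
qed

end

section \<open>Sums over tuples and soundness of the certificate\<close>

definition tuples :: "'v set \<Rightarrow> nat \<Rightarrow> 'v list set" where
  "tuples V n = {xs. set xs \<subseteq> V \<and> length xs = n}"

lemma tuples_0: "tuples V 0 = {[]}"
  by (auto simp: tuples_def)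

lemma finite_tuples: "finite V \<Longrightarrow> finite (tuples V n)"
  by (simp add: tuples_def finite_lists_length_eq)

lemma sum_tuples_Suc:
  assumes "finite V"
  shows "(\<Sum>xs\<in>tuples V (Suc n). h xs) = (\<Sum>x\<in>V. \<Sum>xs\<in>tuples V n. h (x #
    xs))"
proof -
  have "tuples V (Suc n) = (\<lambda>(x, xs). x # xs) ` (V \<times> tuples V n)"
    by (force simp: tuples_def length_Suc_conv)
  moreover have "inj_on (\<lambda>(x, xs). x # xs) (V \<times> tuples V n)"
    by (auto simp: inj_on_def)
  ultimately have "(\<Sum>xs\<in>tuples V (Suc n). h xs) = (\<Sum>(x, xs)\<in>V \<times> tuples V
    n. h (x # xs))"
    by (simp add: sum.reindex case_prod_unfold)
  then show ?thesis
    by (simp add: sum.cartesian_product)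
qed

lemma sum_tuples_6:
  assumes "finite V"
  shows "(\<Sum>xs\<in>tuples V 6. h xs) =
    (\<Sum>a\<in>V. \<Sum>b\<in>V. \<Sum>c\<in>V. \<Sum>d\<in>V. \<Sum>e\<in>V. \<Sum>f\<in>V. h
      [a, b, c, d, e, f])"
  by (simp add: numeral_eq_Suc sum_tuples_Suc[OF assms] tuples_0)

lemma bij_betw_permute_tuples:
  assumes V: "finite V" and p: "set p = {..<n}" "length p = n"
  shows "bij_betw (\<lambda>xs. map ((!) xs) p) (tuples V n) (tuples V n)"
proof -
  have "inj_on (\<lambda>xs. map ((!) xs) p) (tuples V n)"
  proof (rule inj_onI)
    fix xs ys
    assume "xs \<in> tuples V n" "ys \<in> tuples V n" "map ((!) xs) p = map ((!) ys) p"
    then show "xs = ys"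
      using p by (intro nth_equalityI) (auto simp: tuples_def)
  qed
  moreover have "(\<lambda>xs. map ((!) xs) p) ` tuples V n \<subseteq> tuples V n"
    using p by (force simp: tuples_def)
  ultimately show ?thesis
    using endo_inj_surj[OF finite_tuples[OF V]] by (auto simp: bij_betw_def)
qed

lemma sum_permute_tuples:
  assumes "finite V" "set p = {..<n}" "length p = n"
  shows "(\<Sum>xs\<in>tuples V n. h (map ((!) xs) p)) = (\<Sum>xs\<in>tuples V n. h xs)"
  by (rule sum.reindex_bij_betw[OF bij_betw_permute_tuples[OF assms]])

text \<open>Padding by zeros makes \<open>dot\<close>, which stops at the end of the shorter list, a
  standard inner product; \<open>[]\<close> becomes the zero vector.\<close>

definition coord :: "int list \<Rightarrow> nat \<Rightarrow> int" where
  "coord xs k = (if k < length xs then xs ! k else 0)"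

lemma dot_eq_sum: "length xs \<le> n \<Longrightarrow> dot xs ys = (\<Sum>k<n. coord xs k * coord
  ys k)"
proof (induction xs ys arbitrary: n rule: dot.induct)
  case (1 x xs y ys)
  then obtain m where "n = Suc m" "length xs \<le> m"
    by (cases n) auto
  with 1 show ?case
    by (simp only: sum.lessThan_Suc_shift) (simp add: coord_def cong: if_cong)
qed (simp_all add: coord_def)

text \<open>By bilinearity the double sum is the squared norm of the sum of all vectors
  \<open>g e\<close>.\<close>

lemma sum_dot_nonneg:
  assumes "finite V"
  shows "0 \<le> (\<Sum>e\<in>V. \<Sum>f\<in>V. dot (g e) (g f))"
proof -
  \<comment> \<open>Serves as a common bound for the lengths of all vectors, and makes sense for
    empty \<open>V\<close> as well.\<close>
  define n where "n = (\<Sum>e\<in>V. length (g e))"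
  have len: "length (g e) \<le> n" if "e \<in> V" for e
    using that assms unfolding n_def by (intro member_le_sum) auto
  have "(\<Sum>e\<in>V. \<Sum>f\<in>V. dot (g e) (g f)) = (\<Sum>e\<in>V. \<Sum>f\<in>V. \<Sum>k<n.
    coord (g e) k * coord (g f) k)"
    by (intro sum.cong refl dot_eq_sum len)
  also have "\<dots> = (\<Sum>e\<in>V. \<Sum>k<n. \<Sum>f\<in>V. coord (g e) k * coord (g f) k)"
    by (intro sum.cong refl sum.swap)
  also have "\<dots> = (\<Sum>k<n. \<Sum>e\<in>V. \<Sum>f\<in>V. coord (g e) k * coord (g f) k)"
    by (rule sum.swap)
  also have "\<dots> = (\<Sum>k<n. (\<Sum>e\<in>V. coord (g e) k) * (\<Sum>f\<in>V. coord (g f) k))"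
    by (simp only: sum_product)
  finally show ?thesis
    by (simp add: sum_nonneg)
qed

section \<open>Soundness of the search tree\<close>

abbreviation consistent :: "bool option list \<Rightarrow> bool list \<Rightarrow> bool" where
  "consistent \<equiv> list_all2 (\<lambda>p b. p = None \<or> p = Some b)"

lemma consistent_assign:
  "consistent bs cs \<Longrightarrow> \<exists>v. consistent (assign v bs) cs"
proof (induction bs cs rule: list_all2_induct)
  case (Cons p bs b cs)
  then show ?case
    by (cases p) auto
qed simp

lemma consistent_assign_cases:
  assumes "consistent bs cs"
  shows "consistent (assign True bs) cs \<or> consistent (assign False bs) cs"
proof -
  obtain v where "consistent (assign v bs) cs"
    using consistent_assign[OF assms] by blast
  then show ?thesis
    by (cases v) simp_all
qed

lemma consistent_no_None: "consistent bs cs \<Longrightarrow> None \<notin> set bs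
  \<Longrightarrow> map the bs = cs"
  by (induction bs cs rule: list_all2_induct) auto

text \<open>The pair \<open>(True, False)\<close> makes lexicographically larger patterns smaller in
  the relation \<open>lex\<close>, so passing to a larger pattern is a well-founded descent.\<close>

lemma greater_sound:
  assumes "greater as bs" "consistent as as'" "consistent bs bs'" "length as' = length bs'"
  shows "(as', bs') \<in> lex {(True, False)}"
  using assms
proof (induction as bs arbitrary: as' bs' rule: greater.induct)
  case (1 x xs y ys)
  then show ?case
    by (auto simp: list_all2_Cons1 Cons_in_lex split: if_splits)
qed simp_all

lemma swap_triples_bounds:
  assumes "i < 5"
  shows "length (swap_triples ! i) = 20" "set (swap_triples ! i) \<subseteq> {..<20}"
proof -
  from assms consider "i = 0" | "i = 1" | "i = 2" | "i = 3" | "i = 4"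
    by linarith
  then show "length (swap_triples ! i) = 20" "set (swap_triples ! i) \<subseteq> {..<20}"
    by (cases; simp add: swap_triples_def)+
qed

lemma consistent_swap:
  assumes "consistent bs cs" "length cs = 20" "i < 5"
  shows "consistent (map ((!) bs) (swap_triples ! i)) (map ((!) cs) (swap_triples ! i))"
  using assms(1,2) swap_triples_bounds[OF assms(3)]
  by (auto simp: list_all2_conv_all_nth subset_iff)

lemma words_bounds: "w \<in> set words \<Longrightarrow> set w \<subseteq> {..<5}"
proof -
  have "\<forall>w\<in>set words. set w \<subseteq> {..<5}"
    by (simp add: words_def)
  then show "w \<in> set words \<Longrightarrow> set w \<subseteq> {..<5}"
    by blast
qed

definition permute_vertices :: "nat list \<Rightarrow> 'v list \<Rightarrow> 'v list" where
  "permute_vertices w xs = foldl (\<lambda>xs i. map ((!) xs) (swap_vertices ! i)) xs w"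

lemma swap_vertices_bounds:
  assumes "i < 5"
  shows "length (swap_vertices ! i) = 6"
proof -
  from assms consider "i = 0" | "i = 1" | "i = 2" | "i = 3" | "i = 4"
    by linarith
  then show ?thesis
    by cases (simp_all add: swap_vertices_def)
qed

lemma length_bits: "length (bits E xs) = 20"
  by (simp add: bits_def triples_def)

context symmetric3
begin

lemma permute:
  assumes "set w \<subseteq> {..<5}" "length xs = 6" "consistent bs (bits E xs)"
  shows "length (permute_vertices w xs) = 6 \<and>
    certificate_value E (permute_vertices w xs) = certificate_value E xs \<and>
    consistent (permute_bits w bs) (bits E (permute_vertices w xs))"
  using assms
proof (induction w arbitrary: xs bs)
  case (Cons i w)
  let ?xs = "map ((!) xs) (swap_vertices ! i)" and ?bs = "map ((!) bs) (swap_triples ! i)"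
  have i: "i < 5" and w: "set w \<subseteq> {..<5}"
    using Cons.prems(1) by simp_all
  have xs: "length ?xs = 6" "certificate_value E ?xs = certificate_value E xs"
    using swap_vertices_bounds[OF i] certificate_value_swap[OF i] Cons.prems(2) by simp_all
  have "consistent ?bs (bits E ?xs)"
    unfolding bits_swap[OF i Cons.prems(2)]
    by (rule consistent_swap[OF Cons.prems(3) length_bits i])
  from Cons.IH[OF w xs(1) this] show ?case
    by (simp add: permute_vertices_def permute_bits_def xs(2))
qed (simp add: permute_vertices_def permute_bits_def)

end

locale K4_J4_free = symmetric3 +
  assumes K4_free: "\<not> (E a b c \<and> E a b d \<and> E a c d \<and> E b c d)"
    and J4_free: "\<not> (E v a b \<and> E v a c \<and> E v a d \<and> E v b c \<and> E v b d
      \<and> E v c d)"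
begin

lemma forbidden_sound:
  assumes "length xs = 6" "k < length forbidden"
  shows "\<exists>i\<in>set (forbidden ! k). \<not> bits E xs ! i"
proof -
  obtain x0 x1 x2 x3 x4 x5 where xs: "xs = [x0, x1, x2, x3, x4, x5]"
    using assms(1) by (auto simp: numeral_eq_Suc length_Suc_conv)
  have bits: "bits E [x0, x1, x2, x3, x4, x5] = [E x0 x1 x2, E x0 x1 x3, E x0 x1 x4, E x0 x1 x5, E
    x0 x2 x3, E x0 x2 x4, E x0 x2 x5, E x0 x3 x4, E x0 x3 x5, E x0 x4 x5, E x1 x2 x3, E x1 x2 x4, E
    x1 x2 x5, E x1 x3 x4, E x1 x3 x5, E x1 x4 x5, E x2 x3 x4, E x2 x3 x5, E x2 x4 x5, E x3 x4 x5]"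
    by (simp add: bits_def triples_def)
  note free = K4_free[of x0 x1 x2 x3] K4_free[of x0 x1 x2 x4] K4_free[of x0 x1 x2 x5] K4_free[of x0
    x1 x3 x4] K4_free[of x0 x1 x3 x5] K4_free[of x0 x1 x4 x5] K4_free[of x0 x2 x3 x4] K4_free[of x0
    x2 x3 x5] K4_free[of x0 x2 x4 x5] K4_free[of x0 x3 x4 x5] K4_free[of x1 x2 x3 x4] K4_free[of x1
    x2 x3 x5] K4_free[of x1 x2 x4 x5] K4_free[of x1 x3 x4 x5] K4_free[of x2 x3 x4 x5] J4_free[of x4
    x0 x1 x2 x3] J4_free[of x5 x0 x1 x2 x3] J4_free[of x3 x0 x1 x2 x4] J4_free[of x5 x0 x1 x2 x4]
    J4_free[of x3 x0 x1 x2 x5] J4_free[of x4 x0 x1 x2 x5] J4_free[of x2 x0 x1 x3 x4] J4_free[of x5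
    x0 x1 x3 x4] J4_free[of x2 x0 x1 x3 x5] J4_free[of x4 x0 x1 x3 x5] J4_free[of x2 x0 x1 x4 x5]
    J4_free[of x3 x0 x1 x4 x5] J4_free[of x1 x0 x2 x3 x4] J4_free[of x5 x0 x2 x3 x4] J4_free[of x1
    x0 x2 x3 x5] J4_free[of x4 x0 x2 x3 x5] J4_free[of x1 x0 x2 x4 x5] J4_free[of x3 x0 x2 x4 x5]
    J4_free[of x1 x0 x3 x4 x5] J4_free[of x2 x0 x3 x4 x5] J4_free[of x0 x1 x2 x3 x4] J4_free[of x5
    x1 x2 x3 x4] J4_free[of x0 x1 x2 x3 x5] J4_free[of x4 x1 x2 x3 x5] J4_free[of x0 x1 x2 x4 x5]
    J4_free[of x3 x1 x2 x4 x5] J4_free[of x0 x1 x3 x4 x5] J4_free[of x2 x1 x3 x4 x5] J4_free[of x0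
    x2 x3 x4 x5] J4_free[of x1 x2 x3 x4 x5]
  \<comment> \<open>Each adjacency gets its arguments in increasing order, as in
    \<open>bits\<close>, and each instance becomes a disjunction, the shape to which the existential
    over a row of \<open>forbidden\<close> unfolds.\<close>
  note free' = free[simplified sym12[of x1 x0] sym23[of _ x1 x0] sym12[of x2 x0] sym23[of _ x2 x0]
    sym12[of x3 x0] sym23[of _ x3 x0] sym12[of x4 x0] sym23[of _ x4 x0] sym12[of x5 x0] sym23[of _
    x5 x0] sym12[of x2 x1] sym23[of _ x2 x1] sym12[of x3 x1] sym23[of _ x3 x1] sym12[of x4 x1]
    sym23[of _ x4 x1] sym12[of x5 x1] sym23[of _ x5 x1] sym12[of x3 x2] sym23[of _ x3 x2] sym12[of
    x4 x2] sym23[of _ x4 x2] sym12[of x5 x2] sym23[of _ x5 x2] sym12[of x4 x3] sym23[of _ x4 x3]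
    sym12[of x5 x3] sym23[of _ x5 x3] sym12[of x5 x4] sym23[of _ x5 x4] de_Morgan_conj]
  have "\<forall>f\<in>set forbidden. \<exists>i\<in>set f. \<not> bits E xs ! i"
    unfolding forbidden_def xs bits list.set ball_simps bex_simps nth_Cons_pred nth_Cons_0
      pred_numeral_simps
      BitM.simps numeral_One
    by (simp only: free' simp_thms)
  then show ?thesis
    using assms(2) by simp
qed

text \<open>The last assumption is the induction hypothesis of the well-founded induction in
  \<open>certificate_value_neg\<close>; the case \<open>Swaps\<close> consumes it, for a relabelled
  tuple with the same value and a larger pattern.\<close>

lemma check_sound:
  assumes "check t bs" "length xs = 6" "consistent bs (bits E xs)"
    and "\<And>ys. length ys = 6 \<Longrightarrow> (bits E ys, bits E xs) \<in> lex {(True, False)}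
      \<Longrightarrow> certificate_value E ys < 0"
  shows "certificate_value E xs < 0"
  using assms
proof (induction t arbitrary: bs)
  case Leaf
  then show ?case
    using consistent_no_None[OF Leaf.prems(3)] by (simp add: certificate_value_eq_bits_value)
next
  case (Br s t)
  then show ?case
    using consistent_assign_cases[OF Br.prems(3)] by auto
next
  case (Swaps k)
  then have w: "set (words ! k) \<subseteq> {..<5}"
    by (simp add: words_bounds)
  note p = conjunct1[OF permute[OF w Swaps.prems(2,3)]] conjunct2[OF permute[OF w Swaps.prems(2,3)]]
  have "(bits E (permute_vertices (words ! k) xs), bits E xs) \<in> lex {(True, False)}"
    using Swaps.prems(1) by (intro greater_sound[OF _ conjunct2[OF p(2)] Swaps.prems(3)]) (simp_all
      add: length_bits)
  then show ?case
    using Swaps.prems(4)[OF p(1)] p(2) by simp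
next
  case (Dead k)
  then have k: "k < length forbidden" and f: "\<forall>i\<in>set (forbidden ! k). bs ! i = Some
    True"
    by simp_all
  obtain i where i: "i \<in> set (forbidden ! k)" "\<not> bits E xs ! i"
    using forbidden_sound[OF Dead.prems(2) k] by blast
  have "\<forall>f\<in>set forbidden. set f \<subseteq> {..<20}"
    by (simp add: forbidden_def)
  then have "i < 20"
    using i(1) k nth_mem by blast
  then have "bs ! i = None \<or> bs ! i = Some (bits E xs ! i)"
    using Dead.prems(3) by (auto simp: list_all2_conv_all_nth length_bits)
  then show ?case
    using i f by auto
qed

text \<open>Induction towards larger patterns replaces an argument about maximal elements of orbits:
  a tuple whose branch ends in \<open>Swaps\<close> is reduced to one with a larger pattern.\<close>

lemma certificate_value_neg:
  assumes "length xs = 6"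
  shows "certificate_value E xs < 0"
proof -
  have "wf (inv_image (lex {(True, False)}) (bits E))"
    by (intro wf_inv_image wf_lex) (simp add: wf_insert)
  then show ?thesis
    using assms
  proof (induction xs rule: wf_induct_rule)
    case (less xs)
    have "consistent (replicate 20 None) (bits E xs)"
      by (simp add: list_all2_conv_all_nth length_bits)
    then show ?case
    proof (rule check_sound[OF certificate_correct less.prems])
      show "certificate_value E ys < 0"
        if "length ys = 6" "(bits E ys, bits E xs) \<in> lex {(True, False)}" for ys
        using that by (intro less.IH) (simp_all add: inv_image_def)
    qed
  qed
qed

end

section \<open>Averaging over all 6-tuples of vertices\<close>

lemma vertex_weight_nonneg: "0 \<le> vertex_weight x y z w"
  by (cases x; cases y; cases z; cases w; simp add: vertex_weight_def)

lemma quad_orders_permutations: "p \<in> set quad_orders \<Longrightarrow> set p = {..<6} \<and>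
  length p = 6"
  unfolding quad_orders_def by (auto simp: lessThan_nat_numeral lessThan_Suc)

lemma pair_orders_permutations: "p \<in> set pair_orders \<Longrightarrow> set p = {..<6} \<and>
  length p = 6"
  unfolding pair_orders_def by (auto simp: lessThan_nat_numeral lessThan_Suc)

text \<open>The weights depend on the root only, so each of the four sums factors into a nonnegative
  weight and an excess degree \<open>315 d(v) - 151 n^2\<close>, with \<open>d\<close> counting
  ordered pairs.\<close>

lemma sum_degree_term_nonneg:
  assumes "finite V"
    and deg: "\<And>v. v \<in> V \<Longrightarrow> 151 * (int (card V))\<^sup>2 \<le> 315 *
      (\<Sum>e\<in>V. \<Sum>f\<in>V. of_bool (E v e f))"
    and V: "a \<in> V" "b \<in> V" "c \<in> V" "d \<in> V"
  shows "0 \<le> (\<Sum>e\<in>V. \<Sum>f\<in>V. degree_term s1 s2 s3 s4 (E a e f) (E b e f) (E c e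
    f) (E d e f))"
proof -
  have nonneg: "0 \<le> (\<Sum>e\<in>V. \<Sum>f\<in>V. vertex_weight x y z w * (315 * of_bool (E v
    e f) - 151))"
    if "v \<in> V" for x y z w v
  proof -
    have "(\<Sum>e\<in>V. \<Sum>f\<in>V. vertex_weight x y z w * (315 * of_bool (E v e f) - 151)) =
        vertex_weight x y z w * (315 * (\<Sum>e\<in>V. \<Sum>f\<in>V. of_bool (E v e f)) - 151 *
          (int (card V))\<^sup>2)"
      by (simp only: sum_distrib_left[symmetric] sum_subtractf sum_constant) (simp add:
        power2_eq_square)
    then show ?thesis
      using deg[OF that] vertex_weight_nonneg by (simp only: mult_nonneg_nonneg diff_ge_0_iff_ge)
  qed
  show ?thesis
    unfolding degree_term_def sum.distrib by (intro add_nonneg_nonneg nonneg V)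
qed

lemma sum_quad_term_nonneg:
  assumes V: "finite V"
    and deg: "\<And>v. v \<in> V \<Longrightarrow> 151 * (int (card V))\<^sup>2 \<le> 315 *
      (\<Sum>e\<in>V. \<Sum>f\<in>V. of_bool (E v e f))"
  shows "0 \<le> (\<Sum>xs\<in>tuples V 6. list6 (quad_term E) xs)"
proof -
  have inner: "0 \<le> (\<Sum>e\<in>V. \<Sum>f\<in>V. quad_term E a b c d e f)"
    if "a \<in> V" "b \<in> V" "c \<in> V" "d \<in> V" for a b c d
    unfolding quad_term_def sum.distrib
    by (intro add_nonneg_nonneg sum_degree_term_nonneg[OF V deg that] sum_dot_nonneg[OF V])
  show ?thesis
    unfolding sum_tuples_6[OF V] list6.simps
    by (rule sum_nonneg, rule sum_nonneg, rule sum_nonneg, rule sum_nonneg, rule inner)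
qed

lemma sum_pair_term_nonneg:
  assumes V: "finite V"
  shows "0 \<le> (\<Sum>xs\<in>tuples V 6. list6 (pair_term E) xs)"
proof -
  have inner: "0 \<le> (\<Sum>c\<in>V. \<Sum>d\<in>V. \<Sum>e\<in>V. \<Sum>f\<in>V. pair_term E a b
    c d e f)" for a b
  proof -
    have pairs: "(\<Sum>p\<in>V \<times> V. h p) = (\<Sum>c\<in>V. \<Sum>d\<in>V. h (c, d))" for h
      :: "_ \<Rightarrow> int"
      by (simp add: sum.cartesian_product)
    define g where "g = (\<lambda>(c, d). F4 [E a b c, E a b d, E a c d, E b c d])"
    have "(\<Sum>c\<in>V. \<Sum>d\<in>V. \<Sum>e\<in>V. \<Sum>f\<in>V. pair_term E a b c d e f) =
        (\<Sum>p\<in>V \<times> V. \<Sum>r\<in>V \<times> V. dot (g p) (g r))"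
      by (simp only: pairs pair_term_def q4_def g_def case_prod_conv)
    also have "0 \<le> \<dots>"
      by (rule sum_dot_nonneg) (use V in simp)
    finally show ?thesis .
  qed
  show ?thesis
    unfolding sum_tuples_6[OF V] list6.simps by (rule sum_nonneg, rule sum_nonneg, rule inner)
qed

text \<open>Permuting coordinates is a bijection of the set of 6-tuples, so all 15 quadruple orders
  contribute one and the same nonnegative total, and so do all 45 pair orders.\<close>

lemma sum_certificate_value_nonneg:
  assumes V: "finite V"
    and deg: "\<And>v. v \<in> V \<Longrightarrow> 151 * (int (card V))\<^sup>2 \<le> 315 *
      (\<Sum>e\<in>V. \<Sum>f\<in>V. of_bool (E v e f))"
  shows "0 \<le> (\<Sum>xs\<in>tuples V 6. certificate_value E xs)"
proof -
  have perm: "(\<Sum>xs\<in>tuples V 6. \<Sum>p\<leftarrow>ps. h (map ((!) xs) p)) =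
    (\<Sum>p\<leftarrow>ps. \<Sum>xs\<in>tuples V 6. h xs)"
    if "\<And>p. p \<in> set ps \<Longrightarrow> set p = {..<6} \<and> length p = 6" for ps and h
      :: "'a list \<Rightarrow> int"
    using that
  proof (induction ps)
    case (Cons p ps)
    then show ?case
      using sum_permute_tuples[OF V, of p 6 h] by (simp add: sum.distrib)
  qed simp
  have quad: "(\<Sum>xs\<in>tuples V 6. \<Sum>p\<leftarrow>quad_orders. list6 (quad_term E) (map
    ((!) xs) p)) =
      (\<Sum>p\<leftarrow>quad_orders. \<Sum>xs\<in>tuples V 6. list6 (quad_term E) xs)"
    by (rule perm) (rule quad_orders_permutations)
  have pair: "(\<Sum>xs\<in>tuples V 6. \<Sum>p\<leftarrow>pair_orders. list6 (pair_term E) (map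
    ((!) xs) p)) =
      (\<Sum>p\<leftarrow>pair_orders. \<Sum>xs\<in>tuples V 6. list6 (pair_term E) xs)"
    by (rule perm) (rule pair_orders_permutations)
  show ?thesis
    unfolding certificate_value_def sum.distrib quad pair
    by (intro add_nonneg_nonneg sum_list_nonneg)
      (auto simp: sum_quad_term_nonneg[OF V deg] sum_pair_term_nonneg[OF V])
qed

lemma exists_low_degree:
  fixes E :: "'v \<Rightarrow> 'v \<Rightarrow> 'v \<Rightarrow> bool"
  assumes V: "finite V" "V \<noteq> {}"
    and E: "\<And>a b c. E a b c = E b a c" "\<And>a b c. E a b c = E a c b"
    "\<And>a b c d. \<not> (E a b c \<and> E a b d \<and> E a c d \<and> E b c d)"
    "\<And>v a b c d. \<not> (E v a b \<and> E v a c \<and> E v a d \<and> E v b c \<and> E v b d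
      \<and> E v c d)"
  shows "\<exists>v\<in>V. 315 * (\<Sum>e\<in>V. \<Sum>f\<in>V. of_bool (E v e f)) < 151 * (int
    (card V))\<^sup>2"
proof (rule ccontr)
  interpret K4_J4_free E
    by unfold_locales (fact E)+
  assume "\<not> ?thesis"
  then have "0 \<le> (\<Sum>xs\<in>tuples V 6. certificate_value E xs)"
    by (intro sum_certificate_value_nonneg V(1)) auto
  moreover have "(\<Sum>xs\<in>tuples V 6. certificate_value E xs) < 0"
  proof (rule sum_strict_mono[of "tuples V 6" _ "\<lambda>_. 0", simplified])
    show "finite (tuples V 6)"
      by (rule finite_tuples[OF V(1)])
    obtain v where "v \<in> V"
      using V(2) by blast
    then have "replicate 6 v \<in> tuples V 6"
      by (simp add: tuples_def)
    then show "tuples V 6 \<noteq> {}"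
      by blast
    show "certificate_value E xs < 0" if "xs \<in> tuples V 6" for xs
      using that by (intro certificate_value_neg) (simp add: tuples_def)
  qed
  ultimately show False
    by simp
qed

section \<open>Existence of the Turan density\<close>

definition edge_counts :: "nat \<Rightarrow> 'b hgraph set \<Rightarrow> nat set" where
  "edge_counts n \<F> = {card (edges G) | G :: nat hgraph.
     three_graph G \<and> finite (vertices G) \<and> card (vertices G) = n \<and> family_free \<F>
       G}"

lemma ex_number_eq_Max: "ex_number n \<F> = Max (edge_counts n \<F>)"
  by (simp add: ex_number_def edge_counts_def)

lemma finite_edges: "three_graph G \<Longrightarrow> finite (vertices G) \<Longrightarrow> finite
  (edges G)"
  by (rule finite_subset[of _ "Pow (vertices G)"]) (auto simp: three_graph_def)

lemma card_edges_le:
  assumes "three_graph G" "finite (vertices G)"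
  shows "card (edges G) \<le> card (vertices G) choose 3"
proof -
  have "edges G \<subseteq> {e. e \<subseteq> vertices G \<and> card e = 3}"
    using assms(1) by (auto simp: three_graph_def)
  then have "card (edges G) \<le> card {e. e \<subseteq> vertices G \<and> card e = 3}"
    by (rule card_mono[rotated]) (use assms(2) in simp)
  then show ?thesis
    by (simp add: n_subsets assms(2))
qed

lemma finite_edge_counts: "finite (edge_counts n \<F>)"
  by (rule finite_subset[of _ "{..n choose 3}"]) (auto simp: edge_counts_def card_edges_le)

lemma le_ex_number:
  fixes G :: "nat hgraph"
  assumes "three_graph G" "finite (vertices G)" "family_free \<F> G"
  shows "card (edges G) \<le> ex_number (card (vertices G)) \<F>"
  unfolding ex_number_eq_Max
  by (rule Max_ge[OF finite_edge_counts]) (use assms in \<open>auto simp: edge_counts_def\<close>)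

lemma ex_number_attained:
  assumes "\<And>H. H \<in> \<F> \<Longrightarrow> edges H \<noteq> {}"
  obtains G :: "nat hgraph" where "three_graph G" "finite (vertices G)" "card (vertices G) = n"
    "family_free \<F> G" "card (edges G) = ex_number n \<F>"
proof -
  let ?G = "\<lparr>vertices = {..<n}, edges = {}\<rparr> :: nat hgraph"
  have "family_free \<F> ?G"
    using assms by (auto simp: family_free_def contains_copy_def)
  then have "0 \<in> edge_counts n \<F>"
    unfolding edge_counts_def by (intro CollectI exI[of _ ?G]) (simp add: three_graph_def)
  then have "ex_number n \<F> \<in> edge_counts n \<F>"
    unfolding ex_number_eq_Max using finite_edge_counts by (intro Max_in) auto
  then show ?thesis
    using that by (auto simp: edge_counts_def)
qed

definition del_vertex :: "'a \<Rightarrow> 'a hgraph \<Rightarrow> 'a hgraph" where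
  "del_vertex v G = \<lparr>vertices = vertices G - {v}, edges = {e \<in> edges G. v \<notin>
    e}\<rparr>"

lemma three_graph_del_vertex: "three_graph G \<Longrightarrow> three_graph (del_vertex v G)"
  by (auto simp: three_graph_def del_vertex_def)

lemma family_free_del_vertex: "family_free \<F> G \<Longrightarrow> family_free \<F> (del_vertex v
  G)"
  unfolding family_free_def contains_copy_def del_vertex_def by fastforce

lemma sum_card_del_vertex:
  assumes "three_graph G" "finite (vertices G)" "card (vertices G) = Suc n" "2 \<le> n"
  shows "(\<Sum>v\<in>vertices G. card (edges (del_vertex v G))) = (n - 2) * card (edges G)"
proof -
  have fin: "finite (edges G)"
    by (rule finite_edges[OF assms(1,2)])
  have "(\<Sum>v\<in>vertices G. card (edges (del_vertex v G))) =
      (\<Sum>v\<in>vertices G. \<Sum>e\<in>edges G. if v \<notin> e then 1 else 0)"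
    using fin by (intro sum.cong refl) (simp add: del_vertex_def sum.If_cases Int_def)
  also have "\<dots> = (\<Sum>e\<in>edges G. \<Sum>v\<in>vertices G. if v \<notin> e then 1 else 0)"
    by (rule sum.swap)
  also have "\<dots> = (\<Sum>e\<in>edges G. n - 2)"
  proof (intro sum.cong refl)
    fix e
    assume "e \<in> edges G"
    then have e: "e \<subseteq> vertices G" "card e = 3"
      using assms(1) by (auto simp: three_graph_def)
    have "(\<Sum>v\<in>vertices G. if v \<notin> e then 1 else 0) = card (vertices G - e)"
      using assms(2) by (simp add: sum.If_cases set_diff_eq Int_def)
    then show "(\<Sum>v\<in>vertices G. if v \<notin> e then 1 else 0) = n - 2"
      using e assms(2,3) by (simp add: card_Diff_subset finite_subset)
  qed
  finally show ?thesis
    by simp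
qed

definition edge_density :: "'b hgraph set \<Rightarrow> nat \<Rightarrow> real" where
  "edge_density \<F> n = real (ex_number n \<F>) / real (n choose 3)"

text \<open>The averaging argument of Katona, Nemetz and Simonovits: of the n + 1 vertex deletions,
  each edge survives exactly n - 2.\<close>

lemma edge_density_Suc_le:
  assumes ne: "\<And>H. H \<in> \<F> \<Longrightarrow> edges H \<noteq> {}" and n: "3 \<le> n"
  shows "edge_density \<F> (Suc n) \<le> edge_density \<F> n"
proof -
  obtain G :: "nat hgraph" where G: "three_graph G" "finite (vertices G)" "card (vertices G) = Suc
    n"
    "family_free \<F> G" "card (edges G) = ex_number (Suc n) \<F>"
    using ex_number_attained ne by blast
  have "card (edges (del_vertex v G)) \<le> ex_number n \<F>" if "v \<in> vertices G" for v
  proof -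
    have "card (vertices (del_vertex v G)) = n" "finite (vertices (del_vertex v G))"
      using that G(2,3) by (auto simp: del_vertex_def)
    then show ?thesis
      using le_ex_number[OF three_graph_del_vertex[OF G(1)] _ family_free_del_vertex[OF G(4)]] by
        metis
  qed
  then have "(n - 2) * ex_number (Suc n) \<F> \<le> Suc n * ex_number n \<F>"
    using sum_card_del_vertex[OF G(1-3)] n G(3,5) sum_bounded_above[of "vertices G" _ "ex_number n
      \<F>"]
    by (metis (no_types, lifting) le_trans of_nat_id numeral_2_eq_2 numeral_3_eq_3 Suc_leD)
  then have le: "real (n - 2) * ex_number (Suc n) \<F> \<le> real (Suc n) * ex_number n \<F>"
    by (metis of_nat_le_iff of_nat_mult)
  have "Suc n * (n choose 3) = (n - 2) * (Suc n choose 3)"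
    using binomial_absorb_comp[of "Suc n" 3] n by (simp add: Suc_diff_le numeral_eq_Suc
      mult.commute)
  then have choose: "real (Suc n) * real (n choose 3) = real (n - 2) * real (Suc n choose 3)"
    by (metis of_nat_mult)
  have pos: "real (n choose 3) > 0" "real (Suc n choose 3) > 0" "real (n - 2) > 0"
    using n by (auto simp: zero_less_binomial_iff)
  have "real (n - 2) * (ex_number (Suc n) \<F> * real (n choose 3)) \<le> real (Suc n) * real (n
    choose 3) * ex_number n \<F>"
    using mult_right_mono[OF le, of "real (n choose 3)"] by (simp add: ac_simps)
  also have "\<dots> = real (n - 2) * (ex_number n \<F> * real (Suc n choose 3))"
    by (simp only: choose ac_simps)
  finally have "ex_number (Suc n) \<F> * real (n choose 3) \<le> ex_number n \<F> * real (Suc n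
    choose 3)"
    using pos(3) by (simp add: mult_le_cancel_left_pos)
  then show ?thesis
    using pos by (simp add: edge_density_def divide_le_eq le_divide_eq field_simps)
qed

lemma edge_density_antimono:
  assumes "\<And>H. H \<in> \<F> \<Longrightarrow> edges H \<noteq> {}" "3 \<le> m" "m \<le> n"
  shows "edge_density \<F> n \<le> edge_density \<F> m"
  using assms(3)
proof (induction n rule: dec_induct)
  case (step k)
  then show ?case
    using edge_density_Suc_le[OF assms(1), where n = k] assms(2) by force
qed simp

lemma edge_density_tendsto:
  assumes "\<And>H. H \<in> \<F> \<Longrightarrow> edges H \<noteq> {}"
  shows "edge_density \<F> \<longlonglongrightarrow> turan_density \<F>"
proof -
  \<comment> \<open>For n < 3 the binomial coefficient is 0 and the quotient is 0 by the convention
    for division, so monotonicity only starts at 3.\<close>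
  have "decseq (\<lambda>n. edge_density \<F> (n + 3))"
    using edge_density_antimono[OF assms] by (auto simp: decseq_def)
  moreover have "0 \<le> edge_density \<F> n" for n
    by (simp add: edge_density_def)
  ultimately obtain L where "(\<lambda>n. edge_density \<F> (n + 3)) \<longlonglongrightarrow> L"
    using decseq_convergent[of "\<lambda>n. edge_density \<F> (n + 3)" 0] by metis
  then have "convergent (\<lambda>n. edge_density \<F> (n + 3))"
    by (rule convergentI)
  then have "convergent (edge_density \<F>)"
    by (simp only: convergent_ignore_initial_segment)
  then show ?thesis
    by (simp add: convergent_LIMSEQ_iff turan_density_def edge_density_def[abs_def])
qed

section \<open>The upper bound\<close>

definition adj :: "'a hgraph \<Rightarrow> 'a \<Rightarrow> 'a \<Rightarrow> 'a \<Rightarrow> bool"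
  where
  "adj G a b c \<longleftrightarrow> {a, b, c} \<in> edges G"

lemma adj_commute: "adj G a b c = adj G b a c" "adj G a b c = adj G a c b"
  by (simp_all add: adj_def insert_commute)

lemma adj_D:
  assumes "three_graph G" "adj G a b c"
  shows "a \<noteq> b" "a \<noteq> c" "b \<noteq> c" "a \<in> vertices G" "b \<in> vertices G" "c
    \<in> vertices G"
proof -
  have card: "card {a, b, c} = 3" and "{a, b, c} \<subseteq> vertices G"
    using assms by (auto simp: three_graph_def adj_def)
  then show "a \<in> vertices G" "b \<in> vertices G" "c \<in> vertices G"
    by auto
  show "a \<noteq> b" "a \<noteq> c" "b \<noteq> c"
    using card card_insert_le_m1[of 2 "{b, c}" a] card_insert_le_m1[of 2 "{a, c}" b]
    by (auto simp: card_insert_if split: if_splits)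
qed

section \<open>Forbidden copies expressed by adjacency\<close>

lemma contains_K4:
  assumes G: "three_graph G" and adj: "adj G a b c" "adj G a b d" "adj G a c d" "adj G b c d"
  shows "contains_copy G K4"
proof -
  let ?f = "\<lambda>i. [a, b, c, d] ! (i - 1)"
  have verts: "vertices K4 = {1, 2, 3, 4}"
    by (auto simp: K4_def)
  have "e \<in> {{1, 2, 3}, {1, 2, 4}, {1, 3, 4}, {2, 3, 4}}" if e: "e \<in> edges K4" for e
  proof -
    have sub: "e \<subseteq> {1, 2, 3, 4}" and 3: "card e = 3"
      using e verts by (auto simp: K4_def)
    then have "card ({1, 2, 3, 4} - e) = 1"
      by (subst card_Diff_subset) (auto intro: finite_subset)
    then obtain x where "{1, 2, 3, 4} - e = {x}"
      by (auto simp: card_1_singleton_iff)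
    then have e: "e = {1, 2, 3, 4} - {x}" and "x \<in> {1, 2, 3, 4}"
      using sub by blast+
    then have "x = 1 \<or> x = 2 \<or> x = 3 \<or> x = 4"
      by simp
    then show ?thesis
      unfolding e by (elim disjE) (simp_all add: insert_Diff_if)
  qed
  then have "?f ` e \<in> edges G" if "e \<in> edges K4" for e
    using that adj by (fastforce simp: adj_def)
  moreover have "inj_on ?f (vertices K4)" "?f ` vertices K4 \<subseteq> vertices G"
    using adj_D[OF G adj(1)] adj_D[OF G adj(2)] adj_D[OF G adj(3)] by (auto simp: verts inj_on_def)
  ultimately show ?thesis
    unfolding contains_copy_def by blast
qed

text \<open>Any two of the five vertices occur together in one of the six edges, and an edge has
  three distinct elements; this makes the map injective.\<close>

lemma contains_J4:
  assumes G: "three_graph G" and adj: "adj G v a b" "adj G v a c" "adj G v a d" "adj G v b c"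
    "adj G v b d" "adj G v c d"
  shows "contains_copy G J4"
proof -
  let ?f = "\<lambda>i. [a, b, c, d, v] ! (i - 1)"
  have verts: "vertices J4 = {1, 2, 3, 4, 5}"
    by (auto simp: J4_def)
  have "?f ` e \<in> edges G" if "e \<in> edges J4" for e
  proof -
    have "e \<in> {{x, y, 5} | x y. {x, y} \<subseteq> {1..4} \<and> x \<noteq> y}"
      using that by (simp add: J4_def)
    then obtain x y where xy: "e = {x, y, 5}" "x \<noteq> y" "{x, y} \<subseteq> {1..4}"
      by blast
    then have "x \<in> {1, 2, 3, 4}" "y \<in> {1, 2, 3, 4}"
      by auto
    then show ?thesis
      using xy(1,2) adj by (auto simp: adj_def insert_commute)
  qed
  moreover have "inj_on ?f (vertices J4)" "?f ` vertices J4 \<subseteq> vertices G"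
    using adj_D[OF G adj(1)] adj_D[OF G adj(2)] adj_D[OF G adj(3)] adj_D[OF G adj(4)]
      adj_D[OF G adj(5)] adj_D[OF G adj(6)] by (auto simp: verts inj_on_def)
  ultimately show ?thesis
    unfolding contains_copy_def by blast
qed

lemma adj_of_J4_copy:
  assumes "contains_copy G J4"
  obtains v a b c d where "adj G v a b" "adj G v a c" "adj G v a d" "adj G v b c"
    "adj G v b d" "adj G v c d"
proof -
  obtain f where f: "\<And>e. e \<in> edges J4 \<Longrightarrow> f ` e \<in> edges G"
    using assms by (auto simp: contains_copy_def)
  have "adj G (f 5) (f x) (f y)" if "x \<in> {1..4}" "y \<in> {1..4}" "x \<noteq> y" for x y
  proof -
    have "{x, y, 5} \<in> edges J4"
      using that by (auto simp: J4_def)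
    from f[OF this] show ?thesis
      by (simp add: adj_def insert_commute)
  qed
  from that[of "f 5" "f 1" "f 2" "f 3" "f 4"] this show thesis
    by simp
qed

text \<open>An edge {v, x, y} yields the two ordered pairs (x, y) and (y, x), and different edges
  yield different pairs.\<close>

lemma degree_le_ordered_pairs:
  assumes G: "three_graph G" and fin: "finite (vertices G)"
  shows "2 * int (card {e \<in> edges G. v \<in> e}) \<le>
    (\<Sum>x\<in>vertices G. \<Sum>y\<in>vertices G. of_bool (adj G v x y))"
proof -
  let ?P = "{(x, y) \<in> vertices G \<times> vertices G. adj G v x y}"
  let ?D = "{e \<in> edges G. v \<in> e}"
  have finD: "finite ?D"
    using finite_edges[OF G fin] by simp
  have "finite ?P"
    using fin by (rule finite_subset[rotated, OF finite_cartesian_product[OF fin]]) auto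
  have pairs: "card (\<Union>e\<in>?D. {(x, y). e = {v, x, y} \<and> x \<noteq> v \<and> y \<noteq>
    v \<and> x \<noteq> y}) = 2 * card ?D"
  proof -
    have two: "card {(x, y). e = {v, x, y} \<and> x \<noteq> v \<and> y \<noteq> v \<and> x
      \<noteq> y} = 2 \<and>
        finite {(x, y). e = {v, x, y} \<and> x \<noteq> v \<and> y \<noteq> v \<and> x \<noteq> y}"
          if "e \<in> ?D" for e
    proof -
      have "card e = 3" "v \<in> e"
        using that G by (auto simp: three_graph_def)
      then have "card (e - {v}) = 2"
        by simp
      then obtain x y where xy: "e - {v} = {x, y}" "x \<noteq> y"
        by (auto simp: card_2_iff)
      then have e: "e = {v, x, y}" "x \<noteq> v" "y \<noteq> v"
        using \<open>v \<in> e\<close> by auto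
      have "{(x, y). e = {v, x, y} \<and> x \<noteq> v \<and> y \<noteq> v \<and> x \<noteq> y} =
        {(x, y), (y, x)}"
        using e xy(2) by (auto simp: doubleton_eq_iff insert_eq_iff)
      then show ?thesis
        using xy(2) by simp
    qed
    have "card (\<Union>e\<in>?D. {(x, y). e = {v, x, y} \<and> x \<noteq> v \<and> y \<noteq> v
      \<and> x \<noteq> y}) =
      (\<Sum>e\<in>?D. card {(x, y). e = {v, x, y} \<and> x \<noteq> v \<and> y \<noteq> v \<and> x
        \<noteq> y})"
      using finD two by (intro card_UN_disjoint) auto
    then show ?thesis
      using two by simp
  qed
  have "(\<Union>e\<in>?D. {(x, y). e = {v, x, y} \<and> x \<noteq> v \<and> y \<noteq> v \<and> x
    \<noteq> y}) \<subseteq> ?P"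
    using G by (auto simp: adj_def three_graph_def)
  note sub = this
  have "2 * card ?D \<le> card ?P"
    using card_mono[OF \<open>finite ?P\<close> sub] pairs by simp
  moreover have "int (card ?P) = (\<Sum>(x, y)\<in>vertices G \<times> vertices G. of_bool (adj G v
    x y))"
    using fin by (simp add: sum.If_cases of_bool_def case_prod_unfold Int_def)
      (rule arg_cong[of _ _ card], auto)
  ultimately show ?thesis
    by (simp add: sum.cartesian_product)
qed

text \<open>Deleting a vertex of low degree from a free 3-graph on k vertices loses fewer than
  151/630 k^2 edges and leaves a free 3-graph; 630 = 2 * 315 accounts for ordered pairs.\<close>

lemma card_edges_K4_J4_free:
  assumes "three_graph G" "finite (vertices G)" "family_free {K4, J4} G"
  shows "630 * int (card (edges G)) \<le> 151 * (\<Sum>k\<le>card (vertices G). (int k)\<^sup>2)"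
  using assms
proof (induction "card (vertices G)" arbitrary: G)
  case 0
  then have "edges G = {}"
    by (force simp: three_graph_def)
  then show ?case
    by (simp add: sum_nonneg)
next
  case (Suc n)
  note G = Suc.prems
  have free: "\<not> contains_copy G K4" "\<not> contains_copy G J4"
    using G(3) by (auto simp: family_free_def)
  have "vertices G \<noteq> {}"
    using Suc.hyps(2) by auto
  then have "\<exists>v\<in>vertices G. 315 * (\<Sum>x\<in>vertices G. \<Sum>y\<in>vertices G.
    of_bool (adj G v x y)) <
      151 * (int (card (vertices G)))\<^sup>2"
  proof (rule exists_low_degree[OF G(2)])
    show "\<not> (adj G a b c \<and> adj G a b d \<and> adj G a c d \<and> adj G b c d)" for a b c d
      using contains_K4[OF G(1)] free(1) by blast
    show "\<not> (adj G v a b \<and> adj G v a c \<and> adj G v a d \<and> adj G v b c \<and> adj G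
      v b d \<and> adj G v c d)"
      for v a b c d
      using contains_J4[OF G(1)] free(2) by blast
  qed (fact adj_commute)+
  then obtain v where v: "v \<in> vertices G"
    "315 * (\<Sum>x\<in>vertices G. \<Sum>y\<in>vertices G. of_bool (adj G v x y)) < 151 * (int
      (card (vertices G)))\<^sup>2"
    by blast
  let ?H = "del_vertex v G"
  have "630 * int (card (edges ?H)) \<le> 151 * (\<Sum>k\<le>card (vertices ?H). (int k)\<^sup>2)"
    using Suc.hyps(2) v(1) G
    by (intro Suc.hyps(1) three_graph_del_vertex family_free_del_vertex) (auto simp: del_vertex_def)
  moreover have "card (vertices ?H) = n"
    using Suc.hyps(2) v(1) G(2) by (simp add: del_vertex_def)
  moreover have "card (edges G) = card (edges ?H) + card {e \<in> edges G. v \<in> e}"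
    using finite_edges[OF G(1,2)]
    by (subst card_Un_disjoint[symmetric]) (auto simp: del_vertex_def intro!: arg_cong[of _ _ card])
  moreover have "2 * int (card {e \<in> edges G. v \<in> e}) \<le>
    (\<Sum>x\<in>vertices G. \<Sum>y\<in>vertices G. of_bool (adj G v x y))"
    by (rule degree_le_ordered_pairs[OF G(1,2)])
  ultimately show ?case
    using v(2) by (simp add: Suc.hyps(2)[symmetric] algebra_simps)
qed

section \<open>From edge counts to the density\<close>

lemma sum_squares_eq: "6 * (\<Sum>k\<le>n. (int k)\<^sup>2) = int n * (int n + 1) * (2 * int n + 1)"
  by (induction n) (auto simp: algebra_simps power2_eq_square)

lemma two_choose_two: "2 * (Suc (Suc n) choose 2) = (n + 2) * (n + 1)"
  by (induction n) (simp_all add: numeral_2_eq_2)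
lemma choose_Suc3: "Suc m choose 3 = (m choose 2) + (m choose 3)"
  by (simp add: numeral_3_eq_3 numeral_2_eq_2)
text \<open>The argument is shifted by 3 so that no truncated subtraction enters the
  product.\<close>

lemma six_choose_three: "6 * (Suc (Suc (Suc n)) choose 3) = (n + 3) * (n + 2) * (n + 1)"
proof (induction n)
  case 0 show ?case by (simp add: numeral_3_eq_3)
next
  case (Suc n)
  have "6 * (Suc (Suc (Suc (Suc n))) choose 3) = 6 * (Suc (Suc (Suc n)) choose 3) + 3 * (2 * (Suc
    (Suc (Suc n)) choose 2))"
    unfolding choose_Suc3[of "Suc (Suc (Suc n))"] by presburger
  also have "\<dots> = (n + 3) * (n + 2) * (n + 1) + 3 * ((Suc n + 2) * (Suc n + 1))"
    by (simp only: Suc.IH two_choose_two)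
  finally show ?case
    by (simp add: algebra_simps)
qed

lemma edges_K4_J4_nonempty:
  assumes "H \<in> {K4, J4}"
  shows "edges H \<noteq> {}"
proof -
  have "{1, 2, 3} \<in> edges K4"
    by (simp add: K4_def)
  moreover have "{1, 2, 5} \<in> edges J4"
    unfolding J4_def by simp (rule exI[of _ 1], rule exI[of _ 2], simp)
  ultimately show ?thesis
    using assms by auto
qed

text \<open>The sum of squares is n (n + 1) (2 n + 1) / 6, asymptotically n^3/3, so the edge bound
  divided by n^3/6 tends to 151/630 * 2.\<close>

lemma turan_density_K4_J4_le: "turan_density {K4, J4} \<le> 151 / 315"
proof -
  note nonempty = edges_K4_J4_nonempty
  have bound: "edge_density {K4, J4} n \<le>
      151 / 630 * (real n * (real n + 1) * (2 * real n + 1)) / (real n * (real n - 1) * (real n -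
        2))"
    if n: "3 \<le> n" for n
  proof -
    obtain G :: "nat hgraph" where G: "three_graph G" "finite (vertices G)" "card (vertices G) = n"
      "family_free {K4, J4} G" "card (edges G) = ex_number n {K4, J4}"
      using ex_number_attained nonempty by blast
    have "6 * (630 * int (ex_number n {K4, J4})) \<le> 151 * (int n * (int n + 1) * (2 * int n +
      1))"
      using card_edges_K4_J4_free[OF G(1,2,4)] by (simp add: G(3,5) flip: sum_squares_eq)
    then have "real_of_int (6 * (630 * int (ex_number n {K4, J4}))) \<le>
        real_of_int (151 * (int n * (int n + 1) * (2 * int n + 1)))"
      by (simp only: of_int_le_iff)
    then have *: "6 * real (ex_number n {K4, J4}) \<le> 151 / 630 * (real n * (real n + 1) * (2 *
      real n + 1))"
      by simp
    define m where "m = n - 3"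
    have m: "n = Suc (Suc (Suc m))"
      using n by (simp add: m_def)
    have choose: "6 * real (n choose 3) = real n * (real n - 1) * (real n - 2)"
      using arg_cong[OF six_choose_three[of m], of real] by (simp add: m algebra_simps)
    have "edge_density {K4, J4} n = 6 * real (ex_number n {K4, J4}) / (6 * real (n choose 3))"
      by (simp add: edge_density_def)
    also have "\<dots> \<le> 151 / 630 * (real n * (real n + 1) * (2 * real n + 1)) / (6 * real (n
      choose 3))"
      by (rule divide_right_mono[OF *]) simp
    finally show ?thesis
      by (simp only: choose)
  qed
  have "(\<lambda>n. 151 / 630 * (real n * (real n + 1) * (2 * real n + 1)) / (real n * (real n -
    1) * (real n - 2)))
      \<longlonglongrightarrow> 151 / 315"
  \<comment> \<open>The numerator and the denominator are divided by n^3.\<close>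
  proof (rule Lim_transform_eventually)
    show "(\<lambda>n. 151 / 630 * ((1 + 1 / real n) * (2 + 1 / real n)) / ((1 - 1 / real n) * (1 -
      2 * (1 / real n)))) \<longlonglongrightarrow> 151 / 315"
      by (rule tendsto_eq_intros lim_1_over_n refl | simp)+
    show "\<forall>\<^sub>F n in sequentially.
        151 / 630 * ((1 + 1 / real n) * (2 + 1 / real n)) / ((1 - 1 / real n) * (1 - 2 * (1 / real
          n))) =
        151 / 630 * (real n * (real n + 1) * (2 * real n + 1)) / (real n * (real n - 1) * (real n -
          2))"
      using eventually_ge_at_top[of 3]
    proof eventually_elim
      case (elim n)
      then show ?case
        by (simp add: divide_simps)
    qed
  qed
  from LIMSEQ_le[OF edge_density_tendsto[OF nonempty] this] show ?thesis
    using bound by blast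
qed

section \<open>The lower bound\<close>

text \<open>Row \<open>a\<close>, column \<open>b\<close> holds the third point of the Fano line
  through \<open>a\<close> and \<open>b\<close>; the lines are the translates of \<open>{0, 1,
  3}\<close> modulo 7.\<close>

definition third_point :: "nat \<Rightarrow> nat \<Rightarrow> nat" where
  "third_point a b = [[0, 3, 6, 1, 5, 4, 2], [3, 1, 4, 0, 2, 6, 5], [6, 4, 2, 5, 1, 3, 0], [1, 0,
    5, 3, 6, 2, 4], [5, 2, 1, 6, 4, 0, 3], [4, 6, 3, 2, 0, 5, 1], [2, 5, 0, 4, 3, 1, 6]] ! a ! b"

definition off_line :: "nat \<Rightarrow> nat \<Rightarrow> nat \<Rightarrow> bool" where
  "off_line a b c \<longleftrightarrow> a \<noteq> b \<and> a \<noteq> c \<and> b \<noteq> c \<and>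
    third_point a b \<noteq> c"

lemma off_line_commute:
  assumes "a < 7" "b < 7" "c < 7"
  shows "off_line a b c = off_line b a c" "off_line a b c = off_line a c b"
proof -
  have "\<forall>a\<in>set [0..<7]. \<forall>b\<in>set [0..<7]. \<forall>c\<in>set [0..<7].
      off_line a b c = off_line b a c \<and> off_line a b c = off_line a c b"
    by code_simp
  then show "off_line a b c = off_line b a c" "off_line a b c = off_line a c b"
    using assms by auto
qed

lemma third_point_involution:
  assumes "v < 7" "a < 7" "a \<noteq> v"
  shows "third_point v a < 7" "third_point v a \<noteq> v" "third_point v (third_point v a) = a"
proof -
  have "\<forall>v\<in>set [0..<7]. \<forall>a\<in>set [0..<7]. a \<noteq> v \<longrightarrow>
      third_point v a < 7 \<and> third_point v a \<noteq> v \<and> third_point v (third_point v a)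
        = a"
    by code_simp
  then show "third_point v a < 7" "third_point v a \<noteq> v" "third_point v (third_point v a) = a"
    using assms by auto
qed

lemma third_point_neq:
  assumes "v < 7" "a < 7" "a \<noteq> v"
  shows "third_point v a \<noteq> a"
proof -
  have "\<forall>v\<in>set [0..<7]. \<forall>a\<in>set [0..<7]. a \<noteq> v \<longrightarrow>
    third_point v a \<noteq> a"
    by code_simp
  then show ?thesis
    using assms by auto
qed

text \<open>The lines through \<open>v\<close> pair up the six other points, and two points of a
  pair are not joined in the link of \<open>v\<close>, so at most three points of the link are
  pairwise joined.\<close>

lemma off_line_link_K4_free:
  assumes lt: "v < 7" "a < 7" "b < 7" "c < 7" "d < 7"
    and off: "off_line v a b" "off_line v a c" "off_line v a d" "off_line v b c" "off_line v b d"
      "off_line v c d"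
  shows False
proof -
  let ?S = "{a, b, c, d}" and ?t = "third_point v"
  have S: "card ?S = 4" "\<And>x. x \<in> ?S \<Longrightarrow> x < 7 \<and> x \<noteq> v"
    using lt off by (auto simp: off_line_def)
  have "inj_on ?t ?S"
    by (rule inj_on_inverseI[of _ ?t]) (use S(2) third_point_involution(3)[OF lt(1)] in blast)
  then have "card (?t ` ?S) = 4"
    using S(1) by (simp only: card_image)
  moreover have "?S \<inter> ?t ` ?S = {}"
  proof -
    have "off_line v x y" if "x \<in> ?S" "y \<in> ?S" "x \<noteq> y" for x y
      using that off lt off_line_commute by auto
    then have "?t x \<noteq> y" if "x \<in> ?S" "y \<in> ?S" for x y
      using that S(2) third_point_neq[OF lt(1)] by (cases "x = y") (auto simp: off_line_def)
    then show ?thesis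
      by blast
  qed
  \<comment> \<open>Four pairwise joined points and their four partners would be eight of the seven
    points.\<close>
  ultimately have "card (?S \<union> ?t ` ?S) = 8"
    using S(1) by (subst card_Un_disjoint) auto
  moreover have "card (?S \<union> ?t ` ?S) \<le> card {..<7 :: nat}"
  proof (rule card_mono)
    show "?S \<union> ?t ` ?S \<subseteq> {..<7}"
      using S(2) third_point_involution(1)[OF lt(1)] by blast
  qed simp
  ultimately show False
    by simp
qed

text \<open>The 35 - 7 = 28 triples that are not lines, each in its six orders.\<close>

lemma card_off_line: "(\<Sum>a<7. \<Sum>b<7. \<Sum>c<7. of_bool (off_line a b c)) = (168 :: nat)"
proof -
  have "sum_list (map (\<lambda>a. sum_list (map (\<lambda>b. sum_list (map (\<lambda>c. of_bool
    (off_line a b c)) [0..<7])) [0..<7])) [0..<7])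
      = (168 :: nat)"
    by code_simp
  then show ?thesis
    by (simp add: interv_sum_list_conv_sum_set_nat atLeast0LessThan)
qed

text \<open>The iterated blow-up of the complement of the Fano plane, on the \<open>7\<close>-adic
  strings of length \<open>k\<close>.\<close>

fun fano_adj :: "nat \<Rightarrow> nat \<Rightarrow> nat \<Rightarrow> nat \<Rightarrow> bool" where
  "fano_adj 0 x y z = False"
| "fano_adj (Suc k) x y z =
     (if x mod 7 = y mod 7 \<and> y mod 7 = z mod 7 then fano_adj k (x div 7) (y div 7) (z div 7)
      else off_line (x mod 7) (y mod 7) (z mod 7))"

lemma fano_adj_commute: "fano_adj k x y z = fano_adj k y x z" "fano_adj k x y z = fano_adj k x z y"
proof (induction k arbitrary: x y z)
  case (Suc k)
  { case 1 show ?case using Suc.IH(1)[of "x div 7" "y div 7" "z div 7"] off_line_commute(1)[of "x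
    mod 7" "y mod 7" "z mod 7"] by auto }
  { case 2 show ?case using Suc.IH(2)[of "x div 7" "y div 7" "z div 7"] off_line_commute(2)[of "x
    mod 7" "y mod 7" "z mod 7"] by auto }
qed simp_all

lemma fano_adj_distinct: "fano_adj k x y z \<Longrightarrow> x \<noteq> y \<and> x \<noteq> z
  \<and> y \<noteq> z"
  by (induction k arbitrary: x y z) (auto simp: off_line_def split: if_splits)

text \<open>If some \<open>a\<close> lies in the part of \<open>v\<close> then so do
  \<open>b\<close>, \<open>c\<close>, \<open>d\<close>, since no edge has exactly two vertices in a
  part.\<close>

lemma fano_adj_link_K4_free:
  assumes "fano_adj k v a b" "fano_adj k v a c" "fano_adj k v a d" "fano_adj k v b c"
    "fano_adj k v b d" "fano_adj k v c d"
  shows False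
  using assms
proof (induction k arbitrary: v a b c d)
  case (Suc k)
  have part: "x mod 7 = v mod 7 \<longleftrightarrow> y mod 7 = v mod 7" if "fano_adj (Suc k) v x
    y" for x y
    using that by (auto simp: off_line_def split: if_splits)
  have inner: "fano_adj k (v div 7) (x div 7) (y div 7)"
    if "fano_adj (Suc k) v x y" "x mod 7 = v mod 7" for x y
    using that by (simp add: off_line_def split: if_splits)
  have outer: "off_line (v mod 7) (x mod 7) (y mod 7)"
    if "fano_adj (Suc k) v x y" "x mod 7 \<noteq> v mod 7" for x y
    using that by (simp split: if_splits)
  note iff = part[OF Suc.prems(1)] part[OF Suc.prems(2)] part[OF Suc.prems(3)]
  show ?case
  proof (cases "a mod 7 = v mod 7")
    case True
    then have "b mod 7 = v mod 7" "c mod 7 = v mod 7"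
      using iff by simp_all
    with True show ?thesis
      by (intro Suc.IH[OF inner inner inner inner inner inner, OF Suc.prems(1) _ Suc.prems(2) _
        Suc.prems(3) _
        Suc.prems(4) _ Suc.prems(5) _ Suc.prems(6)])
  next
    case False
    then have b: "b mod 7 \<noteq> v mod 7" and c: "c mod 7 \<noteq> v mod 7"
      using iff by simp_all
    \<comment> \<open>Here the residues modulo 7 would form a complete graph on four points in a
      link of the complement of the Fano plane.\<close>
    show ?thesis
      by (rule off_line_link_K4_free[OF _ _ _ _ _ outer[OF Suc.prems(1) False] outer[OF
        Suc.prems(2) False]
        outer[OF Suc.prems(3) False] outer[OF Suc.prems(4) b] outer[OF Suc.prems(5) b] outer[OF
          Suc.prems(6) c]])
        simp_all
  qed
qed simp

definition fano_graph :: "nat \<Rightarrow> nat hgraph" where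
  "fano_graph k = \<lparr>vertices = {..<7 ^ k},
     edges = {{x, y, z} | x y z. x < 7 ^ k \<and> y < 7 ^ k \<and> z < 7 ^ k \<and> fano_adj k x y
       z}\<rparr>"

lemma three_graph_fano_graph: "three_graph (fano_graph k)"
  by (auto simp: three_graph_def fano_graph_def card_insert_if dest!: fano_adj_distinct)

text \<open>An edge is a set and forgets the order of the witnesses; distinctness leaves six orders,
  and \<open>fano_adj\<close> does not distinguish them.\<close>

lemma adj_fano_graph: "adj (fano_graph k) x y z \<Longrightarrow> fano_adj k x y z"
proof -
  assume "adj (fano_graph k) x y z"
  then obtain x' y' z' where *: "{x, y, z} = {x', y', z'}" "fano_adj k x' y' z'"
    by (auto simp: adj_def fano_graph_def)
  then have "x' \<noteq> y' \<and> x' \<noteq> z' \<and> y' \<noteq> z'"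
    by (auto dest: fano_adj_distinct)
  moreover have "x \<in> {x', y', z'}" "y \<in> {x', y', z'}" "z \<in> {x', y', z'}"
    using *(1) by blast+
  moreover have "x' \<in> {x, y, z}" "y' \<in> {x, y, z}" "z' \<in> {x, y, z}"
    using *(1) by blast+
  ultimately have "(x, y, z) \<in> {(x', y', z'), (x', z', y'), (y', x', z'), (y', z', x'), (z',
    x', y'), (z', y', x')}"
    unfolding insert_iff empty_iff Pair_inject simp_thms by metis
  then show "fano_adj k x y z"
    using *(2) fano_adj_commute by auto
qed

lemma J4_free_fano_graph: "family_free {J4} (fano_graph k)"
proof -
  have "\<not> contains_copy (fano_graph k) J4"
  proof
    assume "contains_copy (fano_graph k) J4"
    then show False
      by (rule adj_of_J4_copy) (blast dest: adj_fano_graph fano_adj_link_K4_free)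
  qed
  then show ?thesis
    by (simp add: family_free_def)
qed

section \<open>Counting the edges of the iterated blow-up\<close>

lemma sum_lessThan_mult:
  fixes h :: "nat \<Rightarrow> 'a :: comm_monoid_add"
  assumes "0 < m"
  shows "(\<Sum>x<m * n. h x) = (\<Sum>r<m. \<Sum>q<n. h (m * q + r))"
proof -
  have "(\<Sum>x<m * n. h x) = (\<Sum>(r, q)\<in>{..<m} \<times> {..<n}. h (m * q + r))"
  proof (rule sum.reindex_bij_witness[of _ "\<lambda>(r, q). m * q + r" "\<lambda>x. (x mod m, x
    div m)"])
    fix p assume "p \<in> {..<m} \<times> {..<n}"
    then obtain r q where p: "p = (r, q)" "r < m" "Suc q \<le> n"
      by (auto simp: Suc_le_eq)
    then have "m * q + r < m * Suc q" "m * Suc q \<le> m * n"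
      by (simp, intro mult_le_mono) simp_all
    then have "m * q + r < m * n"
      by (rule less_le_trans)
    then show "(case p of (r, q) \<Rightarrow> m * q + r) \<in> {..<m * n}"
      by (simp add: p(1))
  qed (use assms in \<open>auto simp: less_mult_imp_div_less mult.commute\<close>)
  then show ?thesis
    by (simp add: sum.cartesian_product)
qed

definition fano_count :: "nat \<Rightarrow> nat" where
  "fano_count k = (\<Sum>x<7 ^ k. \<Sum>y<7 ^ k. \<Sum>z<7 ^ k. of_bool (fano_adj k x y z))"

text \<open>Split off the lowest digits of the three vertices. If they agree, 7 choices, the
  previous level recurs; if they form one of the 168 ordered non-lines, the remaining digits are
  arbitrary, 343^k choices; otherwise there is no edge.\<close>

lemma fano_count_Suc: "fano_count (Suc k) = 7 * fano_count k + 168 * 343 ^ k"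
proof -
  let ?N = "7 ^ k :: nat"
  have eq: "(\<Sum>x<?N. \<Sum>y<?N. \<Sum>z<?N. of_bool (fano_adj (Suc k) (7 * x + a) (7 * y + b)
    (7 * z + c))) =
      (if a = b \<and> b = c then fano_count k else 0) + 343 ^ k * of_bool (off_line a b c)"
    if "a < 7" "b < 7" "c < 7" for a b c :: nat
  proof (cases "a = b \<and> b = c")
    case True
    then show ?thesis
      using that by (simp add: fano_count_def off_line_def)
  next
    case False
    have "(343 :: nat) ^ k = 7 ^ k * (7 ^ k * 7 ^ k)"
      by (simp flip: power_mult_distrib)
    then show ?thesis
      using False that by auto
  qed
  have swap: "(\<Sum>a<7. \<Sum>x<?N. \<Sum>b<7. \<Sum>y<?N. \<Sum>c<7. \<Sum>z<?N. h a x b y c z) =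
      (\<Sum>a<7. \<Sum>b<7. \<Sum>c<7. \<Sum>x<?N. \<Sum>y<?N. \<Sum>z<?N. h a x b y c z)"
    for h :: "nat \<Rightarrow> nat \<Rightarrow> nat \<Rightarrow> nat \<Rightarrow> nat
      \<Rightarrow> nat \<Rightarrow> nat"
  proof -
    have "(\<Sum>x<?N. \<Sum>b<7. \<Sum>y<?N. \<Sum>c<7. \<Sum>z<?N. h a x b y c z) =
        (\<Sum>b<7. \<Sum>c<7. \<Sum>x<?N. \<Sum>y<?N. \<Sum>z<?N. h a x b y c z)" for a
    proof -
      have "(\<Sum>x<?N. \<Sum>b<7. \<Sum>y<?N. \<Sum>c<7. \<Sum>z<?N. h a x b y c z) =
          (\<Sum>x<?N. \<Sum>b<7. \<Sum>c<7. \<Sum>y<?N. \<Sum>z<?N. h a x b y c z)"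
        by (intro sum.cong refl sum.swap)
      also have "\<dots> = (\<Sum>b<7. \<Sum>x<?N. \<Sum>c<7. \<Sum>y<?N. \<Sum>z<?N. h a x b y c
        z)"
        by (rule sum.swap)
      also have "\<dots> = (\<Sum>b<7. \<Sum>c<7. \<Sum>x<?N. \<Sum>y<?N. \<Sum>z<?N. h a x b y c
        z)"
        by (intro sum.cong refl sum.swap)
      finally show ?thesis .
    qed
    then show ?thesis
      by simp
  qed
  have "fano_count (Suc k) = (\<Sum>a<7. \<Sum>b<7. \<Sum>c<7. \<Sum>x<?N. \<Sum>y<?N. \<Sum>z<?N.
      of_bool (fano_adj (Suc k) (7 * x + a) (7 * y + b) (7 * z + c)))"
    unfolding fano_count_def power_Suc by (simp only: sum_lessThan_mult zero_less_numeral swap)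
  also have "\<dots> = (\<Sum>a<7. \<Sum>b<7. \<Sum>c<7. (if a = b \<and> b = c then fano_count k
    else 0) + 343 ^ k * of_bool (off_line a b c))"
    by (intro sum.cong refl eq) auto
  also have "\<dots> = (\<Sum>a<7::nat. \<Sum>b<7::nat. \<Sum>c<7::nat. if a = b \<and> b = c then
    fano_count k else 0) +
      343 ^ k * (\<Sum>a<7. \<Sum>b<7. \<Sum>c<7. of_bool (off_line a b c))"
    by (simp only: sum.distrib sum_distrib_left)
  also have "(\<Sum>a<7::nat. \<Sum>b<7::nat. \<Sum>c<7::nat. if a = b \<and> b = c then fano_count
    k else 0) = 7 * fano_count k"
    by (simp add: numeral_eq_Suc)
  finally show ?thesis
    by (simp only: card_off_line mult.commute[of 168])
qed

text \<open>Of the N^3 - N nonconstant triples, where N = 7^k, exactly half are ordered edges: at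
  the lowest digit where a triple is not constant, 168 of the 336 possible digit triples give an
  edge.\<close>

lemma fano_count_eq: "2 * fano_count k + 7 ^ k = 343 ^ k"
proof (induction k)
  case 0
  show ?case by (simp add: fano_count_def)
next
  case (Suc k)
  then show ?case by (simp add: fano_count_Suc)
qed

text \<open>The map from ordered triples to edges has fibres of at most six elements.\<close>

lemma fano_count_le: "fano_count k \<le> 6 * card (edges (fano_graph k))"
proof -
  let ?N = "7 ^ k :: nat"
  let ?S = "{(x, y, z). x < ?N \<and> y < ?N \<and> z < ?N \<and> fano_adj k x y z}"
  let ?D = "edges (fano_graph k)"
  have finD: "finite ?D"
    using finite_edges[OF three_graph_fano_graph] by (simp add: fano_graph_def)
  have sub: "?S \<subseteq> {..<?N} \<times> {..<?N} \<times> {..<?N}"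
    by auto
  then have finS: "finite ?S"
    by (rule finite_subset) simp
  have "fano_count k = (\<Sum>x<?N. \<Sum>(y, z)\<in>{..<?N} \<times> {..<?N}. of_bool (fano_adj k
    x y z))"
    unfolding fano_count_def by (intro sum.cong refl sum.cartesian_product)
  also have "\<dots> = (\<Sum>(x, y, z)\<in>{..<?N} \<times> {..<?N} \<times> {..<?N}. of_bool
    (fano_adj k x y z))"
    by (rule sum.cartesian_product)
  also have "\<dots> = card ?S"
    by (simp add: of_bool_def case_prod_unfold sum.If_cases) (rule arg_cong[of _ _ card], auto)
  also have "?S \<subseteq> (\<Union>e\<in>?D. {(x, y, z). e = {x, y, z} \<and> fano_adj k x y z})"
    by (auto simp: fano_graph_def)
  then have "card ?S \<le> card (\<Union>e\<in>?D. {(x, y, z). e = {x, y, z} \<and> fano_adj k x y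
    z} \<inter> ?S)"
    by (intro card_mono[OF finite_subset[OF _ finS]]) blast+
  also have "\<dots> \<le> (\<Sum>e\<in>?D. card ({(x, y, z). e = {x, y, z} \<and> fano_adj k x y
    z} \<inter> ?S))"
    by (rule card_UN_le[OF finD])
  also have "\<dots> \<le> (\<Sum>e\<in>?D. 6)"
  proof (rule sum_mono)
    fix e
    assume "e \<in> ?D"
    then obtain x y z where e: "e = {x, y, z}"
      by (auto simp: fano_graph_def)
    have "{(x, y, z). e = {x, y, z} \<and> fano_adj k x y z} \<inter> ?S
        \<subseteq> set [(x, y, z), (x, z, y), (y, x, z), (y, z, x), (z, x, y), (z, y, x)]"
    proof
      fix t
      assume "t \<in> {(x, y, z). e = {x, y, z} \<and> fano_adj k x y z} \<inter> ?S"
      then obtain a b c where t: "t = (a, b, c)" "{a, b, c} = {x, y, z}" "fano_adj k a b c"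
        using e by auto
      then have "a \<noteq> b \<and> a \<noteq> c \<and> b \<noteq> c"
        by (auto dest: fano_adj_distinct)
      moreover have "a \<in> {x, y, z}" "b \<in> {x, y, z}" "c \<in> {x, y, z}"
        using t(2) by auto
      ultimately show "t \<in> set [(x, y, z), (x, z, y), (y, x, z), (y, z, x), (z, x, y), (z, y,
        x)]"
        using t(1) by auto
    qed
    from card_mono[OF finite_set this] show "card ({(x, y, z). e = {x, y, z} \<and> fano_adj k x y
      z} \<inter> ?S) \<le> 6"
      using card_length[of "[(x, y, z), (x, z, y), (y, x, z), (y, z, x), (z, x, y), (z, y, x)]"] by
        simp
  qed
  finally show ?thesis
    by simp
qed

text \<open>There are at least (N^3 - N)/12 edges, and N choose 3 is at most (N^3 - N)/6 because N -
  2 is less than N + 1. So 1/2 is reached at each finite level, not just in the limit.\<close>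

lemma half_le_edge_density:
  assumes "1 \<le> k"
  shows "1 / 2 \<le> edge_density {J4} (7 ^ k)"
proof -
  define N where "N = (7 :: nat) ^ k"
  have N: "7 \<le> N"
    using power_increasing[OF assms, of "7 :: nat"] by (simp add: N_def)
  define m where "m = N - 3"
  have m: "N = Suc (Suc (Suc m))"
    using N by (simp add: m_def)
  have choose: "6 * real (N choose 3) = real N * (real N - 1) * (real N - 2)"
    using arg_cong[OF six_choose_three[of m], of real] by (simp add: m algebra_simps)
  have "card (edges (fano_graph k)) \<le> ex_number N {J4}"
    using le_ex_number[OF three_graph_fano_graph _ J4_free_fano_graph, of k] by (simp add:
      fano_graph_def N_def)
  then have "fano_count k \<le> 6 * ex_number N {J4}"
    using fano_count_le[of k] by linarith
  moreover have "343 ^ k = N ^ 3"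
    using power_mult[of "7 :: nat" 3 k] power_mult[of "7 :: nat" k 3] by (simp add: N_def
      mult.commute)
  ultimately have "N ^ 3 \<le> 12 * ex_number N {J4} + N"
    using fano_count_eq[of k] by (simp add: N_def)
  then have "real (N ^ 3) \<le> real (12 * ex_number N {J4} + N)"
    by (simp only: of_nat_le_iff)
  then have "real N ^ 3 \<le> 12 * real (ex_number N {J4}) + real N"
    by simp
  moreover have "real N * (real N - 1) * (real N - 2) \<le> real N ^ 3 - real N"
    using N by (simp add: power3_eq_cube algebra_simps)
  ultimately have "6 * real (N choose 3) \<le> 2 * (6 * real (ex_number N {J4}))"
    by (simp add: choose)
  moreover have "0 < N choose 3"
    using N by (simp add: zero_less_binomial_iff)
  ultimately show ?thesis
    by (simp add: edge_density_def N_def[symmetric] field_simps)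
qed

lemma half_le_turan_density_J4: "1 / 2 \<le> turan_density {J4}"
proof (rule LIMSEQ_le_const)
  have ne: "edges H \<noteq> {}" if "H \<in> {J4}" for H
    using that edges_K4_J4_nonempty by simp
  show "edge_density {J4} \<longlonglongrightarrow> turan_density {J4}"
    by (rule edge_density_tendsto[OF ne])
  show "\<exists>n0. \<forall>n\<ge>n0. 1 / 2 \<le> edge_density {J4} n"
  proof (intro exI allI impI)
    fix n :: nat
    assume n: "3 \<le> n"
    \<comment> \<open>Edge densities do not increase with the number of vertices, so the density at
      7^n bounds the one at n from below.\<close>
    have "n \<le> 7 ^ n"
      by (rule less_imp_le[OF less_le_trans[OF less_exp]]) (simp add: power_mono)
    then have "edge_density {J4} (7 ^ n) \<le> edge_density {J4} n"
      by (intro edge_density_antimono ne n)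
    then show "1 / 2 \<le> edge_density {J4} n"
      using half_le_edge_density[of n] n by linarith
  qed
qed

theorem theorem12:
  shows "turan_density {K4, J4} < 0.479371 \<and> (0.479371 :: real) < 1 / 2 \<and> 1 / 2 \<le>
    turan_density {J4}"
  using turan_density_K4_J4_le half_le_turan_density_J4 by simp

end
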